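(* The polynomial $\mathcal P_{34}=\prod_{j=1}^6F_j$ on $\mathfrak k_A$ is invariant under $\operatorname{Ad}_{g_\theta}$ for all $\theta\in\mathbb R$, is homogeneous of degree $34$, and satisfies $$\{Z\in\mathfrak k_A:L_Z\neq\mathfrak g_2\}=\{\mathcal P_{34}=0\},\qquad \{Z\in\mathfrak k_A:L_Z=\mathfrak g_2\}=\{\mathcal P_{34}>0\}.$$ In particular, the nongenerating set $\{Z\in\mathfrak k_A:L_Z\neq\mathfrak g_2\}$ is real algebraic, and its complement is a nonempty real Zariski-open subset of $\mathfrak k_A$.
   Context: Octonions: $\mathbb O$ has real basis $1,e_1,\dots,e_7$ with $1$ the identity, $e_i^2=-1$, and multiplication given by the oriented triples $(123),(145),(176),(246),(257),(347),(365)$: for a triple $(abc)$, $e_ae_b=e_c$, $e_be_c=e_a$, $e_ce_a=e_b$, and reversing the order changes the sign. $V=\operatorname{Im}\mathbb O$. $G_2=\operatorname{Aut}(\mathbb O)$, $\mathfrak g_2=\operatorname{Der}(\mathbb O)$, acting on $V$; $\operatorname{Ad}_gZ=gZg^{-1}$. $D_{ij}=D_{e_i,e_j}\in\mathfrak g_2$ with $D_{a,b}(x)=[[a,b],x]-3[a,b,x]$, $[a,b]=ab-ba$, $[a,b,x]=(ab)x-a(bx)$. $H_A=\operatorname{span}\{1,e_1,e_2,e_3\}$ and $\mathfrak k_A=\{Z\in\mathfrak g_2:Z(H_A)\subseteq H_A\}$, with basis $D_{12},D_{13},D_{23},D_{45},D_{46},D_{47}$. $S\in G_2$ is the involution $S(e_1)=e_1$,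 $e_2\leftrightarrow e_4$, $e_3\leftrightarrow e_5$, $S(e_6)=-e_6$, $S(e_7)=-e_7$. $L_Z$ is the smallest real Lie subalgebra containing $Z$ and $SZS^{-1}$. The residual circle is $g_\theta=\exp(\tfrac\theta2(D_{23}+D_{45}))$, $\theta\in\mathbb R$; $\operatorname{Ad}_{g_\theta}$ preserves $\mathfrak k_A$. Coordinates: write $Z=x_0D_{12}+x_1D_{13}+x_2D_{23}+x_3D_{45}+x_4D_{46}+x_5D_{47}$ and put $(a_1,a_2,a_3)=(2x_2-x_3,-2x_1-x_4,2x_0-x_5)$, $(b_1,b_2,b_3)=3(x_3,x_4,x_5)$, $a=a_1$, $d=b_1$, $q=a_2+ia_3\in\mathbb C$, $p=b_2+ib_3\in\mathbb C$. With $q^\ast$ the complex conjugate of $q$, let $u=|q|^2$, $v=|p|^2$, $R+iI=p(q^\ast)^3$ ($R,I$ real), $\rho=a^2+d^2+u+v$, $\delta=a^2+u-d^2-v$, $\Theta=u\bigl((2v+3u)a-3ud\bigr)-(a+d)R$, and $F_1=u$, $F_2=a^2\rho+(d^2+v-u)^2$, $F_3=(a+d)^2\rho+(v-u)^2$, $F_4=(a^2+d^2)\rho^3+I^2$, $F_5=(d-3a)^2\rho^2+|up-3q^3|^2$, $F_6=\delta^2\rho^3+I^2\rho+\Theta^2$. *)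

theory Defs
  imports "HOL-Analysis.Analysis"
begin

text \<open>
  An octonion is a vector of type \<^typ>\<open>real ^ 8\<close>. In the index type \<^typ>\<open>8\<close> we have
  \<^prop>\<open>(8::8) = 0\<close>, so the indices are \<open>0, 1, ..., 7\<close>; index \<open>0\<close> belongs to the unit
  and index \<open>i > 0\<close> to \<open>e\<^sub>i\<close>.
\<close>

type_synonym octonion = "real ^ 8"

abbreviation oct_e :: "8 \<Rightarrow> octonion" where
  "oct_e i \<equiv> axis i 1"

definition oct_triples :: "(8 \<times> 8 \<times> 8) set" where
  "oct_triples = {(1,2,3), (1,4,5), (1,7,6), (2,4,6), (2,5,7), (3,4,7), (3,6,5)}"

definition oct_oriented :: "8 \<Rightarrow> 8 \<Rightarrow> 8 \<Rightarrow> bool" where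
  "oct_oriented i j k \<longleftrightarrow>
     (i,j,k) \<in> oct_triples \<or> (j,k,i) \<in> oct_triples \<or> (k,i,j) \<in> oct_triples"

text \<open>\<open>oct_coeff i j k\<close> is the coefficient of \<open>e\<^sub>k\<close> in \<open>e\<^sub>i e\<^sub>j\<close>, where \<open>e\<^sub>0 = 1\<close>.\<close>

definition oct_coeff :: "8 \<Rightarrow> 8 \<Rightarrow> 8 \<Rightarrow> real" where
  "oct_coeff i j k =
     (if i = 0 then (if k = j then 1 else 0)
      else if j = 0 then (if k = i then 1 else 0)
      else if i = j then (if k = 0 then -1 else 0)
      else if oct_oriented i j k then 1
      else if oct_oriented j i k then -1
      else 0)"

definition oct_mult :: "octonion \<Rightarrow> octonion \<Rightarrow> octonion"  (infixl "\<star>" 70) where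
  "x \<star> y = (\<chi> k. \<Sum>i\<in>UNIV. \<Sum>j\<in>UNIV. oct_coeff i j k * x $ i * y $ j)"

definition oct_commutator :: "octonion \<Rightarrow> octonion \<Rightarrow> octonion" where
  "oct_commutator a b = a \<star> b - b \<star> a"

definition oct_associator :: "octonion \<Rightarrow> octonion \<Rightarrow> octonion \<Rightarrow> octonion" where
  "oct_associator a b x = (a \<star> b) \<star> x - a \<star> (b \<star> x)"

text \<open>
  Endomorphisms are represented by their matrices with respect to \<open>1, e\<^sub>1, ..., e\<^sub>7\<close>.
  Derivations kill \<open>1\<close> and preserve the imaginary part, and automorphisms fix \<open>1\<close> and
  preserve the imaginary part, so nothing is lost or added by letting them act on all
  octonions instead of the imaginary ones.
\<close>

type_synonym oct_endo = "real ^ 8 ^ 8"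

definition lie_bracket :: "oct_endo \<Rightarrow> oct_endo \<Rightarrow> oct_endo" where
  "lie_bracket X Y = X ** Y - Y ** X"

definition lie_subalgebra :: "oct_endo set \<Rightarrow> bool" where
  "lie_subalgebra L \<longleftrightarrow> subspace L \<and> (\<forall>X\<in>L. \<forall>Y\<in>L. lie_bracket X Y \<in> L)"

definition Ad :: "oct_endo \<Rightarrow> oct_endo \<Rightarrow> oct_endo" where
  "Ad g Z = g ** Z ** matrix_inv g"

definition endo_exp :: "oct_endo \<Rightarrow> oct_endo" where
  "endo_exp X = (\<Sum>n. (1 / fact n) *\<^sub>R (((**) X) ^^ n) (mat 1))"

definition g2 :: "oct_endo set" where
  "g2 = {Z. \<forall>x y. Z *v (x \<star> y) = (Z *v x) \<star> y + x \<star> (Z *v y)}"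

definition oct_D :: "octonion \<Rightarrow> octonion \<Rightarrow> oct_endo" where
  "oct_D a b =
     matrix (\<lambda>x. oct_commutator (oct_commutator a b) x - 3 *\<^sub>R oct_associator a b x)"

abbreviation D_ij :: "8 \<Rightarrow> 8 \<Rightarrow> oct_endo" where
  "D_ij i j \<equiv> oct_D (oct_e i) (oct_e j)"

definition H_A :: "octonion set" where
  "H_A = span {oct_e 0, oct_e 1, oct_e 2, oct_e 3}"

definition k_A :: "oct_endo set" where
  "k_A = {Z \<in> g2. \<forall>x\<in>H_A. Z *v x \<in> H_A}"

definition oct_S :: oct_endo where
  "oct_S = matrix (\<lambda>x.
     x$0 *\<^sub>R oct_e 0 + x$1 *\<^sub>R oct_e 1
     + x$2 *\<^sub>R oct_e 4 + x$4 *\<^sub>R oct_e 2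
     + x$3 *\<^sub>R oct_e 5 + x$5 *\<^sub>R oct_e 3
     - x$6 *\<^sub>R oct_e 6 - x$7 *\<^sub>R oct_e 7)"

definition L_gen :: "oct_endo \<Rightarrow> oct_endo set" where
  "L_gen Z = lie_subalgebra hull {Z, Ad oct_S Z}"

definition g_res :: "real \<Rightarrow> oct_endo" where
  "g_res \<theta> = endo_exp ((\<theta> / 2) *\<^sub>R (D_ij 2 3 + D_ij 4 5))"

text \<open>
  \<open>kA_elem\<close> is the linear parametrisation of \<open>k_A\<close> by the basis
  \<open>D\<^sub>1\<^sub>2, D\<^sub>1\<^sub>3, D\<^sub>2\<^sub>3, D\<^sub>4\<^sub>5, D\<^sub>4\<^sub>6, D\<^sub>4\<^sub>7\<close>. Its inverse \<open>kA_coords\<close> is meaningful on \<open>k_A\<close> only.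
  The indices of \<^typ>\<open>real ^ 6\<close> are \<open>0, ..., 5\<close>.
\<close>

definition kA_elem :: "real ^ 6 \<Rightarrow> oct_endo" where
  "kA_elem x = x$0 *\<^sub>R D_ij 1 2 + x$1 *\<^sub>R D_ij 1 3 + x$2 *\<^sub>R D_ij 2 3
             + x$3 *\<^sub>R D_ij 4 5 + x$4 *\<^sub>R D_ij 4 6 + x$5 *\<^sub>R D_ij 4 7"

definition kA_coords :: "oct_endo \<Rightarrow> real ^ 6" where
  "kA_coords = inv kA_elem"

definition a_c :: "real ^ 6 \<Rightarrow> real" where
  "a_c x = 2 * x$2 - x$3"

definition d_c :: "real ^ 6 \<Rightarrow> real" where
  "d_c x = 3 * x$3"

definition q_c :: "real ^ 6 \<Rightarrow> complex" where
  "q_c x = Complex (- 2 * x$1 - x$4) (2 * x$0 - x$5)"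

definition p_c :: "real ^ 6 \<Rightarrow> complex" where
  "p_c x = Complex (3 * x$4) (3 * x$5)"

definition u_c :: "real ^ 6 \<Rightarrow> real" where
  "u_c x = (cmod (q_c x))\<^sup>2"

definition v_c :: "real ^ 6 \<Rightarrow> real" where
  "v_c x = (cmod (p_c x))\<^sup>2"

definition R_c :: "real ^ 6 \<Rightarrow> real" where
  "R_c x = Re (p_c x * cnj (q_c x) ^ 3)"

definition I_c :: "real ^ 6 \<Rightarrow> real" where
  "I_c x = Im (p_c x * cnj (q_c x) ^ 3)"

definition rho_c :: "real ^ 6 \<Rightarrow> real" where
  "rho_c x = (a_c x)\<^sup>2 + (d_c x)\<^sup>2 + u_c x + v_c x"

definition delta_c :: "real ^ 6 \<Rightarrow> real" where
  "delta_c x = (a_c x)\<^sup>2 + u_c x - (d_c x)\<^sup>2 - v_c x"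

definition Theta_c :: "real ^ 6 \<Rightarrow> real" where
  "Theta_c x = u_c x * ((2 * v_c x + 3 * u_c x) * a_c x - 3 * u_c x * d_c x)
             - (a_c x + d_c x) * R_c x"

definition F1 :: "real ^ 6 \<Rightarrow> real" where
  "F1 x = u_c x"

definition F2 :: "real ^ 6 \<Rightarrow> real" where
  "F2 x = (a_c x)\<^sup>2 * rho_c x + ((d_c x)\<^sup>2 + v_c x - u_c x)\<^sup>2"

definition F3 :: "real ^ 6 \<Rightarrow> real" where
  "F3 x = (a_c x + d_c x)\<^sup>2 * rho_c x + (v_c x - u_c x)\<^sup>2"

definition F4 :: "real ^ 6 \<Rightarrow> real" where
  "F4 x = ((a_c x)\<^sup>2 + (d_c x)\<^sup>2) * rho_c x ^ 3 + (I_c x)\<^sup>2"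

definition F5 :: "real ^ 6 \<Rightarrow> real" where
  "F5 x = (d_c x - 3 * a_c x)\<^sup>2 * (rho_c x)\<^sup>2
        + (cmod (complex_of_real (u_c x) * p_c x - 3 * q_c x ^ 3))\<^sup>2"

definition F6 :: "real ^ 6 \<Rightarrow> real" where
  "F6 x = (delta_c x)\<^sup>2 * rho_c x ^ 3 + (I_c x)\<^sup>2 * rho_c x + (Theta_c x)\<^sup>2"

definition P34 :: "oct_endo \<Rightarrow> real" where
  "P34 Z = (let x = kA_coords Z in F1 x * F2 x * F3 x * F4 x * F5 x * F6 x)"

text \<open>
  Since the reals are infinite, polynomials are identified with the functions they induce.
  A homogeneous polynomial of degree \<open>n\<close> is a linear combination of the finitely many
  monomials of total degree \<open>n\<close>.
\<close>

definition homogeneous_polynomial :: "nat \<Rightarrow> (real ^ 'n \<Rightarrow> real) \<Rightarrow> bool" where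
  "homogeneous_polynomial n f \<longleftrightarrow>
     (\<exists>c. \<forall>x. f x = (\<Sum>m | (\<Sum>i\<in>UNIV. m i) = n. c m * (\<Prod>i\<in>UNIV. x $ i ^ m i)))"

text \<open>
  Polynomial functions on a linear subspace \<open>V\<close> are exactly the restrictions to \<open>V\<close> of
  polynomial functions on the ambient space.
\<close>

definition real_algebraic_in :: "'a::real_normed_vector set \<Rightarrow> 'a set \<Rightarrow> bool" where
  "real_algebraic_in V A \<longleftrightarrow>
     (\<exists>P. finite P \<and> (\<forall>p\<in>P. real_polynomial_function p) \<and> A = {x \<in> V. \<forall>p\<in>P. p x = 0})"

definition real_zariski_open_in :: "'a::real_normed_vector set \<Rightarrow> 'a set \<Rightarrow> bool" where
  "real_zariski_open_in V U \<longleftrightarrow> U \<subseteq> V \<and> real_algebraic_in V (V - U)"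

end

(*
  Write g2 as su(3) + C^3 for the complex structure e1 on the imaginary octonions. Let L be a
  subalgebra of g2. If any two commuting elements of L are proportional, then its root
  decomposition shows dim L <= 3. Otherwise L contains a conjugate of a Cartan subalgebra, and the
  closed subsystems of the root system show that L is g2, or kills a nonzero imaginary octonion, or
  preserves an associative 3-plane. For L = L_Z the three proper cases are solved in coordinates:
  q = 0, F2 = 0 and F3 = 0 come from vectors killed by Z and SZS, F4 = 0, F5 = 0 and F6 = 0 from
  invariant associative planes (F6 = 0 also from one kind of common kernel vector), and L_Z of
  dimension at most 3 gives nothing new. An invariant associative plane may be taken stable under S;
  it then contains an explicit vector n fixed by S, and it is spanned by n, Zn and their product, so
  that its existence is a polynomial condition.
*)

theory Submission
  imports Defs
begin

section \<open>Octonions in complex coordinates\<close>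

text \<open>Subalgebras of dimension at most 3 need their own test: the principal
  \<open>su(2)\<close> in g2 acts irreducibly on the imaginary octonions, so it is detected neither
  by a fixed vector nor by an invariant 3-plane. Two maximum arguments supply the structure theory:
  a Rayleigh quotient yields root vectors, and a maximum over the compact automorphism group moves
  commuting elements into the diagonal torus.

  For q nonzero, an S-stable invariant associative plane forces \<open>|q|^2 p = x q^3\<close> with
  x real; this is the origin of I = 0. What remains are real equations in a, d, u, x and two
  auxiliary coefficients l, m. Eliminating l and m leaves a = d = 0, or d = 3a with x = 3, or delta
  = 0 with (2x^2 - x + 3) a = (x + 3) d. These are the zero sets of F4, F5 and F6, since Theta
  becomes u^2 times the difference of the two sides of the last equation. Conversely l and m can be
  solved for, except in the third case at x = 1, where a = d, the vector \<open>frame_m\<close> is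
  zero and Z kills \<open>frame_n\<close>.\<close>

lemma UNIV_8: "(UNIV::8 set) = {0,1,2,3,4,5,6,7}"
proof -
  have "card {0,1,2,3,4,5,6,7::8} = CARD(8)" by simp
  then show ?thesis by (metis card_eq_UNIV_imp_eq_UNIV finite_class.finite_UNIV)
qed

lemma forall_8: "(\<forall>i::8. P i) \<longleftrightarrow> P 0 \<and> P 1 \<and> P 2 \<and> P 3 \<and> P 4 \<and> P 5 \<and> P 6 \<and> P 7"
  using UNIV_8 by (metis (full_types) UNIV_I empty_iff insert_iff)

lemma sum_UNIV_8: "sum f (UNIV::8 set) = f 0 + f 1 + f 2 + f 3 + f 4 + f 5 + f 6 + f 7"
  unfolding UNIV_8 by (simp add: add.assoc)

text \<open>
  Left multiplication by \<open>e\<^sub>1\<close> is a complex structure on the span of \<open>e\<^sub>2, ..., e\<^sub>7\<close>; the complex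
  basis is \<open>e\<^sub>2, e\<^sub>4, e\<^sub>7\<close>, with \<open>e\<^sub>1e\<^sub>2 = e\<^sub>3\<close>, \<open>e\<^sub>1e\<^sub>4 = e\<^sub>5\<close> and \<open>e\<^sub>1e\<^sub>7 = e\<^sub>6\<close>.
\<close>

definition cv :: "real \<Rightarrow> real \<Rightarrow> complex \<Rightarrow> complex \<Rightarrow> complex \<Rightarrow> octonion" where
  "cv r0 r x y z = (\<chi> i. if i = 0 then r0 else if i = 1 then r
     else if i = 2 then Re x else if i = 3 then Im x else if i = 4 then Re y else if i = 5 then Im y
     else if i = 6 then Im z else Re z)"

lemma cv_nth [simp]:
  "cv r0 r x y z $ 0 = r0" "cv r0 r x y z $ 1 = r" "cv r0 r x y z $ 2 = Re x" "cv r0 r x y z $ 3 = Im x"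
  "cv r0 r x y z $ 4 = Re y" "cv r0 r x y z $ 5 = Im y" "cv r0 r x y z $ 6 = Im z" "cv r0 r x y z $ 7 = Re z"
  by (simp_all add: cv_def)

lemma cv_eq_iff [simp]:
  "cv r0 r x y z = cv r0' r' x' y' z' \<longleftrightarrow> r0 = r0' \<and> r = r' \<and> x = x' \<and> y = y' \<and> z = z'"
  by (auto simp: vec_eq_iff forall_8 complex_eq_iff)

lemma cv_cases: obtains r0 r x y z where "v = cv r0 r x y z"
proof
  show "v = cv (v$0) (v$1) (Complex (v$2) (v$3)) (Complex (v$4) (v$5)) (Complex (v$7) (v$6))"
    by (simp add: vec_eq_iff forall_8)
qed

lemma all_cv: "(\<forall>v. P v) \<longleftrightarrow> (\<forall>r0 r x y z. P (cv r0 r x y z))"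
  by (metis cv_cases)

lemma cv_linear [simp]:
  "cv r0 r x y z + cv r0' r' x' y' z' = cv (r0 + r0') (r + r') (x + x') (y + y') (z + z')"
  "cv r0 r x y z - cv r0' r' x' y' z' = cv (r0 - r0') (r - r') (x - x') (y - y') (z - z')"
  "c *\<^sub>R cv r0 r x y z = cv (c * r0) (c * r) (c *\<^sub>R x) (c *\<^sub>R y) (c *\<^sub>R z)"
  "- cv r0 r x y z = cv (- r0) (- r) (- x) (- y) (- z)"
  by (simp_all add: vec_eq_iff forall_8)

lemma cv_0: "0 = cv 0 0 0 0 0"
  by (simp add: vec_eq_iff forall_8)

lemma cv_eq_0_iff [simp]: "cv r0 r x y z = 0 \<longleftrightarrow> r0 = 0 \<and> r = 0 \<and> x = 0 \<and> y = 0 \<and> z = 0"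
  by (simp add: cv_0)

lemma inner_cv: "cv r0 r x y z \<bullet> cv r0' r' x' y' z' = r0 * r0' + r * r' + x \<bullet> x' + y \<bullet> y' + z \<bullet> z'"
  by (simp add: inner_vec_def sum_UNIV_8 inner_complex_def)

lemma oct_e_cv:
  "oct_e 0 = cv 1 0 0 0 0" "oct_e 1 = cv 0 1 0 0 0" "oct_e 2 = cv 0 0 1 0 0" "oct_e 3 = cv 0 0 \<i> 0 0"
  "oct_e 4 = cv 0 0 0 1 0" "oct_e 5 = cv 0 0 0 \<i> 0" "oct_e 6 = cv 0 0 0 0 \<i>" "oct_e 7 = cv 0 0 0 0 1"
  by (simp_all add: vec_eq_iff forall_8 axis_def)

lemma oct_oriented_simps:
  "oct_oriented 1 j k \<longleftrightarrow> j = 2 \<and> k = 3 \<or> j = 4 \<and> k = 5 \<or> j = 7 \<and> k = 6"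
  "oct_oriented 2 j k \<longleftrightarrow> j = 3 \<and> k = 1 \<or> j = 4 \<and> k = 6 \<or> j = 5 \<and> k = 7"
  "oct_oriented 3 j k \<longleftrightarrow> j = 1 \<and> k = 2 \<or> j = 4 \<and> k = 7 \<or> j = 6 \<and> k = 5"
  "oct_oriented 4 j k \<longleftrightarrow> j = 5 \<and> k = 1 \<or> j = 6 \<and> k = 2 \<or> j = 7 \<and> k = 3"
  "oct_oriented 5 j k \<longleftrightarrow> j = 1 \<and> k = 4 \<or> j = 7 \<and> k = 2 \<or> j = 3 \<and> k = 6"
  "oct_oriented 6 j k \<longleftrightarrow> j = 1 \<and> k = 7 \<or> j = 2 \<and> k = 4 \<or> j = 5 \<and> k = 3"
  "oct_oriented 7 j k \<longleftrightarrow> j = 6 \<and> k = 1 \<or> j = 2 \<and> k = 5 \<or> j = 3 \<and> k = 4"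
  unfolding oct_oriented_def oct_triples_def by auto

text \<open>On C^3 the product is a Hermitian form, with values in the span of 1 and e1, plus
  \<open>\<i>\<close> times the conjugated cross product. Both are compatible with SU(3), so that
  \<open>su(3)\<close> appears below as complex matrices.\<close>

lemma cv_mult:
  "cv r0 r x y z \<star> cv r0' r' x' y' z' =
     cv (r0 * r0' - r * r' - Re (cnj x * x' + cnj y * y' + cnj z * z'))
        (r0 * r' + r * r0' + Im (cnj x * x' + cnj y * y' + cnj z * z'))
        (r0 * x' + r0' * x + \<i> * (r * x' - r' * x) + \<i> * cnj (y * z' - z * y'))
        (r0 * y' + r0' * y + \<i> * (r * y' - r' * y) + \<i> * cnj (z * x' - x * z'))
        (r0 * z' + r0' * z + \<i> * (r * z' - r' * z) + \<i> * cnj (x * y' - y * x'))"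
  unfolding oct_mult_def vec_eq_iff forall_8
  by (simp add: sum_UNIV_8 oct_coeff_def oct_oriented_simps algebra_simps)

lemma bounded_bilinear_oct_mult: "bounded_bilinear (\<star>)"
proof -
  have "bilinear (\<star>)"
    unfolding bilinear_def
    by (auto intro!: linearI simp: oct_mult_def vec_eq_iff algebra_simps sum.distrib sum_distrib_left)
  then show ?thesis by (rule bilinear_conv_bounded_bilinear[THEN iffD1])
qed

interpretation oct_mult: bounded_bilinear "(\<star>)"
  by (rule bounded_bilinear_oct_mult)

lemma oct_S_cv [simp]: "oct_S *v cv r0 r x y z = cv r0 r y x (- z)"
proof -
  have "linear (\<lambda>x::octonion. x$0 *\<^sub>R oct_e 0 + x$1 *\<^sub>R oct_e 1 + x$2 *\<^sub>R oct_e 4 + x$4 *\<^sub>R oct_e 2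
     + x$3 *\<^sub>R oct_e 5 + x$5 *\<^sub>R oct_e 3 - x$6 *\<^sub>R oct_e 6 - x$7 *\<^sub>R (oct_e 7 :: octonion))"
    by (intro linearI) (simp_all add: algebra_simps)
  then show ?thesis
    by (simp add: oct_S_def matrix_works oct_e_cv complex_eq_iff)
qed

definition gact :: "real \<Rightarrow> real \<Rightarrow> complex \<Rightarrow> complex \<Rightarrow> complex \<Rightarrow> complex \<Rightarrow> complex \<Rightarrow> complex \<Rightarrow> octonion \<Rightarrow> octonion" where
  "gact s t y1 y2 y3 w1 w2 w3 v =
    (let r = v$1; x = Complex (v$2) (v$3); y = Complex (v$4) (v$5); z = Complex (v$7) (v$6) in
     cv 0 (- 2 * Re (cnj y1 * x + cnj y2 * y + cnj y3 * z))
        (2 * r * y1 + \<i> * s * x + w3 * y - cnj w2 * z - cnj (y2 * z - y3 * y))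
        (2 * r * y2 - cnj w3 * x + \<i> * t * y + w1 * z - cnj (y3 * x - y1 * z))
        (2 * r * y3 + w2 * x - cnj w1 * y - \<i> * (s + t) * z - cnj (y1 * y - y2 * x)))"

text \<open>
  In \<open>gm s t y1 y2 y3 w1 w2 w3\<close> the skew-Hermitian part has diagonal \<open>\<i>s, \<i>t, - \<i>(s + t)\<close> and
  entries \<open>w3, w1, w2\<close> in the positions \<open>(1,2), (2,3), (3,1)\<close>, and \<open>e\<^sub>1\<close> is sent to \<open>2(y1, y2, y3)\<close>;
  the antilinear part is forced by the derivation rule.
\<close>

definition gm :: "real \<Rightarrow> real \<Rightarrow> complex \<Rightarrow> complex \<Rightarrow> complex \<Rightarrow> complex \<Rightarrow> complex \<Rightarrow> complex \<Rightarrow> oct_endo" where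
  "gm s t y1 y2 y3 w1 w2 w3 = matrix (gact s t y1 y2 y3 w1 w2 w3)"

lemma gm_cv [simp]:
  "gm s t y1 y2 y3 w1 w2 w3 *v cv r0 r x y z =
     cv 0 (- 2 * Re (cnj y1 * x + cnj y2 * y + cnj y3 * z))
        (2 * r * y1 + \<i> * s * x + w3 * y - cnj w2 * z - cnj (y2 * z - y3 * y))
        (2 * r * y2 - cnj w3 * x + \<i> * t * y + w1 * z - cnj (y3 * x - y1 * z))
        (2 * r * y3 + w2 * x - cnj w1 * y - \<i> * (s + t) * z - cnj (y1 * y - y2 * x))"
proof -
  have "linear (gact s t y1 y2 y3 w1 w2 w3)"
    by (intro linearI) (simp_all add: gact_def Let_def complex_eq_iff algebra_simps)
  then show ?thesis
    by (simp add: gm_def matrix_works gact_def)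
qed

lemma matrix_eq_cv: "A = B \<longleftrightarrow> (\<forall>r0 r x y z. (A::oct_endo) *v cv r0 r x y z = B *v cv r0 r x y z)"
  unfolding matrix_eq all_cv ..

lemma gm_linear [simp]:
  "gm s t y1 y2 y3 w1 w2 w3 + gm s' t' y1' y2' y3' w1' w2' w3' =
     gm (s + s') (t + t') (y1 + y1') (y2 + y2') (y3 + y3') (w1 + w1') (w2 + w2') (w3 + w3')"
  "gm s t y1 y2 y3 w1 w2 w3 - gm s' t' y1' y2' y3' w1' w2' w3' =
     gm (s - s') (t - t') (y1 - y1') (y2 - y2') (y3 - y3') (w1 - w1') (w2 - w2') (w3 - w3')"
  "c *\<^sub>R gm s t y1 y2 y3 w1 w2 w3 =
     gm (c * s) (c * t) (c *\<^sub>R y1) (c *\<^sub>R y2) (c *\<^sub>R y3) (c *\<^sub>R w1) (c *\<^sub>R w2) (c *\<^sub>R w3)"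
  by (simp_all add: matrix_eq_cv matrix_vector_mult_add_rdistrib matrix_vector_mult_diff_rdistrib
      scaleR_matrix_vector_assoc[symmetric] complex_eq_iff algebra_simps)

lemma gm_eq_iff [simp]:
  "gm s t y1 y2 y3 w1 w2 w3 = gm s' t' y1' y2' y3' w1' w2' w3' \<longleftrightarrow>
     s = s' \<and> t = t' \<and> y1 = y1' \<and> y2 = y2' \<and> y3 = y3' \<and> w1 = w1' \<and> w2 = w2' \<and> w3 = w3'"
proof
  assume eq: "gm s t y1 y2 y3 w1 w2 w3 = gm s' t' y1' y2' y3' w1' w2' w3'"
  show "s = s' \<and> t = t' \<and> y1 = y1' \<and> y2 = y2' \<and> y3 = y3' \<and> w1 = w1' \<and> w2 = w2' \<and> w3 = w3'"
    using arg_cong[OF eq, of "\<lambda>A. A *v cv 0 1 0 0 0"] arg_cong[OF eq, of "\<lambda>A. A *v cv 0 0 1 0 0"]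
      arg_cong[OF eq, of "\<lambda>A. A *v cv 0 0 0 1 0"] by auto
qed simp

lemma gm_0: "0 = gm 0 0 0 0 0 0 0 0"
  by (simp add: matrix_eq_cv)

lemma gm_eq_0_iff [simp]:
  "gm s t y1 y2 y3 w1 w2 w3 = 0 \<longleftrightarrow>
     s = 0 \<and> t = 0 \<and> y1 = 0 \<and> y2 = 0 \<and> y3 = 0 \<and> w1 = 0 \<and> w2 = 0 \<and> w3 = 0"
  by (simp add: gm_0)

lemma lie_bracket_mv: "lie_bracket X Y *v v = X *v (Y *v v) - Y *v (X *v v)"
  by (simp add: lie_bracket_def matrix_vector_mult_diff_rdistrib matrix_vector_mul_assoc)

lemma lie_bracket_gm:
  "lie_bracket (gm s t y1 y2 y3 w1 w2 w3) (gm s' t' y1' y2' y3' w1' w2' w3') =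
    gm (2 * Im (w3' * cnj w3) - 2 * Im (w2' * cnj w2)
          - 4 * Im (y1 * cnj y1') + 2 * Im (y2 * cnj y2') + 2 * Im (y3 * cnj y3'))
       (2 * Im (w1' * cnj w1) - 2 * Im (w3' * cnj w3)
          - 4 * Im (y2 * cnj y2') + 2 * Im (y3 * cnj y3') + 2 * Im (y1 * cnj y1'))
       (\<i> * s * y1' + w3 * y2' - cnj w2 * y3' - (\<i> * s' * y1 + w3' * y2 - cnj w2' * y3)
          - 2 * cnj (y2 * y3' - y3 * y2'))
       (\<i> * t * y2' + w1 * y3' - cnj w3 * y1' - (\<i> * t' * y2 + w1' * y3 - cnj w3' * y1)
          - 2 * cnj (y3 * y1' - y1 * y3'))
       (- \<i> * (s + t) * y3' + w2 * y1' - cnj w1 * y2' - (- \<i> * (s' + t') * y3 + w2' * y1 - cnj w1' * y2)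
          - 2 * cnj (y1 * y2' - y2 * y1'))
       (\<i> * (s + 2 * t) * w1' - \<i> * (s' + 2 * t') * w1 + cnj (w3 * w2' - w3' * w2)
          - 3 * (y2 * cnj y3' - y2' * cnj y3))
       (- \<i> * (2 * s + t) * w2' + \<i> * (2 * s' + t') * w2 + cnj (w1 * w3' - w1' * w3)
          - 3 * (y3 * cnj y1' - y3' * cnj y1))
       (\<i> * (s - t) * w3' - \<i> * (s' - t') * w3 + cnj (w2 * w1' - w2' * w1)
          - 3 * (y1 * cnj y2' - y1' * cnj y2))"
  unfolding matrix_eq_cv lie_bracket_mv gm_cv cv_linear cv_eq_iff complex_eq_iff
  by (simp add: algebra_simps)

section \<open>The Lie algebra of derivations\<close>

lemma gm_in_g2: "gm s t y1 y2 y3 w1 w2 w3 \<in> g2"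
  unfolding g2_def mem_Collect_eq all_cv cv_mult gm_cv cv_linear cv_eq_iff complex_eq_iff
  by (simp add: algebra_simps)

lemma mv_minus: "(A::real^'n^'m) *v (- v) = - (A *v v)"
  by (rule linear_neg[OF matrix_vector_mul_linear])

lemma g2_mult: "X \<in> g2 \<Longrightarrow> X *v (x \<star> y) = (X *v x) \<star> y + x \<star> (X *v y)"
  by (simp add: g2_def)

text \<open>The octonions are generated by \<open>e\<^sub>1, e\<^sub>2, e\<^sub>4\<close>.\<close>

lemma g2_eqI:
  assumes "X \<in> g2" "Y \<in> g2"
    and "X *v cv 0 1 0 0 0 = Y *v cv 0 1 0 0 0"
    and "X *v cv 0 0 1 0 0 = Y *v cv 0 0 1 0 0"
    and "X *v cv 0 0 0 1 0 = Y *v cv 0 0 0 1 0"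
  shows "X = Y"
proof -
  let ?E = "{v. X *v v = Y *v v}"
  have mult: "x \<star> y \<in> ?E" if "x \<in> ?E" "y \<in> ?E" for x y
    using that assms(1,2) by (simp add: g2_mult)
  have 1: "cv 0 1 0 0 0 \<in> ?E" and 2: "cv 0 0 1 0 0 \<in> ?E" and 4: "cv 0 0 0 1 0 \<in> ?E"
    using assms(3-5) by simp_all
  have sub: "subspace ?E"
    by (auto simp: subspace_def matrix_vector_right_distrib matrix_vector_mult_scaleR)
  have 3: "cv 0 0 \<i> 0 0 \<in> ?E" using mult[OF 1 2] by (simp add: cv_mult)
  have 5: "cv 0 0 0 \<i> 0 \<in> ?E" using mult[OF 1 4] by (simp add: cv_mult)
  have 6: "cv 0 0 0 0 \<i> \<in> ?E" using mult[OF 2 4] by (simp add: cv_mult)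
  have 7: "cv 0 0 0 0 1 \<in> ?E" using mult[OF 2 5] by (simp add: cv_mult)
  have "cv (- 1) 0 0 0 0 \<in> ?E" using mult[OF 1 1] by (simp add: cv_mult)
  from subspace_neg[OF sub this] have 0: "cv 1 0 0 0 0 \<in> ?E" by simp
  have "cv r0 r x y z \<in> ?E" for r0 r x y z
  proof -
    have "cv r0 r x y z = r0 *\<^sub>R cv 1 0 0 0 0 + r *\<^sub>R cv 0 1 0 0 0
        + Re x *\<^sub>R cv 0 0 1 0 0 + Im x *\<^sub>R cv 0 0 \<i> 0 0
        + Re y *\<^sub>R cv 0 0 0 1 0 + Im y *\<^sub>R cv 0 0 0 \<i> 0
        + Re z *\<^sub>R cv 0 0 0 0 1 + Im z *\<^sub>R cv 0 0 0 0 \<i>"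
      by (simp add: complex_eq_iff)
    also have "\<dots> \<in> ?E"
      by (intro subspace_add[OF sub] subspace_scale[OF sub] 0 1 2 3 4 5 6 7)
    finally show ?thesis .
  qed
  then show ?thesis by (simp add: matrix_eq_cv)
qed

text \<open>The values on e1, e2, e4 are 24 real numbers. The derivation rule on the squares of
  these generators removes six of them, and the anticommuting pairs (1,2), (1,4), (2,4), (3,4) one
  each; the 14 that remain are the parameters of \<open>gm\<close>.\<close>

lemma g2_gmE:
  assumes "X \<in> g2"
  obtains s t y1 y2 y3 w1 w2 w3 where "X = gm s t y1 y2 y3 w1 w2 w3"
proof -
  note D = g2_mult[OF assms]
  obtain a0 a a1 a2 a3 where A: "X *v cv 0 1 0 0 0 = cv a0 a a1 a2 a3" by (rule cv_cases)
  obtain b0 b b1 b2 b3 where B: "X *v cv 0 0 1 0 0 = cv b0 b b1 b2 b3" by (rule cv_cases)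
  obtain c0 c c1 c2 c3 where C: "X *v cv 0 0 0 1 0 = cv c0 c c1 c2 c3" by (rule cv_cases)
  have one: "X *v cv 1 0 0 0 0 = 0"
  proof -
    obtain d0 d d1 d2 d3 where "X *v cv 1 0 0 0 0 = cv d0 d d1 d2 d3" by (rule cv_cases)
    then show ?thesis
      using D[of "cv 1 0 0 0 0" "cv 1 0 0 0 0"] by (simp add: cv_mult)
  qed
  have neg: "X *v cv (- 1) 0 0 0 0 = 0"
    using one mv_minus[of X "cv 1 0 0 0 0"] by simp
  have E3: "X *v cv 0 0 \<i> 0 0 = cv a0 a a1 a2 a3 \<star> cv 0 0 1 0 0 + cv 0 1 0 0 0 \<star> cv b0 b b1 b2 b3"
    using D[of "cv 0 1 0 0 0" "cv 0 0 1 0 0"] by (simp add: cv_mult A B)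
  have n3: "X *v cv 0 0 (- \<i>) 0 0 = - (X *v cv 0 0 \<i> 0 0)"
    using mv_minus[of X "cv 0 0 \<i> 0 0"] by simp
  have 11: "a0 = 0" "a = 0"
    using D[of "cv 0 1 0 0 0" "cv 0 1 0 0 0"] neg by (auto simp: cv_mult A complex_eq_iff)
  have 22: "b0 = 0" "Re b1 = 0"
    using D[of "cv 0 0 1 0 0" "cv 0 0 1 0 0"] neg by (auto simp: cv_mult B complex_eq_iff)
  have 44: "c0 = 0" "Re c2 = 0"
    using D[of "cv 0 0 0 1 0" "cv 0 0 0 1 0"] neg by (auto simp: cv_mult C complex_eq_iff)
  have 12: "b = - Re a1"
    using D[of "cv 0 1 0 0 0" "cv 0 0 1 0 0"] D[of "cv 0 0 1 0 0" "cv 0 1 0 0 0"] n3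
    by (auto simp: cv_mult A B complex_eq_iff 11 22)
  have n5: "X *v cv 0 0 0 (- \<i>) 0 = - (X *v cv 0 0 0 \<i> 0)"
    using mv_minus[of X "cv 0 0 0 \<i> 0"] by simp
  have 14: "c = - Re a2"
    using D[of "cv 0 1 0 0 0" "cv 0 0 0 1 0"] D[of "cv 0 0 0 1 0" "cv 0 1 0 0 0"] n5
    by (auto simp: cv_mult A C complex_eq_iff 11 44)
  have n6: "X *v cv 0 0 0 0 (- \<i>) = - (X *v cv 0 0 0 0 \<i>)" 
      "X *v cv 0 0 0 0 (- 1) = - (X *v cv 0 0 0 0 1)"
    using mv_minus[of X "cv 0 0 0 0 \<i>"] mv_minus[of X "cv 0 0 0 0 1"] by simp_all
  have 24: "Re c1 = - Re b2"
    using D[of "cv 0 0 1 0 0" "cv 0 0 0 1 0"] D[of "cv 0 0 0 1 0" "cv 0 0 1 0 0"] n6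
    by (auto simp: cv_mult B C complex_eq_iff 22 44)
  have 34: "Im c1 = Im b2 - Im a3"
    using D[of "cv 0 0 \<i> 0 0" "cv 0 0 0 1 0"] D[of "cv 0 0 0 1 0" "cv 0 0 \<i> 0 0"] n6
    by (auto simp: cv_mult A B C E3 complex_eq_iff 11 22 44)
  \<comment> \<open>The image of e1 is twice the \<open>y\<close> part; the \<open>w\<close> part is
    what is left of the mixed entries once the antilinear contribution of the \<open>y\<close> part
    is subtracted.\<close>
  have "X = gm (Im b1) (Im c2) (a1 / 2) (a2 / 2) (a3 / 2)
      (- cnj c3 - a1 / 2) (b3 - cnj (a2 / 2)) (- cnj b2 - a3 / 2)"
  proof (rule g2_eqI[OF assms gm_in_g2])
    show "X *v cv 0 1 0 0 0 = gm (Im b1) (Im c2) (a1 / 2) (a2 / 2) (a3 / 2)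
        (- cnj c3 - a1 / 2) (b3 - cnj (a2 / 2)) (- cnj b2 - a3 / 2) *v cv 0 1 0 0 0"
      unfolding A gm_cv by (simp add: 11)
    show "X *v cv 0 0 1 0 0 = gm (Im b1) (Im c2) (a1 / 2) (a2 / 2) (a3 / 2)
        (- cnj c3 - a1 / 2) (b3 - cnj (a2 / 2)) (- cnj b2 - a3 / 2) *v cv 0 0 1 0 0"
      unfolding B gm_cv cv_eq_iff complex_eq_iff by (simp add: 12 22)
    show "X *v cv 0 0 0 1 0 = gm (Im b1) (Im c2) (a1 / 2) (a2 / 2) (a3 / 2)
        (- cnj c3 - a1 / 2) (b3 - cnj (a2 / 2)) (- cnj b2 - a3 / 2) *v cv 0 0 0 1 0"
      unfolding C gm_cv cv_eq_iff complex_eq_iff by (simp add: 14 24 34 44)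
  qed
  then show ?thesis by (rule that)
qed

lemma subspace_g2: "subspace g2"
  unfolding subspace_def
proof (intro conjI ballI allI)
  show "0 \<in> g2" using gm_in_g2 by (simp add: gm_0)
qed (auto elim!: g2_gmE simp: gm_in_g2)

lemma lie_subalgebra_g2: "lie_subalgebra g2"
  unfolding lie_subalgebra_def
  using subspace_g2 by (auto elim!: g2_gmE simp: lie_bracket_gm gm_in_g2)

section \<open>The subalgebra preserving the quaternions\<close>

lemma matrix_inv_eqI: "A ** B = mat 1 \<Longrightarrow> matrix_inv A = (B :: real^'n^'n)"
proof -
  assume AB: "A ** B = mat 1"
  then have "B ** A = mat 1" by (simp add: matrix_left_right_inverse)
  with AB have "matrix_inv A ** A = mat 1"
    unfolding matrix_inv_def by (metis (mono_tags, lifting) someI_ex)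
  then show ?thesis
    by (metis AB matrix_mul_assoc matrix_mul_lid matrix_mul_rid)
qed

lemma Ad_mv: "Ad g X *v v = g *v (X *v (matrix_inv g *v v))"
  by (simp add: Ad_def matrix_vector_mul_assoc matrix_mul_assoc)

lemma matrix_inv_oct_S: "matrix_inv oct_S = oct_S"
  by (rule matrix_inv_eqI) (simp add: matrix_eq_cv matrix_vector_mul_assoc[symmetric])

lemma Ad_oct_S_gm:
  "Ad oct_S (gm s t y1 y2 y3 w1 w2 w3) = gm t s y2 y1 (- y3) (cnj w2) (cnj w1) (- cnj w3)"
  unfolding matrix_eq_cv Ad_mv matrix_inv_oct_S oct_S_cv gm_cv cv_eq_iff complex_eq_iff
  by (simp add: algebra_simps)

lemma oct_D_mv: "oct_D a b *v x = oct_commutator (oct_commutator a b) x - 3 *\<^sub>R oct_associator a b x"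
proof -
  have "linear (\<lambda>x. oct_commutator (oct_commutator a b) x - 3 *\<^sub>R oct_associator a b x)"
    by (intro linearI) (simp_all add: oct_commutator_def oct_associator_def
        oct_mult.add_left oct_mult.add_right oct_mult.scaleR_left oct_mult.scaleR_right algebra_simps)
  then show ?thesis by (simp add: oct_D_def matrix_works)
qed

lemma D_ij_gm:
  "D_ij 1 2 = gm 0 0 2 0 0 0 0 0" "D_ij 1 3 = gm 0 0 (2 * \<i>) 0 0 0 0 0"
  "D_ij 2 3 = gm 4 (- 2) 0 0 0 0 0 0" "D_ij 4 5 = gm (- 2) 4 0 0 0 0 0 0"
  "D_ij 4 6 = gm 0 0 \<i> 0 0 (3 * \<i>) 0 0" "D_ij 4 7 = gm 0 0 (- 1) 0 0 (- 3) 0 0"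
  unfolding matrix_eq_cv oct_D_mv gm_cv oct_commutator_def oct_associator_def oct_e_cv cv_mult
    cv_linear cv_eq_iff complex_eq_iff
  by (simp_all add: algebra_simps)

text \<open>\<open>(a, q)\<close> and \<open>(d, p)\<close> are coordinates on the two commuting
  ideals \<open>su(2)\<close> of \<open>k_A\<close>; the shift \<open>d - a\<close> in the second
  diagonal entry is what separates them.\<close>

definition Zgen :: "real \<Rightarrow> real \<Rightarrow> complex \<Rightarrow> complex \<Rightarrow> oct_endo" where
  "Zgen a d q p = gm (2 * a) (d - a) (- \<i> * q) 0 0 (\<i> * p) 0 0"

lemma kA_elem_Zgen: "kA_elem x = Zgen (a_c x) (d_c x) (q_c x) (p_c x)"
  unfolding kA_elem_def Zgen_def D_ij_gm gm_linear gm_eq_iff complex_eq_iff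
  by (simp add: a_c_def d_c_def q_c_def p_c_def algebra_simps)

lemma UNIV_6: "(UNIV::6 set) = {0,1,2,3,4,5}"
proof -
  have "card {0,1,2,3,4,5::6} = CARD(6)" by simp
  then show ?thesis by (metis card_eq_UNIV_imp_eq_UNIV finite_class.finite_UNIV)
qed

lemma forall_6: "(\<forall>i::6. P i) \<longleftrightarrow> P 0 \<and> P 1 \<and> P 2 \<and> P 3 \<and> P 4 \<and> P 5"
  using UNIV_6 by (metis (full_types) UNIV_I empty_iff insert_iff)

lemma Zgen_coords:
  obtains x where "a_c x = a" "d_c x = d" "q_c x = q" "p_c x = p"
proof
  let ?x = "(\<chi> i. if i = 0 then Im q / 2 + Im p / 6 else if i = 1 then - Re q / 2 - Re p / 6
    else if i = 2 then a / 2 + d / 6 else if i = 3 then d / 3 else if i = 4 then Re p / 3 else Im p / 3) :: real^6"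
  show "a_c ?x = a" "d_c ?x = d" "q_c ?x = q" "p_c ?x = p"
    by (simp_all add: a_c_def d_c_def q_c_def p_c_def complex_eq_iff)
qed

lemma inj_kA_elem: "inj kA_elem"
proof (rule injI)
  fix x y assume "kA_elem x = kA_elem y"
  then have "a_c x = a_c y" "d_c x = d_c y" "q_c x = q_c y" "p_c x = p_c y"
    by (auto simp: kA_elem_Zgen Zgen_def)
  then show "x = y"
    by (auto simp: a_c_def d_c_def q_c_def p_c_def vec_eq_iff forall_6)
qed

lemma kA_coords_elem [simp]: "kA_coords (kA_elem x) = x"
  by (simp add: kA_coords_def inj_kA_elem inv_f_f)

lemma mem_H_A: "cv r0 r x y z \<in> H_A \<longleftrightarrow> y = 0 \<and> z = 0"
proof
  have "H_A \<subseteq> {v. v$4 = 0 \<and> v$5 = 0 \<and> v$6 = 0 \<and> v$7 = 0}"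
    unfolding H_A_def by (rule span_minimal) (auto simp: subspace_def axis_def)
  then show "cv r0 r x y z \<in> H_A \<Longrightarrow> y = 0 \<and> z = 0"
    by (auto simp: complex_eq_iff)
next
  assume "y = 0 \<and> z = 0"
  then have "cv r0 r x y z = r0 *\<^sub>R oct_e 0 + r *\<^sub>R oct_e 1 + Re x *\<^sub>R oct_e 2 + Im x *\<^sub>R oct_e 3"
    unfolding oct_e_cv by (simp add: complex_eq_iff)
  also have "\<dots> \<in> H_A"
    unfolding H_A_def by (intro span_add span_scale span_base) auto
  finally show "cv r0 r x y z \<in> H_A" .
qed

lemma k_A_eq: "k_A = range (\<lambda>(a, d, q, p). Zgen a d q p)"
proof (intro equalityI subsetI)
  fix X assume X: "X \<in> k_A"
  then have H: "X *v v \<in> H_A" if "v \<in> H_A" for v using that by (simp add: k_A_def)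
  from X have "X \<in> g2" by (simp add: k_A_def)
  then obtain s t y1 y2 y3 w1 w2 w3 where eq: "X = gm s t y1 y2 y3 w1 w2 w3" by (rule g2_gmE)
  have "y2 = 0" "y3 = 0" "w3 = 0" "w2 = 0"
    using H[of "cv 0 1 0 0 0"] H[of "cv 0 0 1 0 0"] by (auto simp: eq mem_H_A)
  then have "X = Zgen (s / 2) (t + s / 2) (\<i> * y1) (- \<i> * w1)"
    by (simp add: eq Zgen_def complex_eq_iff)
  then show "X \<in> range (\<lambda>(a, d, q, p). Zgen a d q p)"
    by (metis (mono_tags, lifting) case_prod_conv rangeI)
next
  fix X assume "X \<in> range (\<lambda>(a, d, q, p). Zgen a d q p)"
  then obtain a d q p where X: "X = Zgen a d q p" by auto
  have "X *v v \<in> H_A" if "v \<in> H_A" for v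
    using that by (cases v rule: cv_cases) (simp add: X Zgen_def mem_H_A)
  then show "X \<in> k_A" by (simp add: k_A_def X Zgen_def gm_in_g2)
qed

lemma Zgen_in_k_A: "Zgen a d q p \<in> k_A"
  unfolding k_A_eq by (rule image_eqI[of _ _ "(a, d, q, p)"]) simp_all

lemma k_A_E:
  assumes "X \<in> k_A"
  obtains a d q p where "X = Zgen a d q p"
  using assms by (auto simp: k_A_eq)

lemma range_kA_elem: "range kA_elem = k_A"
proof
  show "range kA_elem \<subseteq> k_A" by (auto simp: kA_elem_Zgen Zgen_in_k_A)
  show "k_A \<subseteq> range kA_elem"
  proof
    fix X assume "X \<in> k_A"
    then obtain a d q p where X: "X = Zgen a d q p" by (rule k_A_E)
    obtain x where "a_c x = a" "d_c x = d" "q_c x = q" "p_c x = p" by (rule Zgen_coords)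
    then show "X \<in> range kA_elem" by (auto simp: X kA_elem_Zgen)
  qed
qed

section \<open>Subalgebras of rank one\<close>

lemmas mv_simps =
  matrix_vector_mult_add_rdistrib matrix_vector_mult_diff_rdistrib scaleR_matrix_vector_assoc[symmetric]
  matrix_vector_right_distrib matrix_vector_mult_diff_distrib matrix_vector_mult_scaleR mv_minus

lemma mv_minus_left: "(- A) *v v = - ((A::real^'n^'m) *v v)"
  using matrix_vector_mult_diff_rdistrib[of 0 A v] by simp

lemma bilinear_lie_bracket: "bilinear lie_bracket"
  unfolding bilinear_def
  by (auto intro!: linearI simp: matrix_eq lie_bracket_mv mv_simps algebra_simps)

lemmas lie_bracket_simps =
  bilinear_ladd[OF bilinear_lie_bracket] bilinear_radd[OF bilinear_lie_bracket]
  bilinear_lmul[OF bilinear_lie_bracket] bilinear_rmul[OF bilinear_lie_bracket]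
  bilinear_lneg[OF bilinear_lie_bracket] bilinear_rneg[OF bilinear_lie_bracket]
  bilinear_lzero[OF bilinear_lie_bracket] bilinear_rzero[OF bilinear_lie_bracket]
  bilinear_lsub[OF bilinear_lie_bracket] bilinear_rsub[OF bilinear_lie_bracket]

lemma lie_bracket_self [simp]: "lie_bracket X X = 0"
  by (simp add: lie_bracket_def)

lemma lie_bracket_anti: "lie_bracket X Y = - lie_bracket Y X"
  by (simp add: lie_bracket_def)

lemma lie_bracket_jacobi:
  "lie_bracket (lie_bracket X Y) W = lie_bracket X (lie_bracket Y W) - lie_bracket Y (lie_bracket X W)"
  by (simp add: matrix_eq lie_bracket_mv mv_simps)

lemma inner_matrix_matrix_mult: "A \<bullet> (B ** C) = (transpose B ** A) \<bullet> (C :: real^'n^'n)"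
proof -
  have "A \<bullet> (B ** C) = (\<Sum>i\<in>UNIV. \<Sum>j\<in>UNIV. \<Sum>k\<in>UNIV. A$i$j * B$i$k * C$k$j)"
    by (simp add: inner_vec_def matrix_matrix_mult_def sum_distrib_left mult.assoc)
  also have "\<dots> = (\<Sum>i\<in>UNIV. \<Sum>k\<in>UNIV. \<Sum>j\<in>UNIV. A$i$j * B$i$k * C$k$j)"
    by (intro sum.cong refl sum.swap)
  also have "\<dots> = (\<Sum>k\<in>UNIV. \<Sum>i\<in>UNIV. \<Sum>j\<in>UNIV. A$i$j * B$i$k * C$k$j)"
    by (rule sum.swap)
  also have "\<dots> = (\<Sum>k\<in>UNIV. \<Sum>j\<in>UNIV. \<Sum>i\<in>UNIV. A$i$j * B$i$k * C$k$j)"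
    by (intro sum.cong refl sum.swap)
  also have "\<dots> = (transpose B ** A) \<bullet> C"
    by (simp add: inner_vec_def matrix_matrix_mult_def transpose_def sum_distrib_left sum_distrib_right mult.assoc mult.commute mult.left_commute)
  finally show ?thesis .
qed

lemma inner_transpose: "transpose A \<bullet> transpose B = A \<bullet> (B :: real^'n^'m)"
  unfolding inner_vec_def transpose_def by (simp add: sum.swap[of "\<lambda>i j. A $ j $ i * B $ j $ i"])

lemma inner_matrix_matrix_mult': "A \<bullet> (C ** B) = (A ** transpose B) \<bullet> (C :: real^'n^'n)"
proof -
  have "A \<bullet> (C ** B) = transpose A \<bullet> (transpose B ** transpose C)"
    by (simp add: inner_transpose flip: matrix_transpose_mul)
  also have "\<dots> = (B ** transpose A) \<bullet> transpose C"
    by (simp add: inner_matrix_matrix_mult transpose_transpose)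
  also have "\<dots> = (A ** transpose B) \<bullet> C"
    by (metis inner_transpose matrix_transpose_mul transpose_transpose)
  finally show ?thesis .
qed

text \<open>Invariance of the trace form, which takes the place of the Killing form: bracketing with
  a skew matrix is a skew operator.\<close>

lemma inner_lie_bracket:
  assumes "transpose B = - B"
  shows "lie_bracket B A \<bullet> C = - (A \<bullet> lie_bracket B C)"
proof -
  have neg: "(- B) ** A = - (B ** A)" "A ** (- B) = - (A ** B)"
    by (simp_all add: matrix_eq matrix_vector_mul_assoc[symmetric] mv_simps mv_minus_left)
  show ?thesis
    unfolding lie_bracket_def inner_diff_right inner_matrix_matrix_mult[of A B C] inner_matrix_matrix_mult'[of A C B]
      assms neg
    by (simp add: inner_diff_left)
qed


text \<open>First order condition at the maximum \<open>U\<close> of \<open>norm (T U)\<close> on the unit sphere of \<open>K\<close>.\<close>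

lemma rayleigh_maximum:
  fixes T :: "'a::euclidean_space \<Rightarrow> 'a"
  assumes K: "subspace K" "K \<noteq> {0}" and T: "linear T" "\<And>x. x \<in> K \<Longrightarrow> T x \<in> K"
    and skew: "\<And>x y. x \<in> K \<Longrightarrow> y \<in> K \<Longrightarrow> T x \<bullet> y = - (x \<bullet> T y)"
  obtains u l where "u \<in> K" "norm u = 1" "l \<ge> 0" "T (T u) = - (l\<^sup>2 *\<^sub>R u)"
    "\<And>x. x \<in> K \<Longrightarrow> norm (T x) \<le> l * norm x"
proof -
  have bl: "bounded_linear T" using T(1) by (simp add: linear_conv_bounded_linear)
  have "compact (K \<inter> sphere 0 1)"
    by (intro closed_Int_compact closed_subspace K compact_sphere)
  moreover have "K \<inter> sphere 0 1 \<noteq> {}"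
  proof -
    obtain x where "x \<in> K" "x \<noteq> 0" using K by (auto simp: subspace_0)
    then have "(1 / norm x) *\<^sub>R x \<in> K \<inter> sphere 0 1"
      using K by (simp add: subspace_scale)
    then show ?thesis by blast
  qed
  moreover have "continuous_on (K \<inter> sphere 0 1) (\<lambda>x. norm (T x))"
    by (intro continuous_intros linear_continuous_on bl)
  ultimately obtain u where u: "u \<in> K \<inter> sphere 0 1"
    and max: "\<And>x. x \<in> K \<inter> sphere 0 1 \<Longrightarrow> norm (T x) \<le> norm (T u)"
    using continuous_attains_sup by metis
  define l where "l = norm (T u)"
  have uK: "u \<in> K" and nu: "norm u = 1" using u by auto
  have bound: "norm (T x) \<le> l * norm x" if "x \<in> K" for x
  proof (cases "x = 0")
    case True
    then show ?thesis using T(1) by (simp add: linear_0)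
  next
    case False
    then have "norm (T ((1 / norm x) *\<^sub>R x)) \<le> l"
      unfolding l_def using that K by (intro max) (simp add: subspace_scale)
    then show ?thesis using T(1) False by (simp add: linear_cmul field_simps)
  qed
  have eq: "T u \<bullet> T w = l\<^sup>2 * (u \<bullet> w)" if w: "w \<in> K" for w
  proof -
    define c where "c = 2 * (T u \<bullet> T w - l\<^sup>2 * (u \<bullet> w))"
    define e where "e = (norm (T w))\<^sup>2 - l\<^sup>2 * (norm w)\<^sup>2"
    have ineq: "t * c + t\<^sup>2 * e \<le> 0" for t :: real
    proof -
      have "u + t *\<^sub>R w \<in> K" using uK w K by (simp add: subspace_add subspace_scale)
      then have "(norm (T (u + t *\<^sub>R w)))\<^sup>2 \<le> (l * norm (u + t *\<^sub>R w))\<^sup>2"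
        by (intro power_mono bound) simp_all
      moreover have "T (u + t *\<^sub>R w) = T u + t *\<^sub>R T w"
        using T(1) by (simp add: linear_add linear_cmul)
      moreover have "(norm (a + t *\<^sub>R b))\<^sup>2 = (norm a)\<^sup>2 + 2 * t * (a \<bullet> b) + t\<^sup>2 * (norm b)\<^sup>2" for a b :: 'a
        unfolding power2_norm_eq_inner
        by (simp add: inner_add_left inner_add_right inner_commute power2_eq_square algebra_simps)
      ultimately show ?thesis
        by (simp add: power_mult_distrib nu c_def e_def l_def[symmetric] algebra_simps)
    qed
    have "c = 0"
    proof (rule ccontr)
      assume c: "c \<noteq> 0"
      \<comment> \<open>Small enough that \<open>k * e > - 1\<close>, so that at
        \<open>t = c * k\<close> the linear term of \<open>ineq\<close> dominates the quadratic
        one.\<close>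
      define k where "k = 1 / (2 * (\<bar>e\<bar> + 1))"
      have k: "k > 0" by (simp add: k_def)
      have "- 1 < k * e" by (simp add: k_def field_simps)
      then have "c\<^sup>2 * k * (1 + k * e) > 0" using k c by simp
      moreover have "(c * k) * c + (c * k)\<^sup>2 * e = c\<^sup>2 * k * (1 + k * e)"
        by (simp add: power2_eq_square algebra_simps)
      ultimately show False using ineq[of "c * k"] by simp
    qed
    then show ?thesis by (simp add: c_def)
  qed
  have TT: "T (T u) + l\<^sup>2 *\<^sub>R u \<in> K"
    using uK K T by (simp add: subspace_add subspace_scale)
  \<comment> \<open>Skewness turns \<open>eq\<close> into orthogonality of this vector to all of
    \<open>K\<close>; as the vector lies in \<open>K\<close> itself, it is zero.\<close>
  have "(T (T u) + l\<^sup>2 *\<^sub>R u) \<bullet> w = 0" if "w \<in> K" for w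
    using eq[OF that] skew[of "T u" w] uK that T by (simp add: inner_add_left)
  from this[OF TT] have "T (T u) = - (l\<^sup>2 *\<^sub>R u)"
    by (simp add: add_eq_0_iff2)
  with uK nu bound show ?thesis by (intro that[of u l]) (auto simp: l_def)
qed

abbreviation lie_br :: "oct_endo \<Rightarrow> oct_endo \<Rightarrow> oct_endo" ("\<langle>_, _\<rangle>") where
  "\<langle>X, Y\<rangle> \<equiv> lie_bracket X Y"

text \<open>
  The root decomposition of a rank one algebra with respect to \<open>Y\<close>: the multiples of the largest
  root \<open>1\<close> have multiplicity one, a further root would have to be \<open>1/2\<close>, and the Jacobi identity
  for a root vector \<open>V\<close> and its translate \<open>\<langle>U, V\<rangle>\<close> excludes that.
\<close>

lemma rank_one:
  assumes L: "lie_subalgebra L" and skew: "\<And>X. X \<in> L \<Longrightarrow> transpose X = - X"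
    and rank: "\<And>X Y. X \<in> L \<Longrightarrow> Y \<in> L \<Longrightarrow> \<langle>X, Y\<rangle> = 0 \<Longrightarrow> X \<noteq> 0 \<Longrightarrow> \<exists>c. Y = c *\<^sub>R X"
  obtains Y U W where "L \<subseteq> span {Y, U, W}"
proof -
  have sub: "subspace L" and br: "\<And>X Y. X \<in> L \<Longrightarrow> Y \<in> L \<Longrightarrow> \<langle>X, Y\<rangle> \<in> L"
    using L by (auto simp: lie_subalgebra_def)
  note Lcl = subspace_add[OF sub] subspace_diff[OF sub] subspace_scale[OF sub] subspace_neg[OF sub] br
  have inv: "\<langle>X, A\<rangle> \<bullet> C = - (A \<bullet> \<langle>X, C\<rangle>)" if "X \<in> L" for X A C
    using inner_lie_bracket skew[OF that] by blast
  show ?thesis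
  proof (cases "L \<subseteq> {0}")
    case True
    then show ?thesis by (intro that[of 0 0 0]) auto
  next
    case False
    then obtain Y0 where Y0: "Y0 \<in> L" "Y0 \<noteq> 0" by auto
    define K where "K = {X \<in> L. X \<bullet> Y0 = 0}"
    have K: "subspace K"
      using sub by (auto simp: K_def subspace_def inner_add_left)
    show ?thesis
    proof (cases "K = {0}")
      case True
      have "L \<subseteq> span {Y0, 0, 0}"
      proof
        fix X assume X: "X \<in> L"
        have "X - ((X \<bullet> Y0) / (Y0 \<bullet> Y0)) *\<^sub>R Y0 \<in> K"
          using X Y0 by (simp add: K_def Lcl inner_diff_left)
        then have "X = ((X \<bullet> Y0) / (Y0 \<bullet> Y0)) *\<^sub>R Y0" using True by simp
        then show "X \<in> span {Y0, 0, 0}"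
          by (metis insertI1 span_base span_scale)
      qed
      then show ?thesis by (rule that)
    next
      case False
      have lin: "linear (\<lambda>X. \<langle>Y, X\<rangle>)" for Y
        by (intro linearI) (simp_all add: lie_bracket_simps)
      have YK: "\<langle>Y0, X\<rangle> \<in> K" if "X \<in> L" for X
        using that Y0 inv[of Y0 X Y0] by (simp add: K_def br)
      obtain U l where U: "U \<in> K" "norm U = 1" and l: "l \<ge> 0"
        and eig: "\<langle>Y0, \<langle>Y0, U\<rangle>\<rangle> = - (l\<^sup>2 *\<^sub>R U)"
        and bound: "\<And>X. X \<in> K \<Longrightarrow> norm \<langle>Y0, X\<rangle> \<le> l * norm X"
      proof (rule rayleigh_maximum[OF K False lin[of Y0]])
        show "\<langle>Y0, X\<rangle> \<in> K" if "X \<in> K" for X using that YK by (simp add: K_def)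
        show "\<langle>Y0, X\<rangle> \<bullet> X' = - (X \<bullet> \<langle>Y0, X'\<rangle>)" for X X' by (rule inv[OF Y0(1)])
      qed blast
      have UL: "U \<in> L" and UY: "U \<bullet> Y0 = 0" and U0: "U \<noteq> 0" using U by (auto simp: K_def)
      have perp0: "X = 0" if X: "X \<in> L" "X \<bullet> Y0 = 0" "\<langle>Y0, X\<rangle> = 0" for X
      proof -
        obtain c where "X = c *\<^sub>R Y0" using rank[OF Y0(1) X(1,3) Y0(2)] by blast
        then show ?thesis using X(2) Y0(2) by simp
      qed
      have "l \<noteq> 0"
      proof
        assume "l = 0"
        then have "\<langle>Y0, U\<rangle> = 0" using bound[OF U(1)] by simp
        then show False using perp0[OF UL UY] U0 by simp
      qed
      with l have l: "l > 0" by simp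
      \<comment> \<open>Rescaled so that the largest root becomes 1.\<close>
      define Y where "Y = (1 / l) *\<^sub>R Y0"
      have YL: "Y \<in> L" and Ynz: "Y \<noteq> 0" using Y0 l by (auto simp: Y_def Lcl)
      have perp: "X = 0" if "X \<in> L" "X \<bullet> Y = 0" "\<langle>Y, X\<rangle> = 0" for X
        using that perp0[of X] l by (simp add: Y_def lie_bracket_simps)
      define U' where "U' = \<langle>Y, U\<rangle>"
      have U'L: "U' \<in> L" by (simp add: U'_def br YL UL)
      have YU: "\<langle>Y, U\<rangle> = U'" and YU': "\<langle>Y, U'\<rangle> = - U"
        using eig l by (auto simp: U'_def Y_def lie_bracket_simps power2_eq_square)
      have UperpY: "U \<bullet> Y = 0" using UY by (simp add: Y_def)
      have YUc: "\<langle>U, Y\<rangle> = - U'" using YU lie_bracket_anti[of U Y] by simp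
      \<comment> \<open>A root n > 1 would contradict the maximality behind
        \<open>bound\<close>.\<close>
      have big: "X = 0" if X: "X \<in> L" "\<langle>Y, \<langle>Y, X\<rangle>\<rangle> = - (n\<^sup>2 *\<^sub>R X)" "n > 1" for X n
      proof -
        have "n\<^sup>2 * (X \<bullet> Y) = 0"
          using inv[OF YL, of "\<langle>Y, X\<rangle>" Y] by (simp add: X(2))
        then have "X \<bullet> Y = 0" using X(3) by simp
        then have "X \<in> K" using X(1) l by (simp add: K_def Y_def)
        from bound[OF this] have b: "norm \<langle>Y, X\<rangle> \<le> norm X"
          using l by (simp add: Y_def lie_bracket_simps field_simps)
        have "(norm \<langle>Y, X\<rangle>)\<^sup>2 = n\<^sup>2 * (norm X)\<^sup>2"
          using inv[OF YL, of X "\<langle>Y, X\<rangle>"] by (simp add: X(2) power2_norm_eq_inner)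
        moreover have "(norm \<langle>Y, X\<rangle>)\<^sup>2 \<le> (norm X)\<^sup>2" using b by (intro power_mono) auto
        ultimately have "(n\<^sup>2 - 1) * (norm X)\<^sup>2 \<le> 0" by (simp add: algebra_simps)
        moreover have "n\<^sup>2 > 1" using X(3) by (simp add: one_less_power)
        ultimately have "(norm X)\<^sup>2 \<le> 0" by (simp add: mult_le_0_iff)
        then show "X = 0" by simp
      qed
      \<comment> \<open>In complex terms \<open>U - \<i> U'\<close> and \<open>V - \<i> V'\<close>
        have the roots 1 and m. Up to sign, \<open>A\<close> and \<open>B\<close> are the real and
        imaginary parts of their bracket, whose root 1 + m exceeds the largest one, so both
        vanish.\<close>
      have sum_rule: "\<langle>U, V\<rangle> = \<langle>U', V'\<rangle>" "\<langle>U', V\<rangle> = - \<langle>U, V'\<rangle>"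
        if V: "V \<in> L" "V' \<in> L" "\<langle>Y, V\<rangle> = m *\<^sub>R V'" "\<langle>Y, V'\<rangle> = - (m *\<^sub>R V)" "m > 0" for V V' m
      proof -
        define A where "A = \<langle>U, V\<rangle> - \<langle>U', V'\<rangle>"
        define B where "B = \<langle>U, V'\<rangle> + \<langle>U', V\<rangle>"
        have deriv: "\<langle>Y, \<langle>P, Q\<rangle>\<rangle> = \<langle>\<langle>Y, P\<rangle>, Q\<rangle> + \<langle>P, \<langle>Y, Q\<rangle>\<rangle>" for P Q
          using lie_bracket_jacobi[of Y P Q] by simp
        have YA: "\<langle>Y, A\<rangle> = (1 + m) *\<^sub>R B"
          by (simp add: A_def B_def lie_bracket_simps deriv YU YU' V(3,4) algebra_simps)
        have YB: "\<langle>Y, B\<rangle> = - ((1 + m) *\<^sub>R A)"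
          by (simp add: A_def B_def lie_bracket_simps deriv YU YU' V(3,4) algebra_simps)
        have "A \<in> L" by (simp add: A_def Lcl UL U'L V)
        moreover have "\<langle>Y, \<langle>Y, A\<rangle>\<rangle> = - ((1 + m)\<^sup>2 *\<^sub>R A)"
          by (simp add: YA YB lie_bracket_simps power2_eq_square)
        ultimately have "A = 0" using V(5) by (intro big[of A "1 + m"]) auto
        moreover have "B = 0" using YA V(5) \<open>A = 0\<close> by (simp add: lie_bracket_simps)
        ultimately show "\<langle>U, V\<rangle> = \<langle>U', V'\<rangle>" "\<langle>U', V\<rangle> = - \<langle>U, V'\<rangle>"
          by (simp_all add: A_def B_def eq_neg_iff_add_eq_0 add.commute)
      qed
      \<comment> \<open>For root 1 the sum rule makes \<open>\<langle>U, V\<rangle>\<close> commute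
        with \<open>Y\<close>. It is also orthogonal to \<open>Y\<close>, hence zero, and the rank
        hypothesis makes \<open>V\<close> a multiple of \<open>U\<close>.\<close>
      have simple: "V = 0" if V: "V \<in> L" "\<langle>Y, \<langle>Y, V\<rangle>\<rangle> = - V" "V \<bullet> U = 0" "V \<bullet> U' = 0" for V
      proof -
        have "\<langle>U', V\<rangle> = - \<langle>U, \<langle>Y, V\<rangle>\<rangle>"
          using sum_rule(2)[of V "\<langle>Y, V\<rangle>" 1] V by (simp add: br YL)
        then have "\<langle>Y, \<langle>U, V\<rangle>\<rangle> = 0"
          using lie_bracket_jacobi[of Y U V] by (simp add: YU)
        moreover have "\<langle>U, V\<rangle> \<bullet> Y = 0"
          using inv[OF UL, of V Y] V(4) by (simp add: YUc)
        ultimately have "\<langle>U, V\<rangle> = 0" using perp[of "\<langle>U, V\<rangle>"] by (simp add: br UL V)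
        then obtain c where "V = c *\<^sub>R U" using rank[OF UL V(1) _ U0] by blast
        then show "V = 0" using V(3) U0 by simp
      qed
      define K2 where "K2 = {X \<in> L. X \<bullet> Y = 0 \<and> X \<bullet> U = 0 \<and> X \<bullet> U' = 0}"
      have K2: "subspace K2"
        using sub by (auto simp: K2_def subspace_def inner_add_left)
      have UU': "U \<bullet> U' = 0"
        using inv[OF YL, of U U] by (simp add: YU inner_commute)
      have YU'p: "Y \<bullet> U' = 0"
        using inv[OF YL, of U Y] by (simp add: YU inner_commute)
      have nU': "U' \<bullet> U' = 1"
        using inv[OF YL, of U U'] U(2) by (simp add: YU YU' norm_eq_1)
      have nU: "U \<bullet> U = 1" using U(2) by (simp add: norm_eq_1)
      have "K2 = {0}"
      proof (rule ccontr)
        assume "K2 \<noteq> {0}"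
        then obtain V m where VK: "V \<in> K2" "norm V = 1" and m0: "m \<ge> 0"
          and Veig: "\<langle>Y, \<langle>Y, V\<rangle>\<rangle> = - (m\<^sup>2 *\<^sub>R V)"
        proof (rule rayleigh_maximum[OF K2 _ lin[of Y]])
          show "\<langle>Y, X\<rangle> \<in> K2" if "X \<in> K2" for X
            using that inv[OF YL, of X Y] inv[OF YL, of X U] inv[OF YL, of X U']
            by (simp add: K2_def br YL YU YU')
          show "\<langle>Y, X\<rangle> \<bullet> X' = - (X \<bullet> \<langle>Y, X'\<rangle>)" for X X' by (rule inv[OF YL])
        qed blast
        have VL: "V \<in> L" and V0: "V \<noteq> 0" using VK by (auto simp: K2_def)
        have Vp: "V \<bullet> Y = 0" "V \<bullet> U = 0" "V \<bullet> U' = 0" using VK by (auto simp: K2_def)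
        have "m \<noteq> 0"
        proof
          assume "m = 0"
          then have "\<langle>Y, V\<rangle> \<bullet> \<langle>Y, V\<rangle> = 0" using inv[OF YL, of V "\<langle>Y, V\<rangle>"] Veig by simp
          then show False using perp[OF VL Vp(1)] V0 by simp
        qed
        with m0 have m: "m > 0" by simp
        have "m \<noteq> 1" using simple[OF VL _ Vp(2,3)] Veig V0 by auto
        moreover have "\<not> m > 1" using big[OF VL Veig] V0 by blast
        ultimately have m1: "m < 1" by simp
        define V' where "V' = (1 / m) *\<^sub>R \<langle>Y, V\<rangle>"
        have YV: "\<langle>Y, V\<rangle> = m *\<^sub>R V'" and YV': "\<langle>Y, V'\<rangle> = - (m *\<^sub>R V)"
          using m Veig by (auto simp: V'_def lie_bracket_simps power2_eq_square)
        have V'L: "V' \<in> L" by (simp add: V'_def Lcl YL VL)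
        have deriv: "\<langle>Y, \<langle>P, Q\<rangle>\<rangle> = \<langle>\<langle>Y, P\<rangle>, Q\<rangle> + \<langle>P, \<langle>Y, Q\<rangle>\<rangle>" for P Q
          using lie_bracket_jacobi[of Y P Q] by simp
        obtain c where c: "\<langle>U, U'\<rangle> = c *\<^sub>R Y"
          using rank[OF YL, of "\<langle>U, U'\<rangle>"] Ynz
          by (auto simp: br UL U'L deriv YU YU' lie_bracket_simps)
        have cpos: "c > 0"
        proof -
          have "c * (Y \<bullet> Y) = 1"
            using inv[OF UL, of U' Y] by (simp add: c YUc nU')
          then show ?thesis by (metis inner_ge_zero less_numeral_extra(1) mult_nonpos_nonneg not_le)
        qed
        \<comment> \<open>The sum root 1 + m does not occur, so the brackets of the two pairs lie in
          the difference root 1 - m, represented by \<open>R\<close> and \<open>X\<close>. The sum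
          rule applies to this pair in turn, and \<open>U\<close> maps it back to \<open>V'\<close>
          and \<open>V\<close>.\<close>
        define X where "X = \<langle>U, V\<rangle>"
        define R where "R = \<langle>U, V'\<rangle>"
        have XL: "X \<in> L" and RL: "R \<in> L" by (simp_all add: X_def R_def br UL VL V'L)
        have U'V: "\<langle>U', V\<rangle> = - R" and U'V': "\<langle>U', V'\<rangle> = X"
          using sum_rule[OF VL V'L YV YV' m] by (auto simp: X_def R_def)
        have YX: "\<langle>Y, X\<rangle> = - ((1 - m) *\<^sub>R R)"
          by (simp add: X_def deriv YU YV lie_bracket_simps U'V flip: R_def) (simp add: algebra_simps)
        have YR: "\<langle>Y, R\<rangle> = (1 - m) *\<^sub>R X"
          by (simp add: R_def deriv YU YV' lie_bracket_simps U'V' flip: X_def) (simp add: algebra_simps)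
        have U'R: "\<langle>U', R\<rangle> = - \<langle>U, X\<rangle>" and U'X: "\<langle>U', X\<rangle> = \<langle>U, R\<rangle>"
          using sum_rule[OF RL XL YR YX] m1 by auto
        have UR: "\<langle>U, R\<rangle> = - ((c * m / 2) *\<^sub>R V')"
        proof -
          have "\<langle>\<langle>U, U'\<rangle>, V\<rangle> = - (2 *\<^sub>R \<langle>U, R\<rangle>)"
            unfolding lie_bracket_jacobi[of U U' V]
            by (simp add: U'V lie_bracket_simps U'X scaleR_2 flip: X_def)
          then have "2 *\<^sub>R \<langle>U, R\<rangle> = - ((c * m) *\<^sub>R V')"
            by (simp add: c lie_bracket_simps YV eq_neg_iff_add_eq_0 add.commute)
          from arg_cong[OF this, of "\<lambda>W. (1/2) *\<^sub>R W"] show ?thesis by simp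
        qed
        have UX: "\<langle>U, X\<rangle> = - ((c * m / 2) *\<^sub>R V)"
        proof -
          have "\<langle>\<langle>U, U'\<rangle>, V'\<rangle> = 2 *\<^sub>R \<langle>U, X\<rangle>"
            unfolding lie_bracket_jacobi[of U U' V']
            by (simp add: U'V' lie_bracket_simps U'R scaleR_2 flip: R_def)
          then have "2 *\<^sub>R \<langle>U, X\<rangle> = - ((c * m) *\<^sub>R V)"
            by (simp add: c lie_bracket_simps YV')
          from arg_cong[OF this, of "\<lambda>W. (1/2) *\<^sub>R W"] show ?thesis by simp
        qed
        have X0: "X \<noteq> 0" using UX cpos m V0 by (auto simp: lie_bracket_simps)
        \<comment> \<open>The double bracket below is computed twice: as \<open>c\<close> times the
          action of \<open>Y\<close>, with factor 1 - m, and by the Jacobi identity, with factor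
          m.\<close>
        have "m = 1 / 2"
        proof -
          have "\<langle>\<langle>U, U'\<rangle>, R\<rangle> = (c * m) *\<^sub>R X"
          proof -
            have "\<langle>U', \<langle>U, R\<rangle>\<rangle> = (c * m / 2) *\<^sub>R (- X)"
              by (simp add: UR lie_bracket_simps U'V')
            moreover have "\<langle>U, \<langle>U, X\<rangle>\<rangle> = (c * m / 2) *\<^sub>R (- X)"
              by (simp add: UX lie_bracket_simps flip: X_def)
            ultimately show ?thesis
              unfolding lie_bracket_jacobi[of U U' R]
              by (simp add: U'R lie_bracket_simps flip: scaleR_add_left)
          qed
          then have "(c * (1 - m)) *\<^sub>R X = (c * m) *\<^sub>R X"
            by (simp add: c lie_bracket_simps YR)
          then show ?thesis using X0 cpos by simp
        qed
        note YX = YX[unfolded this] and YR = YR[unfolded this] and YV = YV[unfolded this]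
          and YV' = YV'[unfolded this]
        have YVc: "\<langle>V, Y\<rangle> = - ((1/2) *\<^sub>R V')" and YV'c: "\<langle>V', Y\<rangle> = (1/2) *\<^sub>R V"
          using lie_bracket_anti[of V Y] lie_bracket_anti[of V' Y] by (simp_all add: YV YV')
        have nV: "V \<bullet> V = 1" using VK(2) by (simp add: norm_eq_1)
        have nV': "V' \<bullet> V' = 1"
          using inv[OF YL, of V V'] nV by (simp add: YV YV')
        obtain e where e: "\<langle>V, V'\<rangle> = e *\<^sub>R Y"
          using rank[OF YL, of "\<langle>V, V'\<rangle>"] Ynz
          by (auto simp: br VL V'L deriv YV YV' lie_bracket_simps)
        have epos: "e > 0"
        proof -
          have "e * (Y \<bullet> Y) = 1 / 2"
            using inv[OF VL, of V' Y] by (simp add: e YVc nV')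
          then show ?thesis
            by (metis half_gt_zero_iff inner_ge_zero less_numeral_extra(1) mult_nonpos_nonneg not_le)
        qed
        have XV': "X \<bullet> V' = 0"
          using inv[OF UL, of V V'] inv[OF U'L, of V V] by (simp add: U'V inner_commute flip: X_def R_def)
        have XV: "X \<bullet> V = 0"
          using inv[OF UL, of V V] by (simp add: inner_commute flip: X_def)
        have RV: "R \<bullet> V = 0"
          using inv[OF U'L, of V V] by (simp add: U'V inner_commute)
        have RV': "R \<bullet> V' = 0"
          using inv[OF UL, of V' V'] by (simp add: inner_commute flip: R_def)
        have XR: "X \<bullet> R = 0"
          using inv[OF YL, of X X] by (simp add: YX inner_commute)
        \<comment> \<open>\<open>V, V'\<close> and \<open>R, X\<close> now both have root 1/2. The
          root 0 part of their brackets commutes with \<open>Y\<close> and is orthogonal to it, so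
          it vanishes; the root 1 part survives.\<close>
        have VX: "\<langle>V, X\<rangle> = \<langle>V', R\<rangle>"
        proof -
          have "\<langle>V, X\<rangle> - \<langle>V', R\<rangle> = 0"
          proof (rule perp)
            show "(\<langle>V, X\<rangle> - \<langle>V', R\<rangle>) \<bullet> Y = 0"
              using inv[OF VL, of X Y] inv[OF V'L, of R Y]
              by (simp add: inner_diff_left YVc YV'c XV' RV)
          qed (simp_all add: Lcl VL V'L XL RL lie_bracket_simps deriv YV YV' YX YR)
          then show ?thesis by simp
        qed
        have VR: "\<langle>V, R\<rangle> = - \<langle>V', X\<rangle>"
        proof -
          have "\<langle>V, R\<rangle> + \<langle>V', X\<rangle> = 0"
          proof (rule perp)
            show "(\<langle>V, R\<rangle> + \<langle>V', X\<rangle>) \<bullet> Y = 0"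
              using inv[OF VL, of R Y] inv[OF V'L, of X Y]
              by (simp add: inner_add_left YVc YV'c XV RV')
          qed (simp_all add: Lcl VL V'L XL RL lie_bracket_simps deriv YV YV' YX YR VX)
          then show ?thesis by (simp add: eq_neg_iff_add_eq_0)
        qed
        have YVX: "\<langle>Y, \<langle>V, X\<rangle>\<rangle> = \<langle>V', X\<rangle>"
          by (simp add: deriv YV YX lie_bracket_simps VR flip: scaleR_add_left)
        have YV'X: "\<langle>Y, \<langle>V', X\<rangle>\<rangle> = - \<langle>V, X\<rangle>"
          by (simp add: deriv YV' YX lie_bracket_simps VX flip: scaleR_add_left)
        \<comment> \<open>\<open>\<langle>V, X\<rangle>\<close> has root 1, so \<open>simple\<close>
          makes it a multiple of \<open>U\<close>; its inner product with \<open>U\<close>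
          identifies the factor.\<close>
        define al where "al = X \<bullet> X"
        have "\<langle>V, X\<rangle> - al *\<^sub>R U = 0"
        proof (rule simple)
          show "(\<langle>V, X\<rangle> - al *\<^sub>R U) \<bullet> U = 0"
            using inv[OF VL, of X U] lie_bracket_anti[of V U]
            by (simp add: inner_diff_left nU al_def flip: X_def)
          show "(\<langle>V, X\<rangle> - al *\<^sub>R U) \<bullet> U' = 0"
            using inv[OF VL, of X U'] lie_bracket_anti[of V U']
            by (simp add: inner_diff_left UU' U'V XR)
        qed (simp_all add: Lcl VL XL UL lie_bracket_simps YVX YV'X YU YU')
        then have VX': "\<langle>V, X\<rangle> = al *\<^sub>R U" by simp
        then have V'X': "\<langle>V', X\<rangle> = al *\<^sub>R U'" using YVX by (simp add: lie_bracket_simps YU)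
        \<comment> \<open>The same double bracket is \<open>e\<close> times the action of
          \<open>Y\<close> on \<open>X\<close>, that is \<open>- (e / 2)\<close> times
          \<open>R\<close>. As e > 0 and al \<ge> 0, the signs are incompatible.\<close>
        have "\<langle>\<langle>V, V'\<rangle>, X\<rangle> = (2 * al) *\<^sub>R R"
        proof -
          have 1: "\<langle>V, U'\<rangle> = R" "\<langle>V', U\<rangle> = - R"
            using lie_bracket_anti[of V U'] lie_bracket_anti[of V' U] by (simp_all add: U'V flip: R_def)
          show ?thesis
            unfolding lie_bracket_jacobi[of V V' X] VX' V'X' lie_bracket_simps 1
            by (simp only: scaleR_minus_right diff_minus_eq_add scaleR_add_left[symmetric] mult_2)
        qed
        then have "(e / 2 + 2 * al) *\<^sub>R R = 0"
          by (simp add: e lie_bracket_simps YX scaleR_add_left)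
             (metis add.commute neg_eq_iff_add_eq_0)
        moreover have "R \<noteq> 0" using UR cpos m nV' by (auto simp: lie_bracket_simps)
        moreover have "al \<ge> 0" by (simp add: al_def)
        ultimately show False using epos by simp
      qed
      have "L \<subseteq> span {Y, U, U'}"
      proof
        fix X assume X: "X \<in> L"
        define P where "P = ((X \<bullet> Y) / (Y \<bullet> Y)) *\<^sub>R Y + (X \<bullet> U) *\<^sub>R U + (X \<bullet> U') *\<^sub>R U'"
        have "X - P \<in> K2"
          using X YL UL U'L Ynz
          by (simp add: K2_def P_def Lcl inner_diff_left inner_add_left nU nU' UU' UperpY YU'p
              inner_commute[of Y U] inner_commute[of U' U] inner_commute[of U' Y])
        then have "X = P" using \<open>K2 = {0}\<close> by simp
        also have "P \<in> span {Y, U, U'}"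
          unfolding P_def by (intro span_add span_scale span_base) auto
        finally show "X \<in> span {Y, U, U'}" .
      qed
      then show ?thesis by (rule that)
    qed
  qed
qed

section \<open>Exponentials and automorphisms\<close>

lemma bounded_bilinear_mv: "bounded_bilinear (\<lambda>(A::real^'n^'m) v. A *v v)"
  by (rule bilinear_conv_bounded_bilinear[THEN iffD1])
     (auto simp: bilinear_def mv_simps intro!: linearI)

lemma bounded_bilinear_mm: "bounded_bilinear (\<lambda>(A::real^'n^'n) (B::real^'n^'n). A ** B)"
  by (rule bilinear_conv_bounded_bilinear[THEN iffD1])
     (auto simp: bilinear_def matrix_eq mv_simps matrix_vector_mul_assoc[symmetric] intro!: linearI)

interpretation mv: bounded_bilinear "\<lambda>(A::oct_endo) v. A *v v"
  by (rule bounded_bilinear_mv)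

interpretation mm: bounded_bilinear "\<lambda>(A::oct_endo) (B::oct_endo). A ** B"
  by (rule bounded_bilinear_mm)

lemma bounded_linear_transpose: "bounded_linear (transpose :: oct_endo \<Rightarrow> oct_endo)"
  unfolding linear_conv_bounded_linear[symmetric]
  by (rule linearI) (simp_all add: transpose_def vec_eq_iff)

definition mat_pow :: "oct_endo \<Rightarrow> nat \<Rightarrow> oct_endo" where
  "mat_pow X n = (((**) X) ^^ n) (mat 1)"

lemma mat_pow_0 [simp]: "mat_pow X 0 = mat 1"
  and mat_pow_Suc [simp]: "mat_pow X (Suc n) = X ** mat_pow X n"
  by (simp_all add: mat_pow_def)

lemma mat_pow_scaleR: "mat_pow (t *\<^sub>R X) n = t ^ n *\<^sub>R mat_pow X n"
  by (induction n) (simp_all add: mm.scaleR_left mm.scaleR_right)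

lemma summable_mat_exp: "summable (\<lambda>n. (1 / fact n) *\<^sub>R mat_pow X n)"
proof -
  obtain K where K: "K > 0" "\<And>B :: oct_endo. norm (X ** B) \<le> norm B * K"
    using bounded_linear.pos_bounded[OF mm.bounded_linear_right[of X]] by auto
  have pow: "norm (mat_pow X n) \<le> K ^ n * norm (mat 1 :: oct_endo)" for n
  proof (induction n)
    case (Suc n)
    have "norm (mat_pow X (Suc n)) \<le> norm (mat_pow X n) * K" using K(2) by simp
    also have "\<dots> \<le> K ^ n * norm (mat 1 :: oct_endo) * K"
      using Suc K(1) by (intro mult_right_mono) auto
    finally show ?case by (simp add: mult_ac)
  qed simp
  have "summable (\<lambda>n. (inverse (fact n) * K ^ n) * norm (mat 1 :: oct_endo))"
    by (intro summable_mult2 summable_exp)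
  then show ?thesis
  proof (rule summable_comparison_test'[where N = 0])
    show "norm ((1 / fact n) *\<^sub>R mat_pow X n) \<le> inverse (fact n) * K ^ n * norm (mat 1 :: oct_endo)" for n
      using mult_left_mono[OF pow[of n], of "inverse (fact n)"] by (simp add: divide_inverse mult.assoc)
  qed
qed

lemma endo_exp_0 [simp]: "endo_exp 0 = mat 1"
proof -
  have "mat_pow 0 n = (if n = 0 then mat 1 else 0)" for n
    by (cases n) (simp_all add: mm.zero_left)
  then have "endo_exp 0 = (\<Sum>n. (1 / fact n) *\<^sub>R (if n = 0 then mat 1 else 0))"
    by (simp add: endo_exp_def flip: mat_pow_def)
  also have "\<dots> = mat 1"
    using suminf_finite[of "{0}" "\<lambda>n. (1 / fact n) *\<^sub>R (if n = 0 then mat 1 else (0::oct_endo))"] by simp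
  finally show ?thesis .
qed

text \<open>Every coordinate is an everywhere convergent real power series in t, so termwise
  differentiation of scalar series applies.\<close>

lemma endo_exp_has_vector_derivative:
  "((\<lambda>t. endo_exp (t *\<^sub>R X)) has_vector_derivative X ** endo_exp (t *\<^sub>R X)) (at t)"
proof -
  have sums: "(\<lambda>n. (1 / fact n) *\<^sub>R mat_pow (t *\<^sub>R X) n) sums endo_exp (t *\<^sub>R X)" for t
    unfolding endo_exp_def using summable_mat_exp[of "t *\<^sub>R X"] by (simp add: mat_pow_def summable_sums)
  have D: "((\<lambda>t. endo_exp (t *\<^sub>R X) \<bullet> b) has_real_derivative (X ** endo_exp (t *\<^sub>R X)) \<bullet> b) (at t)" for b
  proof -
    define c where "c n = (mat_pow X n \<bullet> b) / fact n" for n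
    have c: "(\<lambda>n. c n * t ^ n) sums (endo_exp (t *\<^sub>R X) \<bullet> b)" for t
      using bounded_linear.sums[OF bounded_linear_inner_left[of b] sums[of t]]
      by (simp add: c_def mat_pow_scaleR mult_ac)
    have "(\<lambda>n. diffs c n * t ^ n) sums ((X ** endo_exp (t *\<^sub>R X)) \<bullet> b)"
    proof -
      have "(\<lambda>n. (X ** ((1 / fact n) *\<^sub>R mat_pow (t *\<^sub>R X) n)) \<bullet> b) sums ((X ** endo_exp (t *\<^sub>R X)) \<bullet> b)"
        by (intro bounded_linear.sums[OF bounded_linear_inner_left]
            bounded_linear.sums[OF mm.bounded_linear_right] sums)
      moreover have "(X ** ((1 / fact n) *\<^sub>R mat_pow (t *\<^sub>R X) n)) \<bullet> b = diffs c n * t ^ n" for n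
        by (simp add: mat_pow_scaleR mm.scaleR_right diffs_def c_def field_simps del: of_nat_Suc)
      ultimately show ?thesis by simp
    qed
    moreover have "((\<lambda>t. \<Sum>n. c n * t ^ n) has_real_derivative (\<Sum>n. diffs c n * t ^ n)) (at t)"
      using c by (intro termdiffs_strong_converges_everywhere) (auto simp: sums_iff)
    ultimately show ?thesis using c by (simp add: sums_iff)
  qed
  show ?thesis
    unfolding has_vector_derivative_def
  proof (rule has_derivative_componentwise_within[THEN iffD2, rule_format])
    fix b
    show "((\<lambda>t. endo_exp (t *\<^sub>R X) \<bullet> b) has_derivative
        (\<lambda>h. h *\<^sub>R (X ** endo_exp (t *\<^sub>R X)) \<bullet> b)) (at t)"
      by (rule has_derivative_eq_rhs[OF D[of b, unfolded has_field_derivative_def]]) auto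
  qed
qed

section \<open>Linear differential equations with skew coefficients, and the compact automorphism
  group\<close>

lemma skew_inner:
  assumes "transpose X = - (X :: real^'n^'n)"
  shows "(X *v x) \<bullet> y = - (x \<bullet> (X *v y))"
proof -
  have "(X *v x) \<bullet> y = x \<bullet> (transpose X *v y)"
    by (metis dot_lmul_matrix inner_commute transpose_matrix_vector transpose_transpose)
  then show ?thesis by (simp add: assms mv_minus_left)
qed

text \<open>Conservation of energy. Applied to the difference of two solutions it yields uniqueness,
  and through it every identity for exponentials below.\<close>

lemma skew_ode_norm:
  fixes X :: oct_endo
  assumes X: "transpose X = - X" and f: "\<And>t. (f has_vector_derivative X *v f t) (at t)"
  shows "f t \<bullet> f t = f 0 \<bullet> f 0"
proof -
  have "((\<lambda>t. f t \<bullet> f t) has_real_derivative 0) (at t)" for t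
    using bounded_bilinear.has_vector_derivative[OF bounded_bilinear_inner f f, of t] skew_inner[OF X, of "f t" "f t"]
    by (simp add: has_real_derivative_iff_has_vector_derivative inner_commute)
  then show ?thesis using DERIV_isconst_all[of "\<lambda>t. f t \<bullet> f t" t 0] by blast
qed

lemma skew_ode_unique:
  fixes X :: oct_endo
  assumes X: "transpose X = - X"
    and f: "\<And>t. (f has_vector_derivative X *v f t) (at t)"
    and g: "\<And>t. (g has_vector_derivative X *v g t) (at t)"
    and "f 0 = g 0"
  shows "f t = g t"
proof -
  have "((\<lambda>t. f t - g t) has_vector_derivative X *v (f t - g t)) (at t)" for t
    unfolding mv.diff_right by (intro has_vector_derivative_diff f g)
  from skew_ode_norm[OF X this, of t] show ?thesis by (simp add: assms(4))
qed

lemma transpose_gm: "transpose (gm s t y1 y2 y3 w1 w2 w3) = - gm s t y1 y2 y3 w1 w2 w3"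
proof -
  let ?X = "gm s t y1 y2 y3 w1 w2 w3"
  have "(?X *v x) \<bullet> y = - (x \<bullet> (?X *v y))" for x y
    by (cases x rule: cv_cases; cases y rule: cv_cases)
       (simp add: inner_cv inner_complex_def algebra_simps)
  then have "x \<bullet> (transpose ?X *v y) = x \<bullet> (- ?X *v y)" for x y
    by (metis (no_types) dot_lmul_matrix inner_commute transpose_matrix_vector transpose_transpose
        mv_minus_left inner_minus_right)
  then show ?thesis by (metis matrix_eq vector_eq_ldot)
qed

lemma transpose_g2: "X \<in> g2 \<Longrightarrow> transpose X = - X"
  by (auto elim!: g2_gmE simp: transpose_gm)

text \<open>Orthogonality is built in so that the inverse is the transpose and boundedness is
  immediate.\<close>

definition octaut :: "oct_endo set" where
  "octaut = {g. orthogonal_matrix g \<and> (\<forall>x y. g *v (x \<star> y) = (g *v x) \<star> (g *v y))}"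

lemma endo_exp_mv_has_vector_derivative:
  "((\<lambda>t. endo_exp (t *\<^sub>R X) *v v) has_vector_derivative X *v (endo_exp (t *\<^sub>R X) *v v)) (at t)"
  using bounded_linear.has_vector_derivative[OF mv.bounded_linear_left endo_exp_has_vector_derivative]
  by (simp add: matrix_vector_mul_assoc)

text \<open>The derivation rule for \<open>X\<close> says exactly that the product of two solution
  curves solves the same equation as the curve through the product. Skewness of \<open>X\<close>
  makes the flow orthogonal.\<close>

lemma endo_exp_octaut:
  assumes X: "X \<in> g2"
  shows "endo_exp (t *\<^sub>R X) \<in> octaut"
proof -
  let ?E = "\<lambda>t. endo_exp (t *\<^sub>R X)"
  note sk = transpose_g2[OF X]
  have "(?E t *v v) \<bullet> (?E t *v v) = v \<bullet> v" for v
    using skew_ode_norm[OF sk, of "\<lambda>t. ?E t *v v" t, OF endo_exp_mv_has_vector_derivative] by simp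
  then have "orthogonal_transformation ((*v) (?E t))"
    by (simp add: orthogonal_transformation matrix_vector_mul_linear norm_eq)
  then have "orthogonal_matrix (?E t)"
    using orthogonal_transformation_matrix[of "(*v) (?E t)"] by (simp add: matrix_of_matrix_vector_mul)
  moreover have "?E t *v (x \<star> y) = (?E t *v x) \<star> (?E t *v y)" for x y
  proof (rule skew_ode_unique[OF sk endo_exp_mv_has_vector_derivative])
    show "((\<lambda>t. (?E t *v x) \<star> (?E t *v y)) has_vector_derivative X *v ((?E t *v x) \<star> (?E t *v y))) (at t)" for t
      using oct_mult.has_vector_derivative[OF endo_exp_mv_has_vector_derivative[of X x t] endo_exp_mv_has_vector_derivative[of X y t]]
      by (simp add: g2_mult[OF X] add.commute)
  qed simp
  ultimately show ?thesis by (simp add: octaut_def)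
qed

lemma endo_exp_commute:
  assumes X: "transpose X = - X" and C: "X ** C = C ** X"
  shows "endo_exp (t *\<^sub>R X) ** C = C ** endo_exp (t *\<^sub>R X)"
proof -
  have "endo_exp (t *\<^sub>R X) *v (C *v v) = C *v (endo_exp (t *\<^sub>R X) *v v)" for v
  proof (rule skew_ode_unique[OF X endo_exp_mv_has_vector_derivative])
    show "((\<lambda>t. C *v (endo_exp (t *\<^sub>R X) *v v)) has_vector_derivative
        X *v (C *v (endo_exp (t *\<^sub>R X) *v v))) (at t)" for t
      using bounded_linear.has_vector_derivative[OF mv.bounded_linear_right[of C] endo_exp_mv_has_vector_derivative[of X v t]]
      by (simp add: matrix_vector_mul_assoc C matrix_mul_assoc)
  qed simp
  then show ?thesis by (simp add: matrix_eq matrix_vector_mul_assoc[symmetric])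
qed


declare transpose_matrix_vector [simp del]

lemma octaut_mult: "g \<in> octaut \<Longrightarrow> h \<in> octaut \<Longrightarrow> g ** h \<in> octaut"
  by (simp add: octaut_def orthogonal_matrix_mul matrix_vector_mul_assoc[symmetric])

lemma octaut_one: "mat 1 \<in> octaut"
  by (simp add: octaut_def orthogonal_matrix_id)

lemma octaut_transpose_mult:
  assumes "g \<in> octaut"
  shows "transpose g ** g = mat 1" "g ** transpose g = mat 1"
    and "transpose g *v (g *v v) = v" "g *v (transpose g *v v) = v"
proof -
  show 1: "transpose g ** g = mat 1" "g ** transpose g = mat 1"
    using assms by (auto simp: octaut_def orthogonal_matrix_def)
  show "transpose g *v (g *v v) = v" "g *v (transpose g *v v) = v"
    by (simp_all add: matrix_vector_mul_assoc 1)
qed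

lemma octaut_transpose:
  assumes g: "g \<in> octaut"
  shows "transpose g \<in> octaut"
proof -
  note t = octaut_transpose_mult[OF g]
  have "transpose g *v (x \<star> y) = (transpose g *v x) \<star> (transpose g *v y)" for x y
  proof -
    have "g *v ((transpose g *v x) \<star> (transpose g *v y)) = x \<star> y"
      using g by (simp add: octaut_def t)
    then show ?thesis by (metis t(3))
  qed
  then show ?thesis using g by (simp add: octaut_def)
qed

lemma matrix_inv_octaut: "g \<in> octaut \<Longrightarrow> matrix_inv g = transpose g"
  by (rule matrix_inv_eqI) (simp add: octaut_transpose_mult)

lemma Ad_octaut: "g \<in> octaut \<Longrightarrow> Ad g X = g ** X ** transpose g"
  by (simp add: Ad_def matrix_inv_octaut)

lemma Ad_octaut_mv: "g \<in> octaut \<Longrightarrow> Ad g X *v v = g *v (X *v (transpose g *v v))"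
  by (simp add: Ad_mv matrix_inv_octaut)

lemma Ad_octaut_transpose:
  assumes "g \<in> octaut"
  shows "Ad (transpose g) (Ad g X) = X" "Ad g (Ad (transpose g) X) = X"
  by (simp_all add: matrix_eq Ad_octaut_mv octaut_transpose assms octaut_transpose_mult[OF assms])

lemma Ad_g2:
  assumes g: "g \<in> octaut" and X: "X \<in> g2"
  shows "Ad g X \<in> g2"
proof -
  have "transpose g *v (x \<star> y) = (transpose g *v x) \<star> (transpose g *v y)"
    and "g *v (x \<star> y) = (g *v x) \<star> (g *v y)" for x y
    using g octaut_transpose[OF g] by (simp_all add: octaut_def)
  then show ?thesis
    by (simp add: g2_def Ad_octaut_mv[OF g] g2_mult[OF X] mv_simps octaut_transpose_mult[OF g])
qed

lemma Ad_lie_bracket: "g \<in> octaut \<Longrightarrow> Ad g \<langle>X, Y\<rangle> = \<langle>Ad g X, Ad g Y\<rangle>"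
  by (simp add: matrix_eq Ad_octaut_mv lie_bracket_mv mv_simps octaut_transpose_mult)

lemma linear_Ad: "linear (Ad g)"
  by (intro linearI) (simp_all add: Ad_def mm.add_left mm.add_right mm.scaleR_left mm.scaleR_right)

lemma compact_octaut: "compact octaut"
proof -
  have "octaut = {g. transpose g ** g = mat 1} \<inter> (\<Inter>x. \<Inter>y. {g. g *v (x \<star> y) = (g *v x) \<star> (g *v y)})"
    by (auto simp: octaut_def orthogonal_matrix)
  also have "closed \<dots>"
    by (intro closed_Int closed_INT ballI closed_Collect_eq mm.continuous_on mv.continuous_on
        oct_mult.continuous_on continuous_on_const continuous_on_id
        bounded_linear.continuous_on[OF bounded_linear_transpose])
  finally have "closed octaut" .
  moreover have "bounded octaut"
  proof (rule boundedI)
    fix g assume "g \<in> octaut"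
    then have "g \<bullet> g = (mat 1 :: oct_endo) \<bullet> mat 1"
      using inner_matrix_matrix_mult[of g g "mat 1"] by (simp add: octaut_transpose_mult)
    then show "norm g \<le> norm (mat 1 :: oct_endo)" by (simp add: norm_le)
  qed
  ultimately show ?thesis by (simp add: compact_eq_bounded_closed)
qed

text \<open>
  At a maximum of \<open>\<lambda>g. Ad g Y \<bullet> H\<close> the derivative in the direction \<open>\<langle>Ad g Y, H\<rangle>\<close> is the square of
  the norm of that direction.
\<close>

lemma conj_commute:
  assumes Y: "Y \<in> g2" and H: "H \<in> g2"
    and C: "\<And>C. C \<in> S \<Longrightarrow> \<langle>C, Y\<rangle> = 0" "\<And>C. C \<in> S \<Longrightarrow> \<langle>C, H\<rangle> = 0"
  obtains g where "g \<in> octaut" "\<And>C. C \<in> S \<Longrightarrow> Ad g C = C" "\<langle>Ad g Y, H\<rangle> = 0"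
proof -
  \<comment> \<open>Restricting the maximum to automorphisms commuting with \<open>S\<close> allows
    a second element to be conjugated without moving the first.\<close>
  define G where "G = octaut \<inter> (\<Inter>C\<in>S. {g. g ** C = C ** g})"
  have "closed (\<Inter>C\<in>S. {g. g ** C = C ** (g::oct_endo)})"
    by (intro closed_INT ballI closed_Collect_eq mm.continuous_on continuous_on_const continuous_on_id)
  with compact_octaut have "compact G" unfolding G_def by (rule compact_Int_closed)
  moreover have "mat 1 \<in> G" by (simp add: G_def octaut_one)
  then have "G \<noteq> {}" by blast
  moreover have "continuous_on G (\<lambda>g. (g ** Y ** transpose g) \<bullet> H)"
    by (intro continuous_on_inner mm.continuous_on continuous_on_const continuous_on_id
        bounded_linear.continuous_on[OF bounded_linear_transpose])
  ultimately obtain g where g: "g \<in> G"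
    and max: "\<And>h. h \<in> G \<Longrightarrow> (h ** Y ** transpose h) \<bullet> H \<le> (g ** Y ** transpose g) \<bullet> H"
    using continuous_attains_sup[of G "\<lambda>g. (g ** Y ** transpose g) \<bullet> H"] by blast
  have gO: "g \<in> octaut" and gC: "\<And>C. C \<in> S \<Longrightarrow> g ** C = C ** g" using g by (auto simp: G_def)
  have AdC: "Ad g C = C" if "C \<in> S" for C
    using gC[OF that] gO by (simp add: Ad_octaut matrix_mul_assoc[symmetric] octaut_transpose_mult)
  define Y' where "Y' = Ad g Y"
  have Y': "Y' \<in> g2" using gO Y by (simp add: Y'_def Ad_g2)
  \<comment> \<open>The variation must stay inside \<open>G\<close>: \<open>D\<close> commutes with
    every \<open>C\<close> in \<open>S\<close> by the Jacobi identity, because \<open>Y'\<close> and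
    \<open>H\<close> do, and so does its exponential.\<close>
  define D where "D = \<langle>Y', H\<rangle>"
  have D: "D \<in> g2" using Y' H lie_subalgebra_g2 by (simp add: D_def lie_subalgebra_def)
  have CD: "D ** C = C ** D" if "C \<in> S" for C
  proof -
    have "\<langle>C, Y'\<rangle> = 0"
      using Ad_lie_bracket[OF gO, of C Y] C(1)[OF that] AdC[OF that] linear_0[OF linear_Ad, of g]
      by (simp add: Y'_def)
    then have "\<langle>C, D\<rangle> = 0"
      using lie_bracket_jacobi[of C Y' H] C(2)[OF that] by (simp add: D_def lie_bracket_simps)
    then show ?thesis by (simp add: lie_bracket_def)
  qed
  define E where "E t = endo_exp (t *\<^sub>R D)" for t
  have EG: "E t ** g \<in> G" for t
  proof -
    have "E t ** g ** C = C ** (E t ** g)" if "C \<in> S" for C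
    proof -
      have "E t ** g ** C = E t ** C ** g" by (simp add: gC[OF that] flip: matrix_mul_assoc)
      also have "\<dots> = C ** (E t ** g)"
        unfolding E_def endo_exp_commute[OF transpose_g2[OF D] CD[OF that]] by (simp add: matrix_mul_assoc)
      finally show ?thesis .
    qed
    then show ?thesis
      by (simp add: G_def octaut_mult gO E_def endo_exp_octaut[OF D])
  qed
  define f where "f t = (E t ** Y' ** transpose (E t)) \<bullet> H" for t
  have E0: "E 0 = mat 1" by (simp add: E_def)
  have le: "f t \<le> f 0" for t
    using max[OF EG[of t]] Ad_octaut[OF gO, of Y]
    by (simp add: f_def E0 Y'_def matrix_transpose_mul matrix_mul_assoc transpose_mat)
  have dE: "(E has_vector_derivative D ** E t) (at t)" for t
    unfolding E_def by (rule endo_exp_has_vector_derivative)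
  have "(f has_real_derivative (D ** Y' - Y' ** D) \<bullet> H) (at 0)"
  proof -
    have "((\<lambda>t. E t ** Y' ** transpose (E t)) has_vector_derivative
        (E 0 ** Y') ** transpose (D ** E 0) + (D ** E 0 ** Y') ** transpose (E 0)) (at 0)"
      by (intro mm.has_vector_derivative bounded_linear.has_vector_derivative[OF bounded_linear_transpose]
          bounded_linear.has_vector_derivative[OF mm.bounded_linear_left] dE)
    from bounded_linear.has_vector_derivative[OF bounded_linear_inner_left[of H] this]
    show ?thesis
      unfolding f_def[abs_def] has_real_derivative_iff_has_vector_derivative
      by (simp add: E0 transpose_mat transpose_g2[OF D] mm.minus_right)
  qed
  then have "(D ** Y' - Y' ** D) \<bullet> H = 0"
    by (rule DERIV_local_max[of _ _ 0 1]) (use le in auto)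
  then have "\<langle>Y', D\<rangle> \<bullet> H = 0"
    by (simp add: lie_bracket_def inner_diff_left)
  then have "D \<bullet> D = 0"
    using inner_lie_bracket[OF transpose_g2[OF Y'], of D H] by (simp add: D_def)
  then have "\<langle>Ad g Y, H\<rangle> = 0" by (simp add: D_def Y'_def)
  with gO AdC show ?thesis by (rule that)
qed

section \<open>The residual circle\<close>

lemma g_res_octaut: "g_res \<theta> \<in> octaut"
  unfolding g_res_def by (rule endo_exp_octaut) (simp add: D_ij_gm gm_in_g2)

text \<open>The generator is \<open>gm 1 1 0 0 0 0 0 0\<close>, the diagonal matrix with entries
  \<open>\<i>\<close>, \<open>\<i>\<close>, \<open>- 2 * \<i>\<close>. The trigonometric curve
  \<open>g\<close> solves the same differential equation.\<close>

lemma g_res_cv: "g_res \<theta> *v cv r0 r x y z = cv r0 r (cis \<theta> * x) (cis \<theta> * y) (cis (- 2 * \<theta>) * z)"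
proof -
  let ?X = "gm 1 1 0 0 0 0 0 0"
  define g where "g t = cv r0 r 0 0 0 + cos t *\<^sub>R cv 0 0 x y 0 + sin t *\<^sub>R cv 0 0 (\<i> * x) (\<i> * y) 0
    + cos (2 * t) *\<^sub>R cv 0 0 0 0 z + sin (2 * t) *\<^sub>R cv 0 0 0 0 (- \<i> * z)" for t
  have "endo_exp (\<theta> *\<^sub>R ?X) *v cv r0 r x y z = g \<theta>"
  proof (rule skew_ode_unique[OF transpose_gm endo_exp_mv_has_vector_derivative])
    show "(g has_vector_derivative ?X *v g t) (at t)" for t
    proof -
      have "(g has_vector_derivative (0 + (- sin t) *\<^sub>R cv 0 0 x y 0 + cos t *\<^sub>R cv 0 0 (\<i> * x) (\<i> * y) 0
          + (- 2 * sin (2 * t)) *\<^sub>R cv 0 0 0 0 z + (2 * cos (2 * t)) *\<^sub>R cv 0 0 0 0 (- \<i> * z))) (at t)"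
        unfolding g_def
        by (intro has_vector_derivative_add has_vector_derivative_const
            bounded_linear.has_vector_derivative[OF bounded_linear_scaleR_left];
            unfold has_real_derivative_iff_has_vector_derivative[symmetric];
            auto intro!: derivative_eq_intros)
      then show ?thesis
        by (rule has_vector_derivative_eq_rhs) (simp add: g_def complex_eq_iff)
    qed
    show "endo_exp (0 *\<^sub>R ?X) *v cv r0 r x y z = g 0"
      by (simp add: g_def del: gm_linear)
  qed
  moreover have "g_res \<theta> = endo_exp (\<theta> *\<^sub>R ?X)"
    by (simp add: g_res_def D_ij_gm)
  ultimately have "g_res \<theta> *v cv r0 r x y z = g \<theta>" by simp
  then show ?thesis
    by (simp add: g_def complex_eq_iff)
qed

lemma transpose_g_res: "transpose (g_res \<theta>) = g_res (- \<theta>)"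
proof -
  have "g_res \<theta> *v (g_res (- \<theta>) *v v) = v" for v
    by (cases v rule: cv_cases) (simp add: g_res_cv mult.assoc[symmetric] cis_mult)
  then show ?thesis
    by (metis matrix_eq octaut_transpose_mult(3) g_res_octaut)
qed

text \<open>The slot \<open>y1\<close> has weight 1; the slot \<open>w1\<close> joins the
  coordinates of weights 1 and -2 and so has weight 3. This makes \<open>p * cnj q ^ 3\<close> an
  invariant.\<close>

lemma Ad_g_res_Zgen: "Ad (g_res \<theta>) (Zgen a d q p) = Zgen a d (cis \<theta> * q) (cis \<theta> ^ 3 * p)"
proof -
  define c where "c = cis \<theta>"
  define k where "k = cis (- \<theta>)"
  have ck: "c * k = 1" and cnj: "cnj c = k" "cnj k = c" by (simp_all add: c_def k_def cis_mult cis_cnj)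
  have [simp]: "c * (k * w) = w" for w by (simp add: ck mult.assoc[symmetric])
  have *: "cis (- 2 * \<theta>) = k * k" "cis (- 2 * - \<theta>) = c * c"
    by (simp_all add: c_def k_def cis_mult)
  show ?thesis
    unfolding matrix_eq_cv Ad_octaut_mv[OF g_res_octaut] transpose_g_res g_res_cv Zgen_def gm_cv cv_eq_iff
      * c_def[symmetric] k_def[symmetric]
    by (simp add: cnj power3_eq_cube algebra_simps)
qed

lemma P34_kA_elem: "P34 (kA_elem x) = F1 x * F2 x * F3 x * F4 x * F5 x * F6 x"
  by (simp add: P34_def)

lemma P34_Ad_g_res:
  assumes "Z \<in> k_A"
  shows "Ad (g_res \<theta>) Z \<in> k_A" "P34 (Ad (g_res \<theta>) Z) = P34 Z"
proof -
  obtain x where x: "Z = kA_elem x" using assms range_kA_elem by blast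
  define c where "c = cis \<theta>"
  have cc: "c * cnj c = 1" and n: "cmod c = 1" by (simp_all add: c_def cis_cnj cis_mult)
  obtain x' where x': "a_c x' = a_c x" "d_c x' = d_c x" "q_c x' = c * q_c x" "p_c x' = c ^ 3 * p_c x"
    by (rule Zgen_coords)
  have Z': "Ad (g_res \<theta>) Z = kA_elem x'"
    by (simp add: x kA_elem_Zgen Ad_g_res_Zgen x' c_def)
  then show "Ad (g_res \<theta>) Z \<in> k_A" using range_kA_elem by blast
  have uv: "u_c x' = u_c x" "v_c x' = v_c x"
    by (simp_all add: u_c_def v_c_def x' norm_mult norm_power n)
  have "p_c x' * cnj (q_c x') ^ 3 = (c * cnj c) ^ 3 * (p_c x * cnj (q_c x) ^ 3)"
    by (simp add: x' power_mult_distrib)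
  then have RI: "R_c x' = R_c x" "I_c x' = I_c x" by (simp_all add: R_c_def I_c_def cc)
  have "complex_of_real (u_c x) * p_c x' - 3 * q_c x' ^ 3 = c ^ 3 * (complex_of_real (u_c x) * p_c x - 3 * q_c x ^ 3)"
    by (simp add: x' power_mult_distrib algebra_simps)
  then have cm: "cmod (complex_of_real (u_c x) * p_c x' - 3 * q_c x' ^ 3) = cmod (complex_of_real (u_c x) * p_c x - 3 * q_c x ^ 3)"
    by (simp add: norm_mult norm_power n)
  have "P34 (Ad (g_res \<theta>) Z) = P34 (kA_elem x')" by (simp only: Z')
  also have "\<dots> = P34 (kA_elem x)"
    unfolding P34_kA_elem F1_def F2_def F3_def F4_def F5_def F6_def rho_c_def delta_c_def Theta_c_def
      uv RI x'(1,2) cm ..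
  finally show "P34 (Ad (g_res \<theta>) Z) = P34 Z" by (simp only: x)
qed

section \<open>Subalgebras containing the diagonal torus\<close>

text \<open>
  The root spaces are the six complex coordinates; on them the bracket with \<open>gm 1 3 0 0 0 0 0 0\<close> has
  the eigenvalues \<open>1, 3, -4, 7, -5, -2\<close> (times \<open>\<i>\<close>), whose squares are distinct.
\<close>

lemma cartan_cases:
  assumes L: "lie_subalgebra L" "L \<subseteq> g2" and T: "\<And>s t. gm s t 0 0 0 0 0 0 \<in> L"
  shows "L = g2
    \<or> (\<forall>X\<in>L. \<exists>s t w1 w2 w3. X = gm s t 0 0 0 w1 w2 w3)
    \<or> (\<forall>X\<in>L. \<exists>s t y w. X = gm s t y 0 0 w 0 0)
    \<or> (\<forall>X\<in>L. \<exists>s t y w. X = gm s t 0 y 0 0 w 0)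
    \<or> (\<forall>X\<in>L. \<exists>s t y w. X = gm s t 0 0 y 0 0 w)"
proof -
  have sub: "subspace L" and br: "\<And>X Y. X \<in> L \<Longrightarrow> Y \<in> L \<Longrightarrow> lie_bracket X Y \<in> L"
    using L by (auto simp: lie_subalgebra_def)
  let ?H = "gm 1 3 0 0 0 0 0 0"
  \<comment> \<open>The square of the bracket with \<open>?H\<close> acts on a root plane as minus
    the squared eigenvalue, so adding \<open>c\<close> kills the plane with squared eigenvalue
    \<open>c\<close>. Five such steps isolate one plane.\<close>
  have step: "gm 0 0 ((c - 1) *\<^sub>R y1) ((c - 9) *\<^sub>R y2) ((c - 16) *\<^sub>R y3)
      ((c - 49) *\<^sub>R w1) ((c - 25) *\<^sub>R w2) ((c - 4) *\<^sub>R w3) \<in> L"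
    if "gm 0 0 y1 y2 y3 w1 w2 w3 \<in> L" for c y1 y2 y3 w1 w2 w3
  proof -
    have "lie_bracket ?H (lie_bracket ?H (gm 0 0 y1 y2 y3 w1 w2 w3)) + c *\<^sub>R gm 0 0 y1 y2 y3 w1 w2 w3 \<in> L"
      by (intro subspace_add[OF sub] subspace_scale[OF sub] br that T)
    also have "lie_bracket ?H (lie_bracket ?H (gm 0 0 y1 y2 y3 w1 w2 w3)) + c *\<^sub>R gm 0 0 y1 y2 y3 w1 w2 w3
        = gm 0 0 ((c - 1) *\<^sub>R y1) ((c - 9) *\<^sub>R y2) ((c - 16) *\<^sub>R y3)
            ((c - 49) *\<^sub>R w1) ((c - 25) *\<^sub>R w2) ((c - 4) *\<^sub>R w3)"
      by (simp add: lie_bracket_gm complex_eq_iff algebra_simps)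
    finally show ?thesis .
  qed
  have off: "gm 0 0 y1 y2 y3 w1 w2 w3 \<in> L" if "gm s t y1 y2 y3 w1 w2 w3 \<in> L" for s t y1 y2 y3 w1 w2 w3
    using subspace_diff[OF sub that T[of s t]] by simp
  have scale: "gm 0 0 y1 y2 y3 w1 w2 w3 \<in> L"
    if "gm 0 0 (c *\<^sub>R y1) (c *\<^sub>R y2) (c *\<^sub>R y3) (c *\<^sub>R w1) (c *\<^sub>R w2) (c *\<^sub>R w3) \<in> L" "c \<noteq> 0" for c y1 y2 y3 w1 w2 w3
    using subspace_scale[OF sub that(1), of "1 / c"] that(2) by simp
  have span: "c = Re (c / z) *\<^sub>R z + Im (c / z) *\<^sub>R (\<i> * z)" if "z \<noteq> 0" for c z :: complex
  proof -
    have "c = (c / z) * z" using that by simp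
    also have "\<dots> = Re (c / z) *\<^sub>R z + Im (c / z) *\<^sub>R (\<i> * z)"
      by (subst complex_eq[of "c / z"]) (simp add: scaleR_conv_of_real algebra_simps)
    finally show ?thesis .
  qed
  \<comment> \<open>A root plane is a complex line, so it lies in \<open>L\<close> once one nonzero
    element and its image under a torus element do.\<close>
  have slot: "f z \<in> L" if "f z0 \<in> L" "f (\<i> * z0) \<in> L" "z0 \<noteq> 0"
    "\<And>z z'. f (z + z') = f z + f z'" "\<And>r z. f (r *\<^sub>R z) = r *\<^sub>R f z" for f z z0
  proof -
    have "f z = Re (z / z0) *\<^sub>R f z0 + Im (z / z0) *\<^sub>R f (\<i> * z0)"
      by (metis span[OF that(3)] that(4,5))
    then show ?thesis using subspace_add[OF sub subspace_scale[OF sub that(1)] subspace_scale[OF sub that(2)]] by simp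
  qed
  have y1: "gm 0 0 z 0 0 0 0 0 \<in> L" if X: "gm s t y1 y2 y3 w1 w2 w3 \<in> L" "y1 \<noteq> 0" for s t y1 y2 y3 w1 w2 w3 z
  proof (rule slot[where f = "\<lambda>z. gm 0 0 z 0 0 0 0 0", OF _ _ X(2)])
    from step[where c = 4, OF step[where c = 25, OF step[where c = 49, OF step[where c = 16, OF step[where c = 9, OF off[OF X(1)]]]]]]
    show 1: "gm 0 0 y1 0 0 0 0 0 \<in> L"
      \<comment> \<open>The factors are \<open>c - 1\<close> for the five values of
        \<open>c\<close>; in the other slots the squared eigenvalue of that slot replaces 1.\<close>
      by - (rule scale[where c = "(8) * (15) * (48) * (24) * (3)"], simp_all)
    have "lie_bracket (gm 1 0 0 0 0 0 0 0) (gm 0 0 y1 0 0 0 0 0) \<in> L" by (intro br 1 T)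
    then show "gm 0 0 (\<i> * y1) 0 0 0 0 0 \<in> L" by (simp add: lie_bracket_gm)
  qed simp_all
  have y2: "gm 0 0 0 z 0 0 0 0 \<in> L" if X: "gm s t y1 y2 y3 w1 w2 w3 \<in> L" "y2 \<noteq> 0" for s t y1 y2 y3 w1 w2 w3 z
  proof (rule slot[where f = "\<lambda>z. gm 0 0 0 z 0 0 0 0", OF _ _ X(2)])
    from step[where c = 4, OF step[where c = 25, OF step[where c = 49, OF step[where c = 16, OF step[where c = 1, OF off[OF X(1)]]]]]]
    show 1: "gm 0 0 0 y2 0 0 0 0 \<in> L"
      by - (rule scale[where c = "(- 8) * (7) * (40) * (16) * (- 5)"], simp_all)
    have "lie_bracket (gm 0 1 0 0 0 0 0 0) (gm 0 0 0 y2 0 0 0 0) \<in> L" by (intro br 1 T)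
    then show "gm 0 0 0 (\<i> * y2) 0 0 0 0 \<in> L" by (simp add: lie_bracket_gm)
  qed simp_all
  have y3: "gm 0 0 0 0 z 0 0 0 \<in> L" if X: "gm s t y1 y2 y3 w1 w2 w3 \<in> L" "y3 \<noteq> 0" for s t y1 y2 y3 w1 w2 w3 z
  proof (rule slot[where f = "\<lambda>z. gm 0 0 0 0 z 0 0 0", OF _ _ X(2)])
    from step[where c = 4, OF step[where c = 25, OF step[where c = 49, OF step[where c = 9, OF step[where c = 1, OF off[OF X(1)]]]]]]
    show 1: "gm 0 0 0 0 y3 0 0 0 \<in> L"
      by - (rule scale[where c = "(- 15) * (- 7) * (33) * (9) * (- 12)"], simp_all)
    have "lie_bracket (gm (- 1) 0 0 0 0 0 0 0) (gm 0 0 0 0 y3 0 0 0) \<in> L" by (intro br 1 T)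
    then show "gm 0 0 0 0 (\<i> * y3) 0 0 0 \<in> L" by (simp add: lie_bracket_gm)
  qed simp_all
  have w1: "gm 0 0 0 0 0 z 0 0 \<in> L" if X: "gm s t y1 y2 y3 w1 w2 w3 \<in> L" "w1 \<noteq> 0" for s t y1 y2 y3 w1 w2 w3 z
  proof (rule slot[where f = "\<lambda>z. gm 0 0 0 0 0 z 0 0", OF _ _ X(2)])
    from step[where c = 4, OF step[where c = 25, OF step[where c = 16, OF step[where c = 9, OF step[where c = 1, OF off[OF X(1)]]]]]]
    show 1: "gm 0 0 0 0 0 w1 0 0 \<in> L"
      by - (rule scale[where c = "(- 48) * (- 40) * (- 33) * (- 24) * (- 45)"], simp_all)
    have "lie_bracket (gm 1 0 0 0 0 0 0 0) (gm 0 0 0 0 0 w1 0 0) \<in> L" by (intro br 1 T)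
    then show "gm 0 0 0 0 0 (\<i> * w1) 0 0 \<in> L" by (simp add: lie_bracket_gm)
  qed simp_all
  have w2: "gm 0 0 0 0 0 0 z 0 \<in> L" if X: "gm s t y1 y2 y3 w1 w2 w3 \<in> L" "w2 \<noteq> 0" for s t y1 y2 y3 w1 w2 w3 z
  proof (rule slot[where f = "\<lambda>z. gm 0 0 0 0 0 0 z 0", OF _ _ X(2)])
    from step[where c = 4, OF step[where c = 49, OF step[where c = 16, OF step[where c = 9, OF step[where c = 1, OF off[OF X(1)]]]]]]
    show 1: "gm 0 0 0 0 0 0 w2 0 \<in> L"
      by - (rule scale[where c = "(- 24) * (- 16) * (- 9) * (24) * (- 21)"], simp_all)
    have "lie_bracket (gm 0 (- 1) 0 0 0 0 0 0) (gm 0 0 0 0 0 0 w2 0) \<in> L" by (intro br 1 T)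
    then show "gm 0 0 0 0 0 0 (\<i> * w2) 0 \<in> L" by (simp add: lie_bracket_gm)
  qed simp_all
  have w3: "gm 0 0 0 0 0 0 0 z \<in> L" if X: "gm s t y1 y2 y3 w1 w2 w3 \<in> L" "w3 \<noteq> 0" for s t y1 y2 y3 w1 w2 w3 z
  proof (rule slot[where f = "\<lambda>z. gm 0 0 0 0 0 0 0 z", OF _ _ X(2)])
    from step[where c = 25, OF step[where c = 49, OF step[where c = 16, OF step[where c = 9, OF step[where c = 1, OF off[OF X(1)]]]]]]
    show 1: "gm 0 0 0 0 0 0 0 w3 \<in> L"
      by - (rule scale[where c = "(- 3) * (5) * (12) * (45) * (21)"], simp_all)
    have "lie_bracket (gm 1 0 0 0 0 0 0 0) (gm 0 0 0 0 0 0 0 w3) \<in> L" by (intro br 1 T)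
    then show "gm 0 0 0 0 0 0 0 (\<i> * w3) \<in> L" by (simp add: lie_bracket_gm)
  qed simp_all
  let ?y1 = "gm 0 0 1 0 0 0 0 0" and ?y2 = "gm 0 0 0 1 0 0 0 0" and ?y3 = "gm 0 0 0 0 1 0 0 0"
    and ?w1 = "gm 0 0 0 0 0 1 0 0" and ?w2 = "gm 0 0 0 0 0 0 1 0" and ?w3 = "gm 0 0 0 0 0 0 0 1"
  \<comment> \<open>The \<open>y\<close> planes are the short roots, the \<open>w\<close> planes the
    long ones. Two short planes produce the third, and a short plane together with a long plane not
    orthogonal to it (different index) produces another short plane.\<close>
  have y1y2: "?y3 \<in> L" if "?y1 \<in> L" "?y2 \<in> L"
    using y3[of _ _ _ _ _ _ _ _ 1] br[OF that] by (simp add: lie_bracket_gm)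
  have y2y3: "?y1 \<in> L" if "?y2 \<in> L" "?y3 \<in> L"
    using y1[of _ _ _ _ _ _ _ _ 1] br[OF that] by (simp add: lie_bracket_gm)
  have y3y1: "?y2 \<in> L" if "?y3 \<in> L" "?y1 \<in> L"
    using y2[of _ _ _ _ _ _ _ _ 1] br[OF that] by (simp add: lie_bracket_gm)
  have w2y1: "?y3 \<in> L" if "?w2 \<in> L" "?y1 \<in> L"
    using y3[of _ _ _ _ _ _ _ _ 1] br[OF that] by (simp add: lie_bracket_gm)
  have w3y1: "?y2 \<in> L" if "?w3 \<in> L" "?y1 \<in> L"
    using y2[of _ _ _ _ _ _ _ _ 1] br[OF that] by (simp add: lie_bracket_gm)
  have w1y2: "?y3 \<in> L" if "?w1 \<in> L" "?y2 \<in> L"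
    using y3[of _ _ _ _ _ _ _ _ 1] br[OF that] by (simp add: lie_bracket_gm)
  have w3y2: "?y1 \<in> L" if "?w3 \<in> L" "?y2 \<in> L"
    using y1[of _ _ _ _ _ _ _ _ 1] br[OF that] by (simp add: lie_bracket_gm)
  have w1y3: "?y2 \<in> L" if "?w1 \<in> L" "?y3 \<in> L"
    using y2[of _ _ _ _ _ _ _ _ 1] br[OF that] by (simp add: lie_bracket_gm)
  have w2y3: "?y1 \<in> L" if "?w2 \<in> L" "?y3 \<in> L"
    using y1[of _ _ _ _ _ _ _ _ 1] br[OF that] by (simp add: lie_bracket_gm)
  have all: "L = g2" if y: "?y1 \<in> L" "?y2 \<in> L" "?y3 \<in> L"
  proof -
    have w3': "?w3 \<in> L" using w3[of _ _ _ _ _ _ _ _ 1] br[OF y(1,2)] by (simp add: lie_bracket_gm)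
    have w1': "?w1 \<in> L" using w1[of _ _ _ _ _ _ _ _ 1] br[OF y(2,3)] by (simp add: lie_bracket_gm)
    have w2': "?w2 \<in> L" using w2[of _ _ _ _ _ _ _ _ 1] br[OF y(3,1)] by (simp add: lie_bracket_gm)
    have "gm s t z1 z2 z3 v1 v2 v3 \<in> L" for s t z1 z2 z3 v1 v2 v3
    proof -
      have "gm s t z1 z2 z3 v1 v2 v3 = gm s t 0 0 0 0 0 0 + gm 0 0 z1 0 0 0 0 0 + gm 0 0 0 z2 0 0 0 0
          + gm 0 0 0 0 z3 0 0 0 + gm 0 0 0 0 0 v1 0 0 + gm 0 0 0 0 0 0 v2 0 + gm 0 0 0 0 0 0 0 v3"
        by simp
      also have "\<dots> \<in> L"
        by (intro subspace_add[OF sub] T y1[OF y(1)] y2[OF y(2)] y3[OF y(3)] w1[OF w1'] w2[OF w2'] w3[OF w3'])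
          simp_all
      finally show ?thesis .
    qed
    then have "g2 \<subseteq> L" by (auto elim!: g2_gmE)
    with L(2) show ?thesis by blast
  qed
  have gm: "\<exists>s t y1 y2 y3 w1 w2 w3. X = gm s t y1 y2 y3 w1 w2 w3" if "X \<in> L" for X
    using that L(2) by (meson g2_gmE subsetD)
  \<comment> \<open>By the short planes in \<open>L\<close>: none leaves a subalgebra of
    \<open>su(3)\<close>, two give all of g2, and exactly one leaves room for only the long plane
    orthogonal to it.\<close>
  consider "?y1 \<notin> L" "?y2 \<notin> L" "?y3 \<notin> L" | "?y1 \<in> L" "?y2 \<in> L" | "?y1 \<in> L" "?y3 \<in> L" | "?y2 \<in> L" "?y3 \<in> L"
    | "?y1 \<in> L" "?y2 \<notin> L" "?y3 \<notin> L" | "?y1 \<notin> L" "?y2 \<in> L" "?y3 \<notin> L" | "?y1 \<notin> L" "?y2 \<notin> L" "?y3 \<in> L"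
    by blast
  then show ?thesis
  proof cases
    case 1
    have "\<exists>s t w1 w2 w3. X = gm s t 0 0 0 w1 w2 w3" if X: "X \<in> L" for X
      using gm[OF X] X y1 y2 y3 1 by metis
    then show ?thesis by blast
  next
    case 2
    then show ?thesis using all y1y2 by blast
  next
    case 3
    then show ?thesis using all y3y1 by blast
  next
    case 4
    then show ?thesis using all y2y3 by blast
  next
    case 5
    then have "?w2 \<notin> L" "?w3 \<notin> L" using w2y1 w3y1 by blast+
    then have "\<exists>s t y w. X = gm s t y 0 0 w 0 0" if X: "X \<in> L" for X
      using gm[OF X] X y2 y3 w2 w3 5 by metis
    then show ?thesis by blast
  next
    case 6
    then have "?w1 \<notin> L" "?w3 \<notin> L" using w1y2 w3y2 by blast+
    then have "\<exists>s t y w. X = gm s t 0 y 0 0 w 0" if X: "X \<in> L" for X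
      using gm[OF X] X y1 y3 w1 w3 6 by metis
    then show ?thesis by blast
  next
    case 7
    then have "?w1 \<notin> L" "?w2 \<notin> L" using w1y3 w2y3 by blast+
    then have "\<exists>s t y w. X = gm s t 0 0 y 0 0 w" if X: "X \<in> L" for X
      using gm[OF X] X y1 y2 w1 w2 7 by metis
    then show ?thesis by blast
  qed
qed

section \<open>Subalgebras of the derivation algebra\<close>

text \<open>The imaginary part of a quaternion subalgebra. The commutator is used because it stays
  imaginary, while the product of two imaginary octonions has a real part.\<close>

definition assoc_space :: "octonion set \<Rightarrow> bool" where
  "assoc_space W \<longleftrightarrow> subspace W \<and> dim W = 3 \<and> W \<subseteq> {v. v $ 0 = 0} \<and> (\<forall>x\<in>W. \<forall>y\<in>W. oct_commutator x y \<in> W)"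

lemma octaut_inner: "g \<in> octaut \<Longrightarrow> (g *v x) \<bullet> (g *v y) = x \<bullet> y"
  by (metis dot_lmul_matrix inner_commute octaut_transpose_mult(3) transpose_matrix_vector transpose_transpose)

lemma octaut_nth_0:
  assumes g: "g \<in> octaut"
  shows "(g *v v) $ 0 = v $ 0"
proof -
  have unit: "x \<star> cv 1 0 0 0 0 = x" "cv 1 0 0 0 0 \<star> x = x" for x
    by (cases x rule: cv_cases, simp add: cv_mult)+
  have "(g *v cv 1 0 0 0 0) \<star> x = x" for x
    using g unit(2)[of "transpose g *v x"] octaut_transpose_mult(4)[OF g]
    by (metis (mono_tags, lifting) mem_Collect_eq octaut_def)
  then have g1: "g *v cv 1 0 0 0 0 = cv 1 0 0 0 0" by (metis unit(1))
  have nth: "x $ 0 = x \<bullet> cv 1 0 0 0 0" for x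
    by (cases x rule: cv_cases) (simp add: inner_cv)
  show ?thesis unfolding nth by (metis g1 octaut_inner[OF g])
qed

lemma octaut_commutator: "g \<in> octaut \<Longrightarrow> g *v oct_commutator x y = oct_commutator (g *v x) (g *v y)"
  by (simp add: octaut_def oct_commutator_def mv_simps)

lemma assoc_space_image:
  assumes g: "g \<in> octaut" and W: "assoc_space W"
  shows "assoc_space ((*v) g ` W)"
proof -
  have inj: "inj ((*v) g)" by (metis injI octaut_transpose_mult(3)[OF g])
  have "dim ((*v) g ` W) = dim W"
    by (rule dim_image_eq[OF matrix_vector_mul_linear]) (use inj in \<open>blast intro: inj_on_subset\<close>)
  then show ?thesis
    using W unfolding assoc_space_def
    by (auto simp: octaut_nth_0[OF g] octaut_commutator[OF g, symmetric] linear_subspace_image matrix_vector_mul_linear)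
qed

lemma assoc_space_coordinate:
  "assoc_space {cv 0 r x 0 0 | r x. True}" (is "assoc_space ?W1")
  "assoc_space {cv 0 r 0 x 0 | r x. True}" (is "assoc_space ?W2")
  "assoc_space {cv 0 r 0 0 x | r x. True}" (is "assoc_space ?W3")
proof -
  have d: "dim {axis 1 1, axis i 1, axis j (1::real) :: octonion} = 3" if "i \<noteq> 1" "j \<noteq> 1" "i \<noteq> j" for i j :: 8
  proof -
    have "independent {axis 1 1, axis i 1, axis j (1::real) :: octonion}"
      by (rule independent_mono[OF independent_Basis]) (auto simp: axis_in_Basis_iff)
    then show ?thesis using that by (simp add: dim_eq_card_independent axis_eq_axis)
  qed
  have main: "assoc_space W" if W: "W = span {oct_e 1, oct_e i, oct_e j}" and "i \<noteq> 1" "j \<noteq> 1" "i \<noteq> j"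
    "W \<subseteq> {v. v $ 0 = 0}" "\<And>x y. x \<in> W \<Longrightarrow> y \<in> W \<Longrightarrow> oct_commutator x y \<in> W" for W i j
    unfolding assoc_space_def using that(5,6) d[OF that(2-4)] by (auto simp: W)
  have "?W1 = span {oct_e 1, oct_e 2, oct_e 3}"
  proof (intro equalityI subsetI)
    fix v assume "v \<in> ?W1"
    then obtain r x where "v = cv 0 r x 0 0" by blast
    then have "v = r *\<^sub>R oct_e 1 + Re x *\<^sub>R oct_e 2 + Im x *\<^sub>R oct_e 3"
      unfolding oct_e_cv by (simp add: complex_eq_iff)
    also have "\<dots> \<in> span {oct_e 1, oct_e 2, oct_e 3}"
      by (intro span_add span_scale span_base) auto
    finally show "v \<in> span {oct_e 1, oct_e 2, oct_e 3}" .
  next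
    fix v assume "v \<in> span {oct_e 1, oct_e 2, oct_e 3}"
    moreover have "span {oct_e 1, oct_e 2, oct_e 3} \<subseteq> ?W1"
      by (rule span_minimal) (auto simp: subspace_def cv_0 oct_e_cv)
    ultimately show "v \<in> ?W1" by blast
  qed
  then show "assoc_space ?W1"
    by (rule main) (auto simp: oct_commutator_def cv_mult)
  have "?W2 = span {oct_e 1, oct_e 4, oct_e 5}"
  proof (intro equalityI subsetI)
    fix v assume "v \<in> ?W2"
    then obtain r x where "v = cv 0 r 0 x 0" by blast
    then have "v = r *\<^sub>R oct_e 1 + Re x *\<^sub>R oct_e 4 + Im x *\<^sub>R oct_e 5"
      unfolding oct_e_cv by (simp add: complex_eq_iff)
    also have "\<dots> \<in> span {oct_e 1, oct_e 4, oct_e 5}"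
      by (intro span_add span_scale span_base) auto
    finally show "v \<in> span {oct_e 1, oct_e 4, oct_e 5}" .
  next
    fix v assume "v \<in> span {oct_e 1, oct_e 4, oct_e 5}"
    moreover have "span {oct_e 1, oct_e 4, oct_e 5} \<subseteq> ?W2"
      by (rule span_minimal) (auto simp: subspace_def cv_0 oct_e_cv)
    ultimately show "v \<in> ?W2" by blast
  qed
  then show "assoc_space ?W2"
    by (rule main) (auto simp: oct_commutator_def cv_mult)
  have "?W3 = span {oct_e 1, oct_e 7, oct_e 6}"
  proof (intro equalityI subsetI)
    fix v assume "v \<in> ?W3"
    then obtain r x where "v = cv 0 r 0 0 x" by blast
    then have "v = r *\<^sub>R oct_e 1 + Re x *\<^sub>R oct_e 7 + Im x *\<^sub>R oct_e 6"
      unfolding oct_e_cv by (simp add: complex_eq_iff)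
    also have "\<dots> \<in> span {oct_e 1, oct_e 7, oct_e 6}"
      by (intro span_add span_scale span_base) auto
    finally show "v \<in> span {oct_e 1, oct_e 7, oct_e 6}" .
  next
    fix v assume "v \<in> span {oct_e 1, oct_e 7, oct_e 6}"
    moreover have "span {oct_e 1, oct_e 7, oct_e 6} \<subseteq> ?W3"
      by (rule span_minimal) (auto simp: subspace_def cv_0 oct_e_cv)
    ultimately show "v \<in> ?W3" by blast
  qed
  then show "assoc_space ?W3"
    by (rule main) (auto simp: oct_commutator_def cv_mult)
qed

text \<open>No eigenvalue of the bracket with \<open>gm 1 3 0 0 0 0 0 0\<close> on a root plane is
  zero, so only the torus commutes with it.\<close>

lemma g2_commute_regular:
  assumes "X \<in> g2" "lie_bracket X (gm 1 3 0 0 0 0 0 0) = 0"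
  obtains s t where "X = gm s t 0 0 0 0 0 0"
proof -
  obtain s t y1 y2 y3 w1 w2 w3 where X: "X = gm s t y1 y2 y3 w1 w2 w3" using assms(1) by (rule g2_gmE)
  then have "X = gm s t 0 0 0 0 0 0"
    using assms(2) by (simp add: lie_bracket_gm complex_eq_iff)
  then show ?thesis by (rule that)
qed

lemma subalgebra_cases:
  assumes L: "lie_subalgebra L" "L \<subseteq> g2"
  obtains "L = g2"
  | n where "n \<noteq> 0" "n $ 0 = 0" "\<And>X. X \<in> L \<Longrightarrow> X *v n = 0"
  | W where "assoc_space W" "\<And>X w. X \<in> L \<Longrightarrow> w \<in> W \<Longrightarrow> X *v w \<in> W"
  | Y U V where "L \<subseteq> span {Y, U, V}"
proof (cases "\<forall>X\<in>L. \<forall>Y\<in>L. lie_bracket X Y = 0 \<longrightarrow> X \<noteq> 0 \<longrightarrow> (\<exists>c. Y = c *\<^sub>R X)")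
  case True
  obtain Y U V where "L \<subseteq> span {Y, U, V}"
    by (rule rank_one[OF L(1)]) (use L(2) transpose_g2 True in auto)
  then show ?thesis by (rule that(4))
next
  note fin = that
  case False
  then obtain Y1 Y2 where Y: "Y1 \<in> L" "Y2 \<in> L" "lie_bracket Y1 Y2 = 0" "Y1 \<noteq> 0"
    and ind: "\<And>c. Y2 \<noteq> c *\<^sub>R Y1" by blast
  let ?H = "gm 1 3 0 0 0 0 0 0"
  have Yg: "Y1 \<in> g2" "Y2 \<in> g2" using Y L(2) by auto
  obtain g1 where g1: "g1 \<in> octaut" "lie_bracket (Ad g1 Y1) ?H = 0"
    using conj_commute[OF Yg(1) gm_in_g2, of "{}"] by blast
  have c: "lie_bracket (Ad g1 Y1) (Ad g1 Y2) = 0"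
    by (metis Ad_lie_bracket[OF g1(1)] Y(3) linear_0[OF linear_Ad])
  \<comment> \<open>The second conjugation fixes the image of \<open>Y1\<close>, so that both
    elements end up commuting with the regular element and hence in the torus.\<close>
  obtain g2' where g2': "g2' \<in> octaut" "Ad g2' (Ad g1 Y1) = Ad g1 Y1" "lie_bracket (Ad g2' (Ad g1 Y2)) ?H = 0"
    using conj_commute[OF Ad_g2[OF g1(1) Yg(2)] gm_in_g2, of "{Ad g1 Y1}"] c g1(2) by blast
  define g where "g = g2' ** g1"
  have g: "g \<in> octaut" using g1 g2' by (simp add: g_def octaut_mult)
  have Adg: "Ad g X = Ad g2' (Ad g1 X)" for X
    by (simp add: Ad_octaut g_def g1 g2' octaut_mult matrix_transpose_mul matrix_mul_assoc)
  obtain s1 t1 where 1: "Ad g Y1 = gm s1 t1 0 0 0 0 0 0"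
    using g2_commute_regular[OF Ad_g2[OF g Yg(1)]] g1 g2' by (metis Adg)
  obtain s2 t2 where 2: "Ad g Y2 = gm s2 t2 0 0 0 0 0 0"
    using g2_commute_regular[OF Ad_g2[OF g Yg(2)]] g2' by (metis Adg)
  define L' where "L' = Ad g ` L"
  have L'sub: "subspace L'"
    unfolding L'_def using L(1) by (intro linear_subspace_image linear_Ad) (simp add: lie_subalgebra_def)
  have L': "lie_subalgebra L'" "L' \<subseteq> g2"
    using L'sub L by (auto simp: lie_subalgebra_def L'_def Ad_g2[OF g] simp flip: Ad_lie_bracket[OF g])
  have inj: "X = X'" if "Ad g X = Ad g X'" for X X'
    using that Ad_octaut_transpose(1)[OF g] by metis
  \<comment> \<open>The torus is two-dimensional; two independent elements of it span it.\<close>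
  have det: "s1 * t2 - s2 * t1 \<noteq> 0"
  proof
    assume d: "s1 * t2 - s2 * t1 = 0"
    have "Ad g Y1 \<noteq> 0" using inj[of Y1 0] Y(4) by (auto simp: linear_0[OF linear_Ad])
    then have "s1 \<noteq> 0 \<or> t1 \<noteq> 0" by (auto simp: 1)
    then have "\<exists>c. s2 = c * s1 \<and> t2 = c * t1"
    proof
      assume "s1 \<noteq> 0" then show ?thesis using d by (intro exI[of _ "s2 / s1"]) (simp add: field_simps)
    next
      assume "t1 \<noteq> 0" then show ?thesis using d by (intro exI[of _ "t2 / t1"]) (simp add: field_simps)
    qed
    then obtain c where "Ad g Y2 = Ad g (c *\<^sub>R Y1)" by (auto simp: 1 2 linear_cmul[OF linear_Ad])
    then show False using inj ind by blast
  qed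
  have T: "gm s t 0 0 0 0 0 0 \<in> L'" for s t
  proof -
    define D where "D = s1 * t2 - s2 * t1"
    have "gm s t 0 0 0 0 0 0 = ((s * t2 - s2 * t) / D) *\<^sub>R Ad g Y1 + ((s1 * t - s * t1) / D) *\<^sub>R Ad g Y2"
    proof -
      have "(s * t2 - s2 * t) * s1 + (s1 * t - s * t1) * s2 = s * D"
        "(s * t2 - s2 * t) * t1 + (s1 * t - s * t1) * t2 = t * D"
        by (simp_all add: D_def algebra_simps)
      moreover have "D \<noteq> 0" using det by (simp add: D_def)
      ultimately show ?thesis by (simp add: 1 2 flip: add_divide_distrib)
    qed
    also have "\<dots> \<in> L'"
      by (intro subspace_add[OF L'sub] subspace_scale[OF L'sub]) (auto simp: L'_def Y)
    finally show ?thesis .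
  qed
  define h where "h = transpose g"
  have h: "h \<in> octaut" by (simp add: h_def octaut_transpose g)
  have conj: "X *v (h *v v) = h *v (Ad g X *v v)" for X v
    by (simp add: Ad_octaut_mv[OF g] h_def octaut_transpose_mult[OF g])
  have assoc: thesis if W: "assoc_space W" "\<And>X w. X \<in> L' \<Longrightarrow> w \<in> W \<Longrightarrow> X *v w \<in> W" for W
  proof (rule fin(3))
    show "assoc_space ((*v) h ` W)" by (rule assoc_space_image[OF h W(1)])
    show "X *v w \<in> (*v) h ` W" if "X \<in> L" "w \<in> (*v) h ` W" for X w
      using that W(2) by (auto simp: conj L'_def)
  qed
  from cartan_cases[OF L' T] consider "L' = g2"
    | "\<forall>X\<in>L'. \<exists>s t w1 w2 w3. X = gm s t 0 0 0 w1 w2 w3"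
    | "\<forall>X\<in>L'. \<exists>s t y w. X = gm s t y 0 0 w 0 0"
    | "\<forall>X\<in>L'. \<exists>s t y w. X = gm s t 0 y 0 0 w 0"
    | "\<forall>X\<in>L'. \<exists>s t y w. X = gm s t 0 0 y 0 0 w" by blast
  then show ?thesis
  proof cases
    case 1
    have "g2 \<subseteq> L"
    proof
      fix X assume "X \<in> g2"
      then have "Ad g X \<in> L'" using 1 Ad_g2[OF g] by blast
      then show "X \<in> L" using inj by (auto simp: L'_def)
    qed
    with L(2) show ?thesis by (intro fin(1)) blast
  next
    case 2
    show ?thesis
    proof (rule fin(2)[of "h *v cv 0 1 0 0 0"])
      show "h *v cv 0 1 0 0 0 \<noteq> 0"
        using octaut_transpose_mult(3)[OF h, of "cv 0 1 0 0 0"] by auto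
      show "(h *v cv 0 1 0 0 0) $ 0 = 0" by (simp add: octaut_nth_0[OF h])
      show "X *v (h *v cv 0 1 0 0 0) = 0" if "X \<in> L" for X
      proof -
        have "Ad g X \<in> L'" using that by (simp add: L'_def)
        then obtain s t w1 w2 w3 where "Ad g X = gm s t 0 0 0 w1 w2 w3" using 2 by blast
        then show ?thesis by (simp add: conj flip: cv_0)
      qed
    qed
  next
    case 3
    show ?thesis by (rule assoc[OF assoc_space_coordinate(1)]) (use 3 in fastforce)
  next
    case 4
    show ?thesis by (rule assoc[OF assoc_space_coordinate(2)]) (use 4 in fastforce)
  next
    case 5
    show ?thesis by (rule assoc[OF assoc_space_coordinate(3)]) (use 5 in fastforce)
  qed
qed

section \<open>The nongenerating conditions\<close>

text \<open>
  The disjuncts are \<open>F1 = 0, ..., F6 = 0\<close>; for \<open>q \<noteq> 0\<close> each of \<open>F2, ..., F6\<close> is a sum of squares, with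
  powers of the positive \<open>rho_c\<close> as weights.
\<close>

definition nongenerating :: "real \<Rightarrow> real \<Rightarrow> complex \<Rightarrow> complex \<Rightarrow> bool" where
  "nongenerating a d q p \<longleftrightarrow> q = 0
    \<or> a = 0 \<and> d\<^sup>2 + (cmod p)\<^sup>2 = (cmod q)\<^sup>2
    \<or> a + d = 0 \<and> (cmod p)\<^sup>2 = (cmod q)\<^sup>2
    \<or> a = 0 \<and> d = 0 \<and> Im (p * cnj q ^ 3) = 0
    \<or> d = 3 * a \<and> complex_of_real ((cmod q)\<^sup>2) * p = 3 * q ^ 3
    \<or> a\<^sup>2 + (cmod q)\<^sup>2 - d\<^sup>2 - (cmod p)\<^sup>2 = 0 \<and> Im (p * cnj q ^ 3) = 0
      \<and> (cmod q)\<^sup>2 * ((2 * (cmod p)\<^sup>2 + 3 * (cmod q)\<^sup>2) * a - 3 * (cmod q)\<^sup>2 * d)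
         - (a + d) * Re (p * cnj q ^ 3) = 0"

lemma P34_eq_0_iff: "P34 (Zgen a d q p) = 0 \<longleftrightarrow> nongenerating a d q p"
  and P34_nonneg: "P34 (Zgen a d q p) \<ge> 0"
proof -
  obtain x where x: "a_c x = a" "d_c x = d" "q_c x = q" "p_c x = p" by (rule Zgen_coords)
  have P: "P34 (Zgen a d q p) = F1 x * F2 x * F3 x * F4 x * F5 x * F6 x"
    using P34_kA_elem[of x] by (simp add: kA_elem_Zgen x)
  note defs = F1_def F2_def F3_def F4_def F5_def F6_def u_c_def v_c_def R_c_def I_c_def delta_c_def Theta_c_def x
  define r where "r = rho_c x"
  have r: "r \<ge> 0" by (simp add: r_def rho_c_def u_c_def v_c_def)
  have r0: "r > 0" if "q \<noteq> 0"
    using that by (simp add: r_def rho_c_def u_c_def v_c_def x add_nonneg_pos add_pos_nonneg)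
  show "P34 (Zgen a d q p) \<ge> 0"
    unfolding P using r by (simp add: defs r_def[symmetric])
  have sum0: "s * t + w\<^sup>2 = 0 \<longleftrightarrow> s = 0 \<and> w = 0" if "s \<ge> 0" "t > 0" for s t w :: real
    using that by (simp add: add_nonneg_eq_0_iff)
  show "P34 (Zgen a d q p) = 0 \<longleftrightarrow> nongenerating a d q p"
  proof (cases "q = 0")
    case True
    then show ?thesis unfolding P by (simp add: F1_def u_c_def x nongenerating_def)
  next
    case False
    note r0 = r0[OF this]
    have 2: "F2 x = 0 \<longleftrightarrow> a = 0 \<and> d\<^sup>2 + (cmod p)\<^sup>2 = (cmod q)\<^sup>2"
      using sum0[of "a\<^sup>2" r] r0 by (simp add: defs r_def[symmetric])
    have 3: "F3 x = 0 \<longleftrightarrow> a + d = 0 \<and> (cmod p)\<^sup>2 = (cmod q)\<^sup>2"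
      using sum0[of "(a + d)\<^sup>2" r] r0 by (simp add: defs r_def[symmetric])
    have 4: "F4 x = 0 \<longleftrightarrow> a = 0 \<and> d = 0 \<and> Im (p * cnj q ^ 3) = 0"
      using sum0[of "a\<^sup>2 + d\<^sup>2" "r ^ 3"] r0 by (simp add: defs r_def[symmetric] sum_power2_eq_zero_iff)
    have 5: "F5 x = 0 \<longleftrightarrow> d = 3 * a \<and> complex_of_real ((cmod q)\<^sup>2) * p = 3 * q ^ 3"
      using sum0[of "(d - 3 * a)\<^sup>2" "r\<^sup>2"] r0 by (simp add: defs r_def[symmetric])
    have 6: "F6 x = 0 \<longleftrightarrow> a\<^sup>2 + (cmod q)\<^sup>2 - d\<^sup>2 - (cmod p)\<^sup>2 = 0 \<and> Im (p * cnj q ^ 3) = 0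
      \<and> (cmod q)\<^sup>2 * ((2 * (cmod p)\<^sup>2 + 3 * (cmod q)\<^sup>2) * a - 3 * (cmod q)\<^sup>2 * d)
         - (a + d) * Re (p * cnj q ^ 3) = 0"
    proof -
      have "F6 x = ((delta_c x)\<^sup>2 * r\<^sup>2 + (I_c x)\<^sup>2) * r + (Theta_c x)\<^sup>2"
        by (simp add: F6_def r_def algebra_simps power2_eq_square power3_eq_cube)
      also have "\<dots> = 0 \<longleftrightarrow> (delta_c x)\<^sup>2 * r\<^sup>2 + (I_c x)\<^sup>2 = 0 \<and> Theta_c x = 0"
        using sum0[of "(delta_c x)\<^sup>2 * r\<^sup>2 + (I_c x)\<^sup>2" r "Theta_c x"] r0 by simp
      also have "(delta_c x)\<^sup>2 * r\<^sup>2 + (I_c x)\<^sup>2 = 0 \<longleftrightarrow> delta_c x = 0 \<and> I_c x = 0"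
        using sum0[of "(delta_c x)\<^sup>2" "r\<^sup>2"] r0 by simp
      finally show ?thesis by (simp add: defs)
    qed
    show ?thesis
      unfolding P mult_eq_0_iff 2 3 4 5 6 nongenerating_def
      using False by (simp add: F1_def u_c_def x)
  qed
qed

section \<open>Common kernels, subalgebras of dimension three, and the real elimination\<close>

lemma mult_cnj_cmod: "q * cnj q = complex_of_real ((cmod q)\<^sup>2)"
  by (rule complex_norm_square[symmetric])

lemma cnj_mult_real:
  assumes "Im (cnj q * w) = 0" "q \<noteq> 0"
  obtains t :: real where "w = of_real t * q"
proof -
  define k where "k = Re (cnj q * w)"
  have "cnj q * w = of_real k" using assms(1) by (simp add: k_def complex_eq_iff)
  then have "of_real ((cmod q)\<^sup>2) * w = of_real k * q"
    by (metis mult.assoc mult.commute mult_cnj_cmod)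
  then have "w = of_real (k / (cmod q)\<^sup>2) * q"
    using assms(2) by (simp add: field_simps)
  then show ?thesis by (rule that)
qed

text \<open>With q nonzero and d = a, the hypothesis on p and q describes the points where
  \<open>frame_m\<close> vanishes; there x = 1, and the sixth condition holds.\<close>

lemma nongenerating_special:
  assumes "q \<noteq> 0" "cnj p * q = (cnj q)\<^sup>2"
  shows "nongenerating a a q p"
proof -
  have "cmod p * cmod q = cmod q * cmod q"
    using arg_cong[OF assms(2), of cmod] by (simp add: norm_mult norm_power power2_eq_square)
  then have n: "cmod p = cmod q" using assms(1) by simp
  have "p * cnj q = q\<^sup>2" using arg_cong[OF assms(2), of cnj] by simp
  then have "p * cnj q ^ 3 = (q * cnj q)\<^sup>2" by (simp add: power3_eq_cube power2_eq_square mult_ac)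
  then have "p * cnj q ^ 3 = of_real (((cmod q)\<^sup>2)\<^sup>2)" by (simp only: mult_cnj_cmod of_real_power)
  then have "Im (p * cnj q ^ 3) = 0" "Re (p * cnj q ^ 3) = ((cmod q)\<^sup>2)\<^sup>2" by simp_all
  then show ?thesis
    unfolding nongenerating_def n by (simp add: power2_eq_square algebra_simps)
qed

lemma oct_S_oct_S [simp]: "oct_S *v (oct_S *v v) = v"
  by (cases v rule: cv_cases) simp

lemma Ad_oct_S_mv: "Ad oct_S X *v v = oct_S *v (X *v (oct_S *v v))"
  by (simp add: Ad_mv matrix_inv_oct_S)

text \<open>The common kernel is S-stable, since S interchanges the two maps. If
  \<open>n + oct_S *v n\<close> is nonzero it is an S-fixed kernel vector, which leads to
  \<open>F6\<close>. Otherwise \<open>n\<close> is negated by S, and its coordinate \<open>x\<close>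
  decides between \<open>F3\<close> (x = 0) and \<open>F2\<close>.\<close>

lemma common_kernel:
  assumes n: "n \<noteq> 0" "n $ 0 = 0" and Z: "Zgen a d q p *v n = 0" "Ad oct_S (Zgen a d q p) *v n = 0"
  shows "nongenerating a d q p"
proof (cases "q = 0")
  case True
  then show ?thesis by (simp add: nongenerating_def)
next
  case q: False
  let ?Z = "Zgen a d q p"
  have ZS: "?Z *v (oct_S *v n) = 0"
    using Z(2) oct_S_oct_S[of "?Z *v (oct_S *v n)"] by (simp add: Ad_oct_S_mv)
  obtain r x y z where nx: "n = cv 0 r x y z" using n(2) by (cases n rule: cv_cases) auto
  show ?thesis
  proof (cases "n + oct_S *v n = 0")
    case False
    define w where "w = x + y"
    have nz: "cv 0 (2 * r) w w 0 \<noteq> 0" using False by (simp add: nx w_def add.commute)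
    have "?Z *v (n + oct_S *v n) = 0" using Z ZS by (simp add: mv_simps)
    then have "?Z *v cv 0 (2 * r) w w 0 = 0" by (simp add: nx w_def add.commute)
    then have 1: "Im (cnj q * w) = 0" "2 * r * q = a * w" "(d - a) * w = 0" "cnj p * w = cnj q * cnj w"
      by (auto simp: Zgen_def algebra_simps complex_eq_iff)
    have "w \<noteq> 0" using nz 1(2) q by auto
    then have "d = a" using 1(3) by auto
    obtain t where t: "w = of_real t * q" using cnj_mult_real[OF 1(1) q] .
    then have "cnj p * q = (cnj q)\<^sup>2" using 1(4) \<open>w \<noteq> 0\<close> by (auto simp: power2_eq_square)
    then show ?thesis using nongenerating_special[OF q] \<open>d = a\<close> by blast
  next
    case True
    then have n': "n = cv 0 0 x (- x) z" and r: "r = 0"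
      by (auto simp: nx eq_neg_iff_add_eq_0 add.commute)
    have 1: "Im (cnj q * x) = 0" "a * x = 0" "p * z + cnj q * cnj z = (d - a) * x"
      "(a + d) * z = cnj q * cnj x - cnj p * x"
      using Z(1) unfolding n' by (auto simp: Zgen_def algebra_simps complex_eq_iff)
    show ?thesis
    proof (cases "x = 0")
      case True
      then have z: "z \<noteq> 0" using n(1) n' by auto
      have "complex_of_real (a + d) * z = 0" using 1(4) True by simp
      then have "a + d = 0" using z by (metis mult_eq_0_iff of_real_eq_0_iff)
      moreover have "p * z = - (cnj q * cnj z)" using 1(3) True by (simp add: eq_neg_iff_add_eq_0)
      then have "cmod p * cmod z = cmod q * cmod z"
        by (metis norm_minus_cancel norm_mult complex_mod_cnj)
      then have "cmod p = cmod q" using z by simp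
      ultimately show ?thesis by (simp add: nongenerating_def)
    next
      case False
      then have a: "a = 0" using 1(2) by auto
      obtain t where t: "x = of_real t * q" using cnj_mult_real[OF 1(1) q] .
      have t0: "t \<noteq> 0" using False t by auto
      have dz: "d * z = t * ((cnj q)\<^sup>2 - cnj p * q)"
        using 1(4) by (simp add: a t power2_eq_square algebra_simps)
      have dz': "d * cnj z = t * (q\<^sup>2 - p * cnj q)"
        using arg_cong[OF dz, of cnj] by simp
      have "d * (t * q) = p * z + cnj q * cnj z" using 1(3) by (simp add: a t)
      \<comment> \<open>Multiplying once more by \<open>d\<close> allows z to be replaced through
        \<open>dz\<close> and its conjugate.\<close>
      then have "d * (d * (t * q)) = d * (p * z + cnj q * cnj z)" by simp
      also have "\<dots> = p * (d * z) + cnj q * (d * cnj z)" by (simp add: algebra_simps)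
      also have "\<dots> = of_real t * q * (q * cnj q - p * cnj p)"
        unfolding dz dz' by (simp add: power2_eq_square algebra_simps)
      finally have "of_real t * q * (of_real (d\<^sup>2) - (q * cnj q - p * cnj p)) = 0"
        by (simp add: power2_eq_square algebra_simps)
      then have "complex_of_real (d\<^sup>2) = of_real ((cmod q)\<^sup>2) - of_real ((cmod p)\<^sup>2)"
        using t0 q by (simp add: mult_cnj_cmod)
      then have "d\<^sup>2 = (cmod q)\<^sup>2 - (cmod p)\<^sup>2" by (metis of_real_diff of_real_eq_iff)
      then show ?thesis using a by (simp add: nongenerating_def)
    qed
  qed
qed

text \<open>The hypothesis holds if \<open>Z\<close> and \<open>SZS\<close> lie in a common three-dimensional subalgebra.\<close>

lemma double_bracket:
  assumes "lie_bracket (Zgen a d q p) (lie_bracket (Zgen a d q p) (Ad oct_S (Zgen a d q p)))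
    = \<alpha> *\<^sub>R Ad oct_S (Zgen a d q p) + \<kappa> *\<^sub>R Zgen a d q p"
  shows "nongenerating a d q p"
proof (cases "q = 0")
  case True
  then show ?thesis by (simp add: nongenerating_def)
next
  case q: False
  note eq = assms[unfolded Zgen_def Ad_oct_S_gm lie_bracket_gm gm_linear gm_eq_iff]
  \<comment> \<open>The slots \<open>y1\<close>, \<open>w1\<close> and \<open>w2\<close> of the
    equation are used in this order; the first determines \<kappa>.\<close>
  have k: "\<kappa> = 2 * a * (d - a)"
  proof -
    have "complex_of_real (\<kappa> - 2 * a * (d - a)) * q = 0"
      using eq by (simp add: complex_eq_iff algebra_simps)
    then have "\<kappa> - 2 * a * (d - a) = 0" using q by (metis mult_eq_0_iff of_real_eq_0_iff)
    then show ?thesis by simp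
  qed
  have w1: "a + d = 0 \<or> p = 0"
  proof -
    have "complex_of_real (2 * d * (3 * a + d) - \<kappa>) * p = 0"
      using eq by (simp add: complex_eq_iff algebra_simps)
    moreover have "2 * d * (3 * a + d) - \<kappa> = 2 * (a + d)\<^sup>2"
      by (simp add: k power2_eq_square algebra_simps)
    ultimately show ?thesis
      by (metis mult_eq_0_iff of_real_eq_0_iff power2_eq_square zero_neq_numeral)
  qed
  have w2: "of_real ((3 * a + d)\<^sup>2 + (cmod p)\<^sup>2 + 9 * (cmod q)\<^sup>2 + \<alpha>) * cnj p + 6 * cnj q ^ 3 = 0"
    using eq unfolding cmod_power2
    by (simp add: complex_eq_iff power2_eq_square power3_eq_cube algebra_simps)
  have p: "p \<noteq> 0" using w2 q by auto
  with w1 have ad: "d = - a" by (simp add: eq_neg_iff_add_eq_0 add.commute)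
  \<comment> \<open>The sum of the two diagonal entries: on the right it is
    \<open>(\<alpha> + \<kappa>) * (a + d)\<close>, which is zero here.\<close>
  have s: "a * ((cmod p)\<^sup>2 - (cmod q)\<^sup>2) = 0"
    using eq unfolding cmod_power2 by (simp add: ad power2_eq_square algebra_simps)
  have "Im (p * cnj q ^ 3) = 0"
  proof -
    have "6 * (p * cnj q ^ 3) = - of_real ((3 * a + d)\<^sup>2 + (cmod p)\<^sup>2 + 9 * (cmod q)\<^sup>2 + \<alpha>) * (p * cnj p)"
      using arg_cong[OF w2, of "\<lambda>w. p * w"] by (simp add: algebra_simps eq_neg_iff_add_eq_0)
    then have "6 * (p * cnj q ^ 3) = of_real (- ((3 * a + d)\<^sup>2 + (cmod p)\<^sup>2 + 9 * (cmod q)\<^sup>2 + \<alpha>) * (cmod p)\<^sup>2)"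
      unfolding mult_cnj_cmod by simp
    from arg_cong[OF this, of Im] show ?thesis by simp
  qed
  with s ad show ?thesis by (auto simp: nongenerating_def)
qed

lemma orthogonal_triple_span:
  fixes V :: "'a::euclidean_space set"
  assumes "dim V \<le> 3" "x \<in> V" "y \<in> V" "z \<in> V" "x \<noteq> 0" "y \<noteq> 0" "z \<noteq> 0"
    and "x \<bullet> y = 0" "x \<bullet> z = 0" "y \<bullet> z = 0" and w: "w \<in> V"
  obtains a b c where "w = a *\<^sub>R x + b *\<^sub>R y + c *\<^sub>R z"
proof -
  have ne: "x \<noteq> y" "x \<noteq> z" "y \<noteq> z" using assms by auto
  have "independent {x, y, z}"
    by (rule pairwise_orthogonal_independent)
       (use assms in \<open>auto simp: pairwise_def orthogonal_def inner_commute\<close>)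
  moreover have "card {x, y, z} = 3" using ne by simp
  ultimately have "V \<subseteq> span {x, y, z}"
    using assms by (intro card_ge_dim_independent) auto
  with w have "w \<in> span {x, y, z}" by blast
  then obtain a b c where "w - a *\<^sub>R x - b *\<^sub>R y = c *\<^sub>R z"
    by (auto simp: span_insert)
  then show ?thesis by (intro that[of a b c]) (simp add: algebra_simps)
qed

text \<open>When \<open>T\<close> is nonzero, \<open>X\<close>, the part \<open>X''\<close> of
  \<open>X'\<close> orthogonal to it, and \<open>T\<close> form an orthogonal basis of
  \<open>L\<close>. Skewness of the bracket with \<open>X\<close> removes the \<open>T\<close>
  component from \<open>\<langle>X, T\<rangle>\<close>.\<close>

lemma double_bracket_rank_one:
  assumes L: "lie_subalgebra L" "L \<subseteq> g2" "L \<subseteq> span {Y, U, V}" and X: "X \<in> L" "X' \<in> L"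
  obtains \<alpha> \<kappa> where "lie_bracket X (lie_bracket X X') = \<alpha> *\<^sub>R X' + \<kappa> *\<^sub>R X"
proof -
  define T where "T = lie_bracket X X'"
  have sub: "subspace L" and br: "\<And>X Y. X \<in> L \<Longrightarrow> Y \<in> L \<Longrightarrow> lie_bracket X Y \<in> L"
    using L by (auto simp: lie_subalgebra_def)
  have inv: "lie_bracket B A \<bullet> C = - (A \<bullet> lie_bracket B C)" if "B \<in> L" for A B C
    using that L(2) transpose_g2 inner_lie_bracket by blast
  show ?thesis
  proof (cases "T = 0")
    case True
    then show ?thesis by (intro that[of 0 0]) (simp add: T_def lie_bracket_simps)
  next
    case False
    then have X0: "X \<noteq> 0" by (auto simp: T_def lie_bracket_simps)
    define X'' where "X'' = X' - ((X' \<bullet> X) / (X \<bullet> X)) *\<^sub>R X"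
    have T: "T = lie_bracket X X''" by (simp add: T_def X''_def lie_bracket_simps)
    then have X''0: "X'' \<noteq> 0" using False by (auto simp: lie_bracket_simps)
    have X''L: "X'' \<in> L" by (simp add: X''_def subspace_diff[OF sub] subspace_scale[OF sub] X)
    have "dim L \<le> card {Y, U, V}" by (rule dim_le_card[OF L(3)]) simp
    also have "\<dots> \<le> 3" by (simp add: card_insert_le_m1)
    finally have "dim L \<le> 3" .
    moreover have "X \<bullet> X'' = 0" using X0 by (simp add: X''_def inner_diff_right inner_commute)
    moreover have "X \<bullet> T = 0" using inv[OF X(1), of X'' X] by (simp add: T inner_commute)
    moreover have "X'' \<bullet> T = 0" using inv[OF X(1), of X'' X''] by (simp add: T inner_commute)
    ultimately obtain a b c where abc: "lie_bracket X T = a *\<^sub>R X + b *\<^sub>R X'' + c *\<^sub>R T"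
      using orthogonal_triple_span[of L X X'' T "lie_bracket X T"] X X''L X0 X''0 False br[OF X(1) br[OF X(1) X''L]]
        br[OF X(1) X''L] by (metis T)
    have "lie_bracket X T \<bullet> T = 0" using inv[OF X(1), of T T] by (simp add: inner_commute)
    then have "c * (T \<bullet> T) = 0"
      unfolding abc using \<open>X \<bullet> T = 0\<close> \<open>X'' \<bullet> T = 0\<close> by (simp add: inner_add_left)
    then have "c = 0" using False by simp
    then have "lie_bracket X T = b *\<^sub>R X' + (a - b * ((X' \<bullet> X) / (X \<bullet> X))) *\<^sub>R X"
      by (simp add: abc X''_def algebra_simps)
    then show ?thesis unfolding T_def by (rule that)
  qed
qed

text \<open>The hypotheses are, up to linear combination, the coordinates of
  \<open>Z frame_m = l frame_n + (m/2) frame_k\<close> when \<open>|q|^2 p = x q^3\<close>.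
  \<open>E1\<close> eliminates \<open>l\<close>, \<open>E2\<close> eliminates
  \<open>m\<close>.\<close>

lemma real_elimination:
  fixes a d u x l m :: real
  assumes u: "u > 0" and 1: "2 * (a - d) * u = l * (a + d)"
    and 2: "4 * l = - (a - d) * (3 * a - d) - u * (1 - x)\<^sup>2"
    and 3: "d\<^sup>2 - a\<^sup>2 + u * (1 - x)\<^sup>2 = 2 * m * (- (a + d) * (a - d) + 2 * u * (x - 1))"
    and 4: "2 * a * x - 2 * d = m * (- (a + d) * x - 3 * a + 5 * d)"
  shows "a = 0 \<and> d = 0 \<or> d = 3 * a \<and> x = 3
    \<or> a\<^sup>2 + u = d\<^sup>2 + x\<^sup>2 * u \<and> (2 * x\<^sup>2 - x + 3) * a = (x + 3) * d"
proof -
  have E1: "8 * (a - d) * u + (a + d) * (a - d) * (3 * a - d) + (a + d) * u * (1 - x)\<^sup>2 = 0"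
  proof -
    have "4 * (2 * (a - d) * u) = 4 * l * (a + d)" by (simp only: 1)
    then show ?thesis unfolding 2 by (simp add: algebra_simps)
  qed
  have E2: "(d\<^sup>2 - a\<^sup>2 + u * (1 - x)\<^sup>2) * (- (a + d) * x - 3 * a + 5 * d)
      = 2 * (2 * a * x - 2 * d) * (- (a + d) * (a - d) + 2 * u * (x - 1))"
    unfolding 3 4 by (simp add: algebra_simps)
  have special: ?thesis if "a = d" "x = 1" using that by simp
  \<comment> \<open>Both \<open>E1\<close> and \<open>E2\<close> are linear in u. Eliminating u
    leaves a product of four factors, each linear in a and d, which are treated separately.\<close>
  have "(a - d) * (a + d) * (((x + 3) * d - (2 * x\<^sup>2 - x + 3) * a) * ((x - 5) * d + (x + 3) * a)) = 0"
  proof -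
    define K where "K = 8 * (a - d) + (a + d) * (x - 1)\<^sup>2"
    define N where "N = 9 * d - 3 * a - (5 * a + d) * x"
    define Q where "Q = - (a + d) * x\<^sup>2 + (6 * d - 10 * a) * x + 3 * (a + d)"
    have uK: "u * K = - ((a - d) * (a + d) * (3 * a - d))"
      using E1 by (simp add: K_def power2_eq_square algebra_simps)
    have "(d - a) * (d + a) * N + u * ((x - 1) * Q) = 0"
      using E2 by (simp add: N_def Q_def power2_eq_square algebra_simps)
    then have "K * ((d - a) * (d + a) * N) + (u * K) * ((x - 1) * Q) = 0"
      by (metis (no_types, opaque_lifting) distrib_left mult.assoc mult.commute mult_zero_right)
    then have "(a - d) * (a + d) * (K * N + (3 * a - d) * ((x - 1) * Q)) = 0"
      unfolding uK by (simp add: algebra_simps)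
    moreover have "K * N + (3 * a - d) * ((x - 1) * Q)
        = 4 * (((x + 3) * d - (2 * x\<^sup>2 - x + 3) * a) * ((x - 5) * d + (x + 3) * a))"
      by (simp add: K_def N_def Q_def power2_eq_square algebra_simps)
    ultimately show ?thesis by simp
  qed
  then consider "a = d" | "d = - a" | "(x + 3) * d = (2 * x\<^sup>2 - x + 3) * a" | "(x - 5) * d + (x + 3) * a = 0"
    by force
  then show ?thesis
  proof cases
    case 1
    then have "2 * a * u * (1 - x)\<^sup>2 = 0" using E1 by simp
    then show ?thesis using 1 u by auto
  next
    case 2
    then show ?thesis using E1 u by simp
  next
    case 3
    show ?thesis
    proof (cases "x = - 3")
      case True
      then have a: "a = 0" using 3 by simp
      then have "d * (8 * u + d\<^sup>2) = 0" using E1 True by (simp add: power2_eq_square algebra_simps)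
      moreover have "8 * u + d\<^sup>2 > 0" using u by (simp add: add_pos_nonneg)
      ultimately show ?thesis using a by simp
    next
      case False
      define k where "k = a / (x + 3)"
      have a: "a = (x + 3) * k" using False by (simp add: k_def)
      have "(x + 3) * d = (x + 3) * ((2 * x\<^sup>2 - x + 3) * k)" using 3 by (simp add: a)
      then have d: "d = (2 * x\<^sup>2 - x + 3) * k" using False by simp
      have "2 * (1 - x) * (3 - x) * (1 + x) * k * (u * (1 + x) + 4 * x * (x\<^sup>2 + 3) * k\<^sup>2) = 0"
        using E1 by (simp add: a d power2_eq_square algebra_simps)
      then consider "x = 1" | "x = 3" | "x = - 1" | "k = 0" | "u * (1 + x) + 4 * x * (x\<^sup>2 + 3) * k\<^sup>2 = 0"
        by force
      then show ?thesis
      proof cases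
        \<comment> \<open>At x = -1 the factorised form of \<open>E1\<close> says nothing about
          \<open>k\<close>, so \<open>E2\<close> is used.\<close>
        case 3
        then have "k * k\<^sup>2 = 0" using E2 by (simp add: a d power2_eq_square algebra_simps)
        then show ?thesis by (simp add: a d)
      next
        case 5
        have "a\<^sup>2 - d\<^sup>2 + (1 - x\<^sup>2) * u = (1 - x) * (u * (1 + x) + 4 * x * (x\<^sup>2 + 3) * k\<^sup>2)"
          by (simp add: a d power2_eq_square algebra_simps)
        also have "\<dots> = 0" by (simp only: 5 mult_zero_right)
        finally have "a\<^sup>2 + u = d\<^sup>2 + x\<^sup>2 * u" by (simp add: algebra_simps)
        then show ?thesis by (simp add: a d)
      qed (simp_all add: a d)
    qed
  next
    case 4
    obtain k where a: "a = (5 - x) * k" and d: "d = (x + 3) * k"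
    proof (cases "x = 5")
      case True
      then show ?thesis using 4 by (intro that[of "d / 8"]) simp_all
    next
      case False
      have "(5 - x) * d = (x + 3) * a" using 4 by (simp add: algebra_simps)
      then show ?thesis using False by (intro that[of "a / (5 - x)"]) (simp_all add: field_simps)
    qed
    have "8 * (1 - x) * (3 - x) * k * (u + 8 * k\<^sup>2) = 0"
      using E1 by (simp add: a d power2_eq_square algebra_simps)
    moreover have "u + 8 * k\<^sup>2 > 0" using u by (simp add: add_pos_nonneg)
    ultimately consider "x = 1" | "x = 3" | "k = 0" by force
    then show ?thesis by cases (simp_all add: a d)
  qed
qed

section \<open>Invariant associative planes\<close>

lemma oct_S_octaut: "oct_S \<in> octaut"
proof -
  have "norm (oct_S *v v) = norm v" for v
    by (cases v rule: cv_cases) (simp add: norm_eq inner_cv)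
  then have "orthogonal_matrix oct_S"
    using orthogonal_transformation_matrix[of "(*v) oct_S"]
    by (simp add: matrix_of_matrix_vector_mul orthogonal_transformation)
  moreover have "oct_S *v (x \<star> y) = (oct_S *v x) \<star> (oct_S *v y)" for x y
    by (cases x rule: cv_cases; cases y rule: cv_cases) (simp add: cv_mult algebra_simps)
  ultimately show ?thesis by (simp add: octaut_def)
qed

lemma oct_mult_left_twice: "x $ 0 = 0 \<Longrightarrow> x \<star> (x \<star> y) = - ((x \<bullet> x) *\<^sub>R y)"
  by (cases x rule: cv_cases; cases y rule: cv_cases)
     (simp add: cv_mult inner_cv inner_complex_def complex_eq_iff algebra_simps)

lemma oct_mult_anticommute: "x $ 0 = 0 \<Longrightarrow> y $ 0 = 0 \<Longrightarrow> x \<bullet> y = 0 \<Longrightarrow> y \<star> x = - (x \<star> y)"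
  by (cases x rule: cv_cases; cases y rule: cv_cases)
     (simp add: cv_mult inner_cv inner_complex_def complex_eq_iff algebra_simps)

lemma commutator_nonzero:
  assumes "x $ 0 = 0" "y $ 0 = 0" "x \<bullet> y = 0" "x \<noteq> 0" "y \<noteq> 0"
  shows "oct_commutator x y \<noteq> 0"
proof
  assume "oct_commutator x y = 0"
  then have "2 *\<^sub>R (x \<star> y) = 0"
    using oct_mult_anticommute[OF assms(1-3)] by (simp add: oct_commutator_def scaleR_2)
  then have "x \<star> (x \<star> y) = 0" by (simp add: oct_mult.zero_right)
  then show False using oct_mult_left_twice[OF assms(1), of y] assms(4,5) by simp
qed

lemma commutator_orthogonal:
  "x $ 0 = 0 \<Longrightarrow> y $ 0 = 0 \<Longrightarrow> x \<bullet> oct_commutator x y = 0"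
  "x $ 0 = 0 \<Longrightarrow> y $ 0 = 0 \<Longrightarrow> y \<bullet> oct_commutator x y = 0"
  by (cases x rule: cv_cases; cases y rule: cv_cases;
      simp add: oct_commutator_def cv_mult inner_cv inner_complex_def algebra_simps)+

text \<open>An associative plane is determined by any two orthogonal nonzero vectors in it: their
  commutator is nonzero and orthogonal to both.\<close>

lemma assoc_space_span:
  assumes W: "assoc_space W" and x: "x \<in> W" "x \<noteq> 0" and y: "y \<in> W" "y \<noteq> 0" and xy: "x \<bullet> y = 0" and w: "w \<in> W"
  obtains a b c where "w = a *\<^sub>R x + b *\<^sub>R y + c *\<^sub>R oct_commutator x y"
proof (rule orthogonal_triple_span[of W x y "oct_commutator x y" w])
  have im: "x $ 0 = 0" "y $ 0 = 0" using W x y by (auto simp: assoc_space_def)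
  show "oct_commutator x y \<noteq> 0" using commutator_nonzero[OF im xy x(2) y(2)] .
  show "x \<bullet> oct_commutator x y = 0" "y \<bullet> oct_commutator x y = 0"
    using commutator_orthogonal[OF im] by auto
  show "dim W \<le> 3" "oct_commutator x y \<in> W" using W x y by (auto simp: assoc_space_def)
qed (use assms in auto)

lemma g2_skew: "X \<in> g2 \<Longrightarrow> (X *v x) \<bullet> y = - (x \<bullet> (X *v y))"
  by (rule skew_inner[OF transpose_g2])

lemma g2_skew_self: "X \<in> g2 \<Longrightarrow> x \<bullet> (X *v x) = 0"
  using g2_skew[of X x x] by (simp add: inner_commute)

lemma g2_nth_0: "X \<in> g2 \<Longrightarrow> (X *v v) $ 0 = 0"
  by (cases v rule: cv_cases) (auto elim!: g2_gmE)

text \<open>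
  If the two 3-planes meet only in \<open>0\<close>, the vector orthogonal to both is killed; if they meet in a
  line, that line is.
\<close>

lemma assoc_space_unique:
  assumes W: "assoc_space W" "assoc_space W'" and A: "A \<subseteq> g2"
    and inv: "\<And>X w. X \<in> A \<Longrightarrow> w \<in> W \<Longrightarrow> X *v w \<in> W" "\<And>X w. X \<in> A \<Longrightarrow> w \<in> W' \<Longrightarrow> X *v w \<in> W'"
    and ne: "W \<noteq> W'"
  obtains n where "n \<noteq> 0" "n $ 0 = 0" "\<And>X. X \<in> A \<Longrightarrow> X *v n = 0"
proof (cases "\<exists>x\<in>W \<inter> W'. x \<noteq> 0")
  case True
  then obtain x where x: "x \<in> W" "x \<in> W'" "x \<noteq> 0" by blast
  have "X *v x = 0" if X: "X \<in> A" for X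
  proof (rule ccontr)
    assume nz: "X *v x \<noteq> 0"
    have mem: "X *v x \<in> W" "X *v x \<in> W'" using inv X x by auto
    have o: "x \<bullet> (X *v x) = 0" using X A g2_skew_self by blast
    have sub: "subspace W" "subspace W'" "oct_commutator x (X *v x) \<in> W" "oct_commutator x (X *v x) \<in> W'"
      using W x mem by (auto simp: assoc_space_def)
    have "w \<in> W'" if "w \<in> W" for w
      by (rule assoc_space_span[OF W(1) x(1,3) mem(1) nz o that])
        (auto intro!: subspace_add[OF sub(2)] subspace_scale[OF sub(2)] x mem sub)
    moreover have "w \<in> W" if "w \<in> W'" for w
      by (rule assoc_space_span[OF W(2) x(2,3) mem(2) nz o that])
        (auto intro!: subspace_add[OF sub(1)] subspace_scale[OF sub(1)] x mem sub)
    ultimately show False using ne by blast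
  qed
  moreover have "x $ 0 = 0" using W x by (auto simp: assoc_space_def)
  ultimately show ?thesis using that[of x] x by blast
next
  case False
  have sub: "subspace W" "subspace W'" and im: "\<And>w. w \<in> W \<Longrightarrow> w $ 0 = 0" "\<And>w. w \<in> W' \<Longrightarrow> w $ 0 = 0"
    and d: "dim W = 3" "dim W' = 3"
    using W by (auto simp: assoc_space_def)
  define U where "U = {x + y | x y. x \<in> W \<and> y \<in> W'}"
  have U: "subspace U" unfolding U_def by (rule subspace_sums[OF sub])
  have "W \<inter> W' = {0}" using False sub by (auto simp: subspace_0)
  then have dU: "dim U = 6" using dim_sums_Int[OF sub] d by (simp add: U_def)
  \<comment> \<open>The unit is added so that the orthogonal complement \<open>C\<close> consists of
    imaginary vectors; dimension 6 + 1 leaves it one-dimensional.\<close>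
  define E where "E = span (insert (cv 1 0 0 0 0) U)"
  have "cv 1 0 0 0 0 \<notin> span U"
  proof
    assume "cv 1 0 0 0 0 \<in> span U"
    then have "cv 1 0 0 0 0 \<in> U" using U by (simp add: span_eq_iff[THEN iffD2])
    then obtain x y where xy: "cv 1 0 0 0 0 = x + y" "x \<in> W" "y \<in> W'" by (auto simp: U_def)
    from arg_cong[OF xy(1), of "\<lambda>v. v $ 0"] show False using im xy(2,3) by simp
  qed
  then have "dim E = 7" using dU by (simp add: E_def dim_insert)
  define C where "C = {y :: octonion. \<forall>x\<in>E. orthogonal x y}"
  have "dim C + dim E = dim (UNIV :: octonion set)"
    using dim_subspace_orthogonal_to_vectors[of E UNIV] by (simp add: C_def E_def)
  then have dC: "dim C = 1" using \<open>dim E = 7\<close> by simp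
  then obtain n where n: "n \<in> C" "n \<noteq> 0"
    by (metis dim_eq_0 insertI1 one_neq_zero subsetI singletonI)
  have Csub: "x \<in> C \<longleftrightarrow> x $ 0 = 0 \<and> (\<forall>w\<in>W. w \<bullet> x = 0) \<and> (\<forall>w\<in>W'. w \<bullet> x = 0)" for x
  proof -
    have "x \<in> C \<longleftrightarrow> (\<forall>y\<in>insert (cv 1 0 0 0 0) U. orthogonal x y)"
      unfolding C_def E_def by (auto simp: orthogonal_commute[of _ x] intro: span_base orthogonal_to_span)
    also have "\<dots> \<longleftrightarrow> x $ 0 = 0 \<and> (\<forall>y\<in>U. y \<bullet> x = 0)"
      by (cases x rule: cv_cases) (auto simp: orthogonal_def inner_cv inner_commute)
    also have "(\<forall>y\<in>U. y \<bullet> x = 0) \<longleftrightarrow> (\<forall>w\<in>W. w \<bullet> x = 0) \<and> (\<forall>w\<in>W'. w \<bullet> x = 0)"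
    proof safe
      assume *: "\<forall>y\<in>U. y \<bullet> x = 0"
      show "w \<bullet> x = 0" if "w \<in> W" for w
        using * that subspace_0[OF sub(2)] by (force simp: U_def)
      show "w \<bullet> x = 0" if "w \<in> W'" for w
        using * that subspace_0[OF sub(1)] by (force simp: U_def)
    qed (auto simp: U_def inner_add_left)
    finally show ?thesis by simp
  qed
  \<comment> \<open>\<open>C\<close> is an invariant line, and a skew map acts on an invariant line
    as zero.\<close>
  have "X *v n = 0" if X: "X \<in> A" for X
  proof (rule ccontr)
    assume nz: "X *v n \<noteq> 0"
    have Xg: "X \<in> g2" using X A by blast
    have "X *v n \<in> C"
      using n(1) inv[OF X] g2_skew[OF Xg] g2_nth_0[OF Xg] by (simp add: Csub) (metis inner_commute neg_equal_0_iff_equal)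
    moreover have "independent {n, X *v n}"
      by (rule pairwise_orthogonal_independent)
         (use n nz g2_skew_self[OF Xg, of n] in \<open>auto simp: pairwise_def orthogonal_def inner_commute\<close>)
    moreover have "n \<noteq> X *v n" using g2_skew_self[OF Xg, of n] n(2) by auto
    ultimately have "2 \<le> dim C"
      using independent_card_le_dim[of "{n, X *v n}" C] n(1) by simp
    then show False using dC by simp
  qed
  then show ?thesis using that[of n] n by (auto simp: Csub)
qed

text \<open>
  \<open>frame_n\<close> is, up to scaling, the only \<open>S\<close>-fixed imaginary vector that \<open>Z + SZS\<close> kills, so an
  \<open>S\<close>-stable invariant associative 3-plane contains it, hence also \<open>frame_m\<close>, which is half its
  image under \<open>Z\<close>, and their commutator \<open>frame_k\<close>.
\<close>

definition frame_n :: "real \<Rightarrow> real \<Rightarrow> complex \<Rightarrow> complex \<Rightarrow> octonion" where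
  "frame_n a d q p = cv 0 (a + d) (2 * q) (2 * q) 0"

definition frame_m :: "real \<Rightarrow> real \<Rightarrow> complex \<Rightarrow> complex \<Rightarrow> octonion" where
  "frame_m a d q p = cv 0 0 (\<i> * (a - d) * q) (- (\<i> * (a - d) * q)) (\<i> * (cnj p * q - (cnj q)\<^sup>2))"

definition frame_k :: "real \<Rightarrow> real \<Rightarrow> complex \<Rightarrow> complex \<Rightarrow> octonion" where
  "frame_k a d q p = (let k = 2 * (2 * p * (cnj q)\<^sup>2 - 2 * q * (q * cnj q) - (a + d) * (a - d) * q) in
     cv 0 0 k (- k) (2 * ((5 * d - 3 * a) * (cnj q)\<^sup>2 - (a + d) * cnj p * q)))"

lemma frame_commutator: "oct_commutator (frame_n a d q p) (frame_m a d q p) = frame_k a d q p"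
  unfolding frame_n_def frame_m_def frame_k_def Let_def oct_commutator_def cv_mult cv_linear cv_eq_iff complex_eq_iff
  by (simp add: power2_eq_square algebra_simps)

lemma Zgen_frame_n: "Zgen a d q p *v frame_n a d q p = 2 *\<^sub>R frame_m a d q p"
  unfolding frame_n_def frame_m_def Zgen_def gm_cv cv_linear cv_eq_iff complex_eq_iff
  by (simp add: power2_eq_square algebra_simps)

lemma Zgen_frame_m: "Zgen a d q p *v frame_m a d q p =
  cv 0 (2 * (a - d) * (cmod q)\<^sup>2) (- (2 * a * (a - d) * q))
    (2 * p * (cnj q)\<^sup>2 - of_real ((a - d)\<^sup>2 + (cmod q)\<^sup>2 + (cmod p)\<^sup>2) * q) (2 * a * cnj p * q - 2 * d * (cnj q)\<^sup>2)"
  unfolding frame_m_def Zgen_def gm_cv cv_linear cv_eq_iff complex_eq_iff cmod_power2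
  by (simp add: power2_eq_square algebra_simps)

lemma frame_S:
  "oct_S *v frame_n a d q p = frame_n a d q p" "oct_S *v frame_m a d q p = - frame_m a d q p"
  "oct_S *v frame_k a d q p = - frame_k a d q p"
  by (simp_all add: frame_n_def frame_m_def frame_k_def Let_def)

text \<open>\<open>x\<close> is the real ratio of \<open>|q|^2 p\<close> to \<open>q^3\<close>. The
  conclusions express p through x in the forms needed for R and I, for \<open>F5\<close>, for v, and
  for the antilinear entries of Z.\<close>

lemma cubic_ratio:
  assumes u: "u > 0" and qq: "q * cnj q = of_real u" and p: "p * (cnj q)\<^sup>2 = of_real (x * u) * q"
  shows "p * cnj q ^ 3 = of_real (x * u\<^sup>2)" "of_real u * p = of_real x * q ^ 3"
    "(cmod p)\<^sup>2 = x\<^sup>2 * u" "cnj p * q = of_real x * (cnj q)\<^sup>2"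
proof -
  have u_def: "u = (cmod q)\<^sup>2" using qq by (metis mult_cnj_cmod of_real_eq_iff)
  show "p * cnj q ^ 3 = of_real (x * u\<^sup>2)"
  proof -
    have "p * cnj q ^ 3 = (p * (cnj q)\<^sup>2) * cnj q" by (simp add: power2_eq_square power3_eq_cube)
    also have "\<dots> = of_real (x * u) * (q * cnj q)" by (simp add: p)
    finally show ?thesis by (simp add: qq power2_eq_square)
  qed
  show pu: "of_real u * p = of_real x * q ^ 3"
  proof -
    have "of_real u * (of_real u * p) = p * (cnj q)\<^sup>2 * q\<^sup>2"
      by (simp flip: qq) (simp add: power2_eq_square)
    also have "\<dots> = of_real u * (of_real x * q ^ 3)"
      unfolding p by (simp add: power2_eq_square power3_eq_cube)
    finally show ?thesis using u by simp
  qed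
  show "(cmod p)\<^sup>2 = x\<^sup>2 * u"
  proof -
    have "u * cmod p = \<bar>x\<bar> * cmod q ^ 3"
      using arg_cong[OF pu, of cmod] u by (simp add: norm_mult norm_power)
    then have "u * cmod p = u * (\<bar>x\<bar> * cmod q)" by (simp add: u_def power2_eq_square power3_eq_cube)
    then have "cmod p = \<bar>x\<bar> * cmod q" using u by simp
    then show ?thesis by (simp add: power_mult_distrib u_def)
  qed
  show "cnj p * q = of_real x * (cnj q)\<^sup>2"
  proof -
    have "of_real u * (cnj p * q) = of_real x * (cnj q ^ 3 * q)"
      using arg_cong[OF pu, of cnj] by simp
    also have "\<dots> = of_real x * ((cnj q)\<^sup>2 * (q * cnj q))" by (simp add: power2_eq_square power3_eq_cube)
    finally show ?thesis using u by (simp add: qq)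
  qed
qed

text \<open>The comparison of coordinates forces p to be determined by a real ratio x, and the
  remaining equations are those of \<open>real_elimination\<close> with \<open>2 * m\<close> in the
  place of its \<open>m\<close>.\<close>

lemma frame_relation:
  assumes q: "q \<noteq> 0"
    and eq: "Zgen a d q p *v frame_m a d q p = l *\<^sub>R frame_n a d q p + m *\<^sub>R frame_k a d q p"
  shows "nongenerating a d q p"
proof -
  define u where "u = (cmod q)\<^sup>2"
  have u: "u > 0" using q by (simp add: u_def)
  have qq: "q * cnj q = of_real u" by (simp add: u_def mult_cnj_cmod)
  note eqs = eq[unfolded Zgen_frame_m frame_n_def frame_k_def Let_def cv_linear cv_eq_iff qq, folded u_def]
  have e1: "2 * (a - d) * u = l * (a + d)" using eqs by simp
  define s where "s = 4 * l + 2 * a * (a - d) + (a - d)\<^sup>2 + u + (cmod p)\<^sup>2"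
  \<comment> \<open>The entries of \<open>frame_k\<close> in the first two complex coordinates are k
    and -k, so adding these coordinates removes \<open>m\<close>.\<close>
  have ps: "2 * p * (cnj q)\<^sup>2 = of_real s * (q :: complex)"
  proof -
    define k where "k = 2 * (2 * p * (cnj q)\<^sup>2 - 2 * q * of_real u
      - (complex_of_real a + complex_of_real d) * (complex_of_real a - complex_of_real d) * q)"
    have X: "- (2 * complex_of_real a * (complex_of_real a - complex_of_real d) * q) = l *\<^sub>R (2 * q) + m *\<^sub>R k"
      and Y: "2 * p * (cnj q)\<^sup>2 - of_real ((a - d)\<^sup>2 + u + (cmod p)\<^sup>2) * q = l *\<^sub>R (2 * q) + m *\<^sub>R (- k)"
      using eqs unfolding k_def by blast+
    have "- (2 * complex_of_real a * (complex_of_real a - complex_of_real d) * q) + (2 * p * (cnj q)\<^sup>2 - of_real ((a - d)\<^sup>2 + u + (cmod p)\<^sup>2) * q)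
        = l *\<^sub>R (4 * q)"
      unfolding X Y by (simp add: scaleR_conv_of_real algebra_simps)
    then show ?thesis by (simp add: s_def scaleR_conv_of_real algebra_simps)
  qed
  define x where "x = s / (2 * u)"
  have p: "p * (cnj q)\<^sup>2 = of_real (x * u) * q"
    using ps u by (simp add: x_def mult_ac)
  note p3 = cubic_ratio(1)[OF u qq p] and pu = cubic_ratio(2)[OF u qq p]
    and v = cubic_ratio(3)[OF u qq p] and pq = cubic_ratio(4)[OF u qq p]
  have e2: "4 * l = - (a - d) * (3 * a - d) - u * (1 - x)\<^sup>2"
  proof -
    have "2 * u * x = s" using u by (simp add: x_def)
    then show ?thesis unfolding s_def v by (simp add: power2_eq_square algebra_simps)
  qed
  have e3: "d\<^sup>2 - a\<^sup>2 + u * (1 - x)\<^sup>2 = 2 * (2 * m) * (- (a + d) * (a - d) + 2 * u * (x - 1))"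
  proof -
    have "2 * a * (a - d) = - (2 * l + m * (2 * (2 * (x * u) - 2 * u - (a + d) * (a - d))))"
    proof -
      have "of_real (2 * a * (a - d)) * q = of_real (- (2 * l + m * (2 * (2 * (x * u) - 2 * u - (a + d) * (a - d))))) * q"
        using eqs p by (simp add: scaleR_conv_of_real algebra_simps)
      then show ?thesis using q by (metis mult_cancel_right of_real_eq_iff)
    qed
    then show ?thesis using e2 by (simp add: power2_eq_square algebra_simps)
  qed
  have e4: "2 * a * x - 2 * d = (2 * m) * (- (a + d) * x - 3 * a + 5 * d)"
  proof -
    have "2 * a * (cnj p * q) - 2 * d * (cnj q)\<^sup>2 = m *\<^sub>R (2 * ((5 * d - 3 * a) * (cnj q)\<^sup>2 - (a + d) * (cnj p * q)))"
      using eqs by (simp add: mult.assoc)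
    then have "of_real (2 * a * x - 2 * d) * (cnj q)\<^sup>2 = of_real ((2 * m) * (- (a + d) * x - 3 * a + 5 * d)) * (cnj q)\<^sup>2"
      unfolding pq by (simp add: scaleR_conv_of_real algebra_simps)
    then show ?thesis using q by (metis complex_cnj_zero_iff mult_cancel_right of_real_eq_iff power_not_zero)
  qed
  have RI: "Re (p * cnj q ^ 3) = x * u\<^sup>2" "Im (p * cnj q ^ 3) = 0" by (simp_all only: p3 Re_complex_of_real Im_complex_of_real)
  from real_elimination[OF u e1 e2 e3 e4] consider "a = 0" "d = 0" | "d = 3 * a" "x = 3"
    | "a\<^sup>2 + u = d\<^sup>2 + x\<^sup>2 * u" "(2 * x\<^sup>2 - x + 3) * a = (x + 3) * d" by blast
  then show ?thesis
  proof cases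
    case 1
    then show ?thesis using RI by (simp add: nongenerating_def)
  next
    case 2
    then show ?thesis using pu by (simp add: nongenerating_def flip: u_def)
  next
    case 3
    have "u * ((2 * (x\<^sup>2 * u) + 3 * u) * a - 3 * u * d) - (a + d) * (x * u\<^sup>2)
        = u\<^sup>2 * ((2 * x\<^sup>2 - x + 3) * a - (x + 3) * d)"
      by (simp add: power2_eq_square algebra_simps)
    then show ?thesis
      unfolding nongenerating_def RI v using 3 by (simp flip: u_def)
  qed
qed

lemma oct_S_fixed:
  assumes "oct_S *v v = v" "v $ 0 = 0"
  obtains r w where "v = cv 0 r w w 0"
proof -
  obtain r0 r x y z where v: "v = cv r0 r x y z" by (rule cv_cases)
  have "r0 = 0" "y = x" using assms unfolding v oct_S_cv cv_eq_iff cv_nth by blast+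
  moreover have "- z = z" using assms unfolding v oct_S_cv cv_eq_iff by blast
  then have "z = 0" by (simp add: complex_eq_iff)
  ultimately have "v = cv 0 r x x 0" by (simp add: v)
  then show ?thesis by (rule that)
qed

lemma assoc_space_orthogonal:
  assumes W: "assoc_space W" and x: "x \<in> W" "x \<noteq> 0"
  obtains y where "y \<in> W" "y \<noteq> 0" "x \<bullet> y = 0"
proof -
  have sub: "subspace W" using W by (simp add: assoc_space_def)
  have "\<not> W \<subseteq> span {x}"
    using dim_le_card[of W "{x}"] W by (auto simp: assoc_space_def)
  then obtain w where w: "w \<in> W" "w \<notin> span {x}" by blast
  define y where "y = w - ((w \<bullet> x) / (x \<bullet> x)) *\<^sub>R x"
  have "y \<in> W" using w x by (simp add: y_def subspace_diff[OF sub] subspace_scale[OF sub])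
  moreover have "y \<noteq> 0"
  proof
    assume "y = 0"
    then have "w = ((w \<bullet> x) / (x \<bullet> x)) *\<^sub>R x" by (simp add: y_def)
    then show False using w(2) by (metis insertI1 span_base span_scale)
  qed
  moreover have "x \<bullet> y = 0" using x by (simp add: y_def inner_diff_right inner_commute)
  ultimately show ?thesis by (rule that)
qed

text \<open>S cannot be -1 on \<open>W\<close>: the commutator of two vectors negated by the
  automorphism S is fixed by it, and for orthogonal nonzero vectors it is a nonzero element of
  \<open>W\<close>.\<close>

lemma assoc_space_S_fixed:
  assumes W: "assoc_space W" and S: "\<And>w. w \<in> W \<Longrightarrow> oct_S *v w \<in> W"
  obtains n where "n \<in> W" "n \<noteq> 0" "oct_S *v n = n"
proof (cases "\<forall>w\<in>W. oct_S *v w = - w")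
  case False
  then obtain w where w: "w \<in> W" "w + oct_S *v w \<noteq> 0" by (auto simp: eq_neg_iff_add_eq_0 add.commute)
  have "w + oct_S *v w \<in> W" using W w S by (simp add: assoc_space_def subspace_add)
  then show ?thesis using w by (intro that[of "w + oct_S *v w"]) (simp_all add: mv_simps add.commute)
next
  case True
  have "W \<noteq> {0}" using W by (auto simp: assoc_space_def)
  moreover have "0 \<in> W" using W by (simp add: assoc_space_def subspace_0)
  ultimately obtain x where x: "x \<in> W" "x \<noteq> 0" by blast
  obtain y where y: "y \<in> W" "y \<noteq> 0" "x \<bullet> y = 0" using assoc_space_orthogonal[OF W x] .
  have c: "oct_commutator x y \<in> W" using W x y by (simp add: assoc_space_def)
  have "oct_S *v oct_commutator x y = oct_commutator (- x) (- y)"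
    using True x y by (simp add: octaut_commutator[OF oct_S_octaut])
  also have "\<dots> = oct_commutator x y"
    by (simp add: oct_commutator_def oct_mult.minus_left oct_mult.minus_right)
  finally have "oct_commutator x y = - oct_commutator x y" using True c by simp
  moreover have "oct_commutator x y \<noteq> 0"
    using W x y by (intro commutator_nonzero) (auto simp: assoc_space_def)
  ultimately show ?thesis by (simp add: eq_neg_iff_add_eq_0 flip: scaleR_2)
qed

lemma assoc_space_invariant:
  assumes W: "assoc_space W" and inv: "\<And>w. w \<in> W \<Longrightarrow> Zgen a d q p *v w \<in> W"
    "\<And>w. w \<in> W \<Longrightarrow> Ad oct_S (Zgen a d q p) *v w \<in> W"
  shows "nongenerating a d q p"
proof (cases "q = 0")
  case True
  then show ?thesis by (simp add: nongenerating_def)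
next
  case q: False
  let ?Z = "Zgen a d q p" and ?S = "(*v) oct_S"
  have Zg: "?Z \<in> g2" by (simp add: Zgen_def gm_in_g2)
  have sub: "subspace W" and im: "\<And>w. w \<in> W \<Longrightarrow> w $ 0 = 0" using W by (auto simp: assoc_space_def)
  note Wcl = subspace_add[OF sub] subspace_diff[OF sub] subspace_scale[OF sub]
  have W': "assoc_space (?S ` W)" by (rule assoc_space_image[OF oct_S_octaut W])
  show ?thesis
  proof (cases "W = ?S ` W")
    case False
    \<comment> \<open>S interchanges Z and SZS, so the image of \<open>W\<close> is invariant under
      both as well.\<close>
    obtain n where n: "n \<noteq> 0" "n $ 0 = 0" "\<And>X. X \<in> {?Z, Ad oct_S ?Z} \<Longrightarrow> X *v n = 0"
    proof (rule assoc_space_unique[OF W W' _ _ _ False])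
      show "{?Z, Ad oct_S ?Z} \<subseteq> g2" using Zg Ad_g2[OF oct_S_octaut Zg] by simp
      show "X *v w \<in> W" if "X \<in> {?Z, Ad oct_S ?Z}" "w \<in> W" for X w using that inv by auto
      show "X *v w \<in> ?S ` W" if X: "X \<in> {?Z, Ad oct_S ?Z}" and w: "w \<in> ?S ` W" for X w
      proof -
        obtain w0 where w0: "w0 \<in> W" "w = oct_S *v w0" using w by blast
        have "oct_S *v (X *v w) \<in> W"
          using X inv[OF w0(1)] by (auto simp: w0(2) Ad_oct_S_mv)
        then show ?thesis by (metis image_eqI oct_S_oct_S)
      qed
    qed blast
    then show ?thesis by (intro common_kernel[of n]) auto
  next
    case True
    then have S: "oct_S *v w \<in> W" if "w \<in> W" for w using that by blast
    obtain n where n: "n \<in> W" "n \<noteq> 0" "oct_S *v n = n" using assoc_space_S_fixed[OF W S] .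
    \<comment> \<open>Otherwise the S-fixed part \<open>e\<close> of Zn is nonzero, and n, e and
      their commutator make all of \<open>W\<close> fixed by S. Then \<open>W\<close> is the whole
      three-dimensional space of S-fixed imaginary octonions and contains e1; but Z e1 is not fixed
      by S, as q is nonzero.\<close>
    have odd: "oct_S *v (?Z *v n) = - (?Z *v n)"
    proof (rule ccontr)
      define e where "e = ?Z *v n + oct_S *v (?Z *v n)"
      assume "oct_S *v (?Z *v n) \<noteq> - (?Z *v n)"
      then have e0: "e \<noteq> 0" by (simp add: e_def eq_neg_iff_add_eq_0 add.commute)
      have eW: "e \<in> W" by (simp add: e_def Wcl inv S n)
      have eS: "oct_S *v e = e" by (simp add: e_def mv_simps add.commute)
      have ne: "n \<bullet> e = 0"
        using octaut_inner[OF oct_S_octaut, of n "?Z *v n"] g2_skew_self[OF Zg, of n]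
        by (simp add: e_def inner_add_right n(3))
      have cS: "oct_S *v oct_commutator n e = oct_commutator n e"
        by (simp add: octaut_commutator[OF oct_S_octaut] n eS)
      have even: "oct_S *v w = w" if "w \<in> W" for w
        by (rule assoc_space_span[OF W n(1,2) eW e0 ne that]) (simp add: mv_simps n eS cS)
      define F where "F = span {cv 0 1 0 0 0, cv 0 0 1 1 0, cv 0 0 \<i> \<i> 0}"
      have "W \<subseteq> F"
      proof
        fix w assume "w \<in> W"
        then have "oct_S *v w = w" "w $ 0 = 0" using even im by auto
        then obtain r z where w: "w = cv 0 r z z 0" by (rule oct_S_fixed)
        have "w = r *\<^sub>R cv 0 1 0 0 0 + Re z *\<^sub>R cv 0 0 1 1 0 + Im z *\<^sub>R cv 0 0 \<i> \<i> 0"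
          by (simp add: w complex_eq_iff)
        also have "\<dots> \<in> F" unfolding F_def by (intro span_add span_scale span_base) auto
        finally show "w \<in> F" .
      qed
      moreover have "dim F \<le> dim W"
      proof -
        have "dim F \<le> card {cv 0 1 0 0 0, cv 0 0 1 1 0, cv 0 0 \<i> \<i> 0}"
          by (rule dim_le_card) (simp_all add: F_def)
        then show ?thesis using W by (simp add: assoc_space_def card_insert_le_m1)
      qed
      ultimately have "W = F" using sub by (intro subspace_dim_equal) (simp_all add: F_def)
      then have "cv 0 1 0 0 0 \<in> W" by (simp add: F_def span_base)
      from even[OF inv(1)[OF this]] show False using q by (simp add: Zgen_def)
    qed
    obtain r w where nw: "n = cv 0 r w w 0"
      using oct_S_fixed[OF n(3) im[OF n(1)]] .
    \<comment> \<open>Oddness of Zn says that Z + SZS kills n; this linear system makes n a multiple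
      of \<open>frame_n\<close>.\<close>
    have 1: "Im (cnj q * w) = 0" "2 * r * q = (a + d) * w"
      using odd by (auto simp: nw Zgen_def complex_eq_iff algebra_simps)
    obtain t where t: "w = of_real t * q" using cnj_mult_real[OF 1(1) q] .
    have "of_real (2 * r) * q = of_real ((a + d) * t) * q" using 1(2) by (simp add: t)
    then have r: "2 * r = (a + d) * t" using q by (metis mult_cancel_right of_real_eq_iff)
    have "t \<noteq> 0" using n(2) r by (auto simp: nw t)
    have "(2 / t) * r = a + d" using r \<open>t \<noteq> 0\<close> by (simp add: field_simps)
    moreover have "(2 / t) *\<^sub>R (of_real t * q) = 2 * q" using \<open>t \<noteq> 0\<close> by (simp add: complex_eq_iff)
    ultimately have "frame_n a d q p = (2 / t) *\<^sub>R n"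
      by (simp add: frame_n_def nw t)
    then have nW: "frame_n a d q p \<in> W" and n0: "frame_n a d q p \<noteq> 0"
      using n \<open>t \<noteq> 0\<close> by (simp_all add: Wcl)
    have "(1 / 2) *\<^sub>R (?Z *v frame_n a d q p) \<in> W" by (simp add: Wcl inv nW)
    then have mW: "frame_m a d q p \<in> W" by (simp add: Zgen_frame_n)
    show ?thesis
    proof (cases "frame_m a d q p = 0")
      case True
      then have "a = d" "cnj p * q = (cnj q)\<^sup>2" using q by (auto simp: frame_m_def)
      then show ?thesis using nongenerating_special[OF q] by blast
    next
      case m0: False
      have nm: "frame_n a d q p \<bullet> frame_m a d q p = 0"
        by (simp add: frame_n_def frame_m_def inner_cv)
      obtain l c m where lm: "?Z *v frame_m a d q p = l *\<^sub>R frame_n a d q p + c *\<^sub>R frame_m a d q p + m *\<^sub>R frame_k a d q p"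
        using assoc_space_span[OF W nW n0 mW m0 nm inv(1)[OF mW]] unfolding frame_commutator .
      have mk: "frame_m a d q p \<bullet> frame_k a d q p = 0"
        using commutator_orthogonal(2)[OF im[OF nW] im[OF mW]] by (simp add: frame_commutator)
      \<comment> \<open>Z is skew, so the image of \<open>frame_m\<close> has no component along
        \<open>frame_m\<close>.\<close>
      have "c * (frame_m a d q p \<bullet> frame_m a d q p) = 0"
        using g2_skew_self[OF Zg, of "frame_m a d q p"] nm mk
        by (simp add: lm inner_add_right inner_commute)
      then have "c = 0" using m0 by simp
      then show ?thesis using frame_relation[OF q] lm by simp
    qed
  qed
qed

section \<open>Generation\<close>

lemma lie_subalgebra_L_gen: "lie_subalgebra (L_gen Z)"
  unfolding L_gen_def
proof (rule hull_in)
  fix f assume f: "\<forall>L\<in>f. lie_subalgebra L"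
  then have "\<forall>L\<in>f. subspace L" by (simp add: lie_subalgebra_def)
  then have "subspace (\<Inter>f)" by (rule subspace_Inter)
  with f show "lie_subalgebra (\<Inter>f)" by (auto simp: lie_subalgebra_def)
qed

lemma L_gen_mem: "Z \<in> L_gen Z" "Ad oct_S Z \<in> L_gen Z"
  unfolding L_gen_def using hull_subset[of "{Z, Ad oct_S Z}" lie_subalgebra] by auto

lemma L_gen_minimal: "lie_subalgebra L \<Longrightarrow> Z \<in> L \<Longrightarrow> Ad oct_S Z \<in> L \<Longrightarrow> L_gen Z \<subseteq> L"
  unfolding L_gen_def by (rule hull_minimal) auto

lemma Zgen_in_g2: "Zgen a d q p \<in> g2"
  by (simp add: Zgen_def gm_in_g2)

lemma L_gen_subset_g2: "L_gen (Zgen a d q p) \<subseteq> g2"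
  by (intro L_gen_minimal lie_subalgebra_g2 Zgen_in_g2 Ad_g2 oct_S_octaut)

lemma L_gen_eq_g2:
  assumes "\<not> nongenerating a d q p"
  shows "L_gen (Zgen a d q p) = g2"
proof (rule subalgebra_cases[OF lie_subalgebra_L_gen L_gen_subset_g2])
  fix n assume "n \<noteq> 0" "n $ 0 = 0" "\<And>X. X \<in> L_gen (Zgen a d q p) \<Longrightarrow> X *v n = 0"
  then show ?thesis using common_kernel[of n] L_gen_mem assms by blast
next
  fix W assume "assoc_space W" "\<And>X w. X \<in> L_gen (Zgen a d q p) \<Longrightarrow> w \<in> W \<Longrightarrow> X *v w \<in> W"
  then show ?thesis using assoc_space_invariant[of W] L_gen_mem assms by blast
next
  fix Y U V assume span: "L_gen (Zgen a d q p) \<subseteq> span {Y, U, V}"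
  obtain \<alpha> \<kappa> where "lie_bracket (Zgen a d q p) (lie_bracket (Zgen a d q p) (Ad oct_S (Zgen a d q p)))
      = \<alpha> *\<^sub>R Ad oct_S (Zgen a d q p) + \<kappa> *\<^sub>R Zgen a d q p"
    using double_bracket_rank_one[OF lie_subalgebra_L_gen L_gen_subset_g2 span L_gen_mem] .
  then show ?thesis using double_bracket assms by blast
qed

section \<open>The converse: each condition gives an S-stable invariant subspace\<close>

lemma g2_irreducible:
  assumes W: "subspace W" and inv: "\<And>X w. X \<in> g2 \<Longrightarrow> w \<in> W \<Longrightarrow> X *v w \<in> W"
    and n: "n \<in> W" "n \<noteq> 0" "n $ 0 = 0"
  shows "dim W > 3"
proof -
  note Wcl = subspace_add[OF W] subspace_scale[OF W] inv gm_in_g2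
  obtain r x y z where nx: "n = cv 0 r x y z" using n(3) by (cases n rule: cv_cases) auto
  let ?H = "gm 1 3 0 0 0 0 0 0"
  \<comment> \<open>The squared eigenvalues of \<open>?H\<close> on the four coordinates are 0, 1,
    9, 16. Suitable values of \<open>c\<close> isolate one nonzero coordinate, and a root vector
    then carries it to e1.\<close>
  have step: "cv 0 (c * r) ((c - 1) *\<^sub>R x) ((c - 9) *\<^sub>R y) ((c - 16) *\<^sub>R z) \<in> W"
    if "cv 0 r x y z \<in> W" for c r x y z
  proof -
    have "?H *v (?H *v cv 0 r x y z) + c *\<^sub>R cv 0 r x y z \<in> W" by (intro Wcl that)
    also have "?H *v (?H *v cv 0 r x y z) + c *\<^sub>R cv 0 r x y z
        = cv 0 (c * r) ((c - 1) *\<^sub>R x) ((c - 9) *\<^sub>R y) ((c - 16) *\<^sub>R z)"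
      by (simp add: complex_eq_iff algebra_simps)
    finally show ?thesis .
  qed
  have real: "cv 0 1 0 0 0 \<in> W" if "cv 0 s 0 0 0 \<in> W" "s \<noteq> 0" for s
    using subspace_scale[OF W that(1), of "1 / s"] that(2) by simp
  have e1: "cv 0 1 0 0 0 \<in> W"
  proof -
    consider "r \<noteq> 0" | "r = 0" "x \<noteq> 0" | "r = 0" "y \<noteq> 0" | "r = 0" "z \<noteq> 0"
      using n(2) by (auto simp: nx)
    then show ?thesis
    proof cases
      case 1
      have "cv 0 (144 * r) 0 0 0 \<in> W"
        using step[where c = 16, OF step[where c = 9, OF step[where c = 1, OF n(1)[unfolded nx]]]] by simp
      then show ?thesis using 1 by (intro real[of "144 * r"]) simp_all
    next
      case 2
      have "cv 0 0 (120 *\<^sub>R x) 0 0 \<in> W"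
        using step[where c = 16, OF step[where c = 9, OF n(1)[unfolded nx]]] 2 by simp
      then have "gm 0 0 x 0 0 0 0 0 *v cv 0 0 (120 *\<^sub>R x) 0 0 \<in> W" by (intro Wcl)
      also have "gm 0 0 x 0 0 0 0 0 *v cv 0 0 (120 *\<^sub>R x) 0 0 = cv 0 (- 240 * (cmod x)\<^sup>2) 0 0 0"
        unfolding cmod_power2 by (simp add: power2_eq_square algebra_simps)
      finally show ?thesis using 2 by (intro real[of "- 240 * (cmod x)\<^sup>2"]) simp_all
    next
      case 3
      have "cv 0 0 0 ((- 56) *\<^sub>R y) 0 \<in> W"
        using step[where c = 16, OF step[where c = 1, OF n(1)[unfolded nx]]] 3 by simp
      then have "gm 0 0 0 y 0 0 0 0 *v cv 0 0 0 ((- 56) *\<^sub>R y) 0 \<in> W" by (intro Wcl)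
      also have "gm 0 0 0 y 0 0 0 0 *v cv 0 0 0 ((- 56) *\<^sub>R y) 0 = cv 0 (112 * (cmod y)\<^sup>2) 0 0 0"
        unfolding cmod_power2 by (simp add: power2_eq_square algebra_simps)
      finally show ?thesis using 3 by (intro real[of "112 * (cmod y)\<^sup>2"]) simp_all
    next
      case 4
      have "cv 0 0 0 0 (105 *\<^sub>R z) \<in> W"
        using step[where c = 9, OF step[where c = 1, OF n(1)[unfolded nx]]] 4 by simp
      then have "gm 0 0 0 0 z 0 0 0 *v cv 0 0 0 0 (105 *\<^sub>R z) \<in> W" by (intro Wcl)
      also have "gm 0 0 0 0 z 0 0 0 *v cv 0 0 0 0 (105 *\<^sub>R z) = cv 0 (- 210 * (cmod z)\<^sup>2) 0 0 0"
        unfolding cmod_power2 by (simp add: power2_eq_square algebra_simps)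
      finally show ?thesis using 4 by (intro real[of "- 210 * (cmod z)\<^sup>2"]) simp_all
    qed
  qed
  \<comment> \<open>From e1 the derivations reach e2, e3 and e4, which already gives dimension
    four.\<close>
  have "gm 0 0 y1 y2 0 0 0 0 *v cv 0 1 0 0 0 \<in> W" for y1 y2 by (intro Wcl e1)
  from this[of "1 / 2" 0] this[of "\<i> / 2" 0] this[of 0 "1 / 2"]
  have "{oct_e 1, oct_e 2, oct_e 3, oct_e 4} \<subseteq> W" using e1 by (simp add: oct_e_cv)
  moreover have "independent {oct_e 1, oct_e 2, oct_e 3, oct_e 4}"
    by (rule independent_mono[OF independent_Basis]) (auto simp: axis_in_Basis_iff)
  ultimately have "card {oct_e 1, oct_e 2, oct_e 3, oct_e 4} \<le> dim W"
    by (rule independent_card_le_dim)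
  then show ?thesis by (simp add: axis_eq_axis)
qed

text \<open>The matrices preserving \<open>W\<close> form a Lie subalgebra containing Z and, by
  S-stability, SZS. It therefore contains \<open>L_gen Z\<close>, whereas g2 preserves no such small
  space.\<close>

lemma invariant_subspace_proper:
  assumes W: "subspace W" "dim W \<le> 3" and n: "n \<in> W" "n \<noteq> 0" "n $ 0 = 0"
    and inv: "\<And>w. w \<in> W \<Longrightarrow> Z *v w \<in> W" and S: "\<And>w. w \<in> W \<Longrightarrow> oct_S *v w \<in> W"
  shows "L_gen Z \<noteq> g2"
proof
  assume eq: "L_gen Z = g2"
  define L where "L = {X :: oct_endo. \<forall>w\<in>W. X *v w \<in> W}"
  have "lie_subalgebra L"
    unfolding lie_subalgebra_def L_def
    using W(1) by (auto simp: subspace_def lie_bracket_mv mv_simps subspace_diff[OF W(1)])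
  then have "L_gen Z \<subseteq> L"
    by (rule L_gen_minimal) (auto simp: L_def inv S Ad_oct_S_mv)
  then have "dim W > 3" using g2_irreducible[OF W(1) _ n] by (auto simp: eq L_def)
  then show False using W(2) by simp
qed

lemma kernel_proper:
  assumes "n \<noteq> 0" "n $ 0 = 0" "Z *v n = 0" "oct_S *v n = n \<or> oct_S *v n = - n"
  shows "L_gen Z \<noteq> g2"
proof (rule invariant_subspace_proper[of "span {n}" n])
  show "dim (span {n}) \<le> 3" using dim_le_card[of "span {n}" "{n}"] by simp
  show "Z *v w \<in> span {n}" if "w \<in> span {n}" for w
    using that assms(3) by (auto simp: span_singleton mv_simps intro: exI[of _ 0])
  show "oct_S *v w \<in> span {n}" if "w \<in> span {n}" for w
    using that assms(4) by (auto simp: span_singleton mv_simps image_iff) (metis scaleR_minus_left scaleR_minus_right)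
qed (use assms in \<open>auto simp: span_base\<close>)

lemma commutator_twice:
  assumes "x $ 0 = 0" "y $ 0 = 0" "x \<bullet> y = 0"
  shows "oct_commutator x (oct_commutator x y) = - (4 * (x \<bullet> x)) *\<^sub>R y"
proof -
  have c: "oct_commutator u v = 2 *\<^sub>R (u \<star> v)" if "u $ 0 = 0" "v $ 0 = 0" "u \<bullet> v = 0" for u v
    using oct_mult_anticommute[OF that] by (simp add: oct_commutator_def scaleR_2)
  have "oct_commutator x y $ 0 = 0"
    by (cases x rule: cv_cases; cases y rule: cv_cases)
      (simp add: oct_commutator_def cv_mult algebra_simps)
  then have "oct_commutator x (oct_commutator x y) = 2 *\<^sub>R (x \<star> (2 *\<^sub>R (x \<star> y)))"
    using c[OF assms(1) _ commutator_orthogonal(1)[OF assms(1,2)]] c[OF assms] by simp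
  then show ?thesis by (simp add: oct_mult.scaleR_right oct_mult_left_twice[OF assms(1)])
qed

text \<open>One relation suffices for invariance of the span of the frame: Z \<open>frame_n\<close>
  is twice \<open>frame_m\<close>, and the derivation rule applied to the commutator makes Z
  \<open>frame_k\<close> a multiple of \<open>frame_m\<close>.\<close>

lemma frame_proper:
  assumes q: "q \<noteq> 0"
    and eq: "Zgen a d q p *v frame_m a d q p = l *\<^sub>R frame_n a d q p + m *\<^sub>R frame_k a d q p"
  shows "L_gen (Zgen a d q p) \<noteq> g2"
proof -
  let ?n = "frame_n a d q p" and ?m = "frame_m a d q p" and ?k = "frame_k a d q p" and ?Z = "Zgen a d q p"
  have im: "?n $ 0 = 0" "?m $ 0 = 0" by (simp_all add: frame_n_def frame_m_def)
  have nm: "?n \<bullet> ?m = 0" by (simp add: frame_n_def frame_m_def inner_cv)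
  have nk: "oct_commutator ?n ?k = - (4 * (?n \<bullet> ?n)) *\<^sub>R ?m"
    using commutator_twice[OF im nm] by (simp add: frame_commutator)
  have "?Z *v ?k = oct_commutator (?Z *v ?n) ?m + oct_commutator ?n (?Z *v ?m)"
    unfolding frame_commutator[symmetric] oct_commutator_def
    by (simp add: mv_simps g2_mult[OF Zgen_in_g2])
  also have "\<dots> = m *\<^sub>R oct_commutator ?n ?k"
    by (simp add: Zgen_frame_n eq oct_commutator_def oct_mult.add_left oct_mult.add_right
        oct_mult.scaleR_left oct_mult.scaleR_right algebra_simps)
  finally have Zk: "?Z *v ?k = (m * - (4 * (?n \<bullet> ?n))) *\<^sub>R ?m" by (simp add: nk)
  define W where "W = span {?n, ?m, ?k}"
  have W: "subspace W" "?n \<in> W" "?m \<in> W" "?k \<in> W" by (simp_all add: W_def span_base)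
  note Wcl = subspace_add[OF W(1)] subspace_scale[OF W(1)] subspace_neg[OF W(1)] W
  show ?thesis
  proof (rule invariant_subspace_proper[of W ?n])
    have "dim W \<le> card {?n, ?m, ?k}" by (rule dim_le_card) (simp_all add: W_def)
    also have "\<dots> \<le> 3" by (simp add: card_insert_le_m1)
    finally show "dim W \<le> 3" .
    have sub: "subspace {w. A *v w \<in> W}" for A :: oct_endo
      using W(1) by (auto simp: subspace_def mv_simps)
    have "W \<subseteq> {w. ?Z *v w \<in> W}"
      unfolding W_def using sub by (intro span_minimal) (auto simp: Zgen_frame_n eq Zk Wcl simp flip: W_def)
    then show "?Z *v w \<in> W" if "w \<in> W" for w using that by blast
    have "W \<subseteq> {w. oct_S *v w \<in> W}"
      unfolding W_def using sub by (intro span_minimal) (auto simp: frame_S Wcl simp flip: W_def)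
    then show "oct_S *v w \<in> W" if "w \<in> W" for w using that by blast
    show "?n \<noteq> 0" using q by (simp add: frame_n_def)
  qed (use W im in auto)
qed

lemma cubic_ratio_cancel:
  assumes u: "u > 0" and qq: "q * cnj q = of_real u" and p3: "p * cnj q ^ 3 = of_real (x * u\<^sup>2)"
  shows "p * (cnj q)\<^sup>2 = of_real (x * u) * q"
proof -
  have "of_real u * (p * (cnj q)\<^sup>2) = (p * cnj q ^ 3) * q"
    by (simp add: power2_eq_square power3_eq_cube flip: qq)
  also have "\<dots> = of_real u * (of_real (x * u) * q)" unfolding p3 by (simp add: power2_eq_square)
  finally show ?thesis using u by simp
qed

text \<open>Once p is expressed through the real ratio x, the coordinates of the frame relation
  reduce to the four scalar equations.\<close>

lemma frame_relation_converse:
  assumes q: "q \<noteq> 0" and I: "Im (p * cnj q ^ 3) = 0" and u: "u = (cmod q)\<^sup>2" and x: "x = Re (p * cnj q ^ 3) / u\<^sup>2"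
    and e1: "2 * (a - d) * u = l * (a + d)"
    and e2: "4 * l = - (a - d) * (3 * a - d) - u * (1 - x)\<^sup>2"
    and e3: "d\<^sup>2 - a\<^sup>2 + u * (1 - x)\<^sup>2 = 2 * (2 * m) * (- (a + d) * (a - d) + 2 * u * (x - 1))"
    and e4: "2 * a * x - 2 * d = (2 * m) * (- (a + d) * x - 3 * a + 5 * d)"
  shows "Zgen a d q p *v frame_m a d q p = l *\<^sub>R frame_n a d q p + m *\<^sub>R frame_k a d q p"
proof -
  have u0: "u > 0" using q by (simp add: u)
  have qq: "q * cnj q = of_real u" by (simp add: u mult_cnj_cmod)
  have p3: "p * cnj q ^ 3 = of_real (x * u\<^sup>2)"
    using I u0 by (simp add: complex_eq_iff x)
  note p = cubic_ratio_cancel[OF u0 qq p3]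
  note v = cubic_ratio(3)[OF u0 qq p] and pq = cubic_ratio(4)[OF u0 qq p]
  have X: "- (2 * a * (a - d)) = l * 2 + m * (2 * (2 * (x * u) - 2 * u - (a + d) * (a - d)))"
    using e2 e3 by (simp add: power2_eq_square algebra_simps)
  have Y: "2 * (x * u) - ((a - d)\<^sup>2 + u + x\<^sup>2 * u) = l * 2 - m * (2 * (2 * (x * u) - 2 * u - (a + d) * (a - d)))"
    using e2 e3 by (simp add: power2_eq_square algebra_simps)
  have Z: "2 * a * x - 2 * d = m * (2 * ((5 * d - 3 * a) - (a + d) * x))"
    using e4 by (simp add: algebra_simps)
  have "Zgen a d q p *v frame_m a d q p = cv 0 (2 * (a - d) * u) (of_real (- (2 * a * (a - d))) * q)
      (of_real (2 * (x * u) - ((a - d)\<^sup>2 + u + x\<^sup>2 * u)) * q) (of_real (2 * a * x - 2 * d) * (cnj q)\<^sup>2)"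
    unfolding Zgen_frame_m v u[symmetric] mult.assoc p pq by (simp add: algebra_simps)
  also have "\<dots> = l *\<^sub>R frame_n a d q p + m *\<^sub>R frame_k a d q p"
    unfolding X Y Z e1 unfolding frame_n_def frame_k_def Let_def cv_linear mult.assoc p pq qq
    by (simp add: scaleR_conv_of_real algebra_simps)
  finally show ?thesis .
qed

lemma nongenerating_proper:
  assumes "nongenerating a d q p"
  shows "L_gen (Zgen a d q p) \<noteq> g2"
proof -
  have point: "L_gen (Zgen a d q p) \<noteq> g2" if q: "q \<noteq> 0" and "a + d = 0" and n: "cmod p = cmod q"
  proof -
    \<comment> \<open>A nonzero solution of \<open>p * y + cnj q * cnj y = 0\<close>. Since |p| =
      |q|, \<open>cnj q - cnj p\<close> is one unless p = q; in that case any imaginary multiple of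
      \<open>cnj q\<close> works.\<close>
    define y where "y = (if p = q then \<i> * (- 2 * cnj q) else cnj q - cnj p)"
    have "p * cnj p = q * cnj q" by (simp add: mult_cnj_cmod n)
    then have "p * y + cnj q * cnj y = 0" by (auto simp: y_def algebra_simps)
    moreover have "y \<noteq> 0" using q by (auto simp: y_def)
    ultimately show ?thesis
      using \<open>a + d = 0\<close>
      by (intro kernel_proper[of "cv 0 0 0 0 y"])
        (simp_all add: Zgen_def algebra_simps add_eq_0_iff2 flip: of_real_add distrib_left)
  qed
  have special: "L_gen (Zgen a d q p) \<noteq> g2" if q: "q \<noteq> 0" and "frame_m a d q p = 0"
    using that Zgen_frame_n[of a d q p] frame_S(1)[of a d q p]
    by (intro kernel_proper[of "frame_n a d q p"]) (simp_all add: frame_n_def)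
  show ?thesis
  proof (cases "q = 0")
    case True
    then show ?thesis by (intro kernel_proper[of "cv 0 1 0 0 0"]) (simp_all add: Zgen_def)
  next
    case q: False
    define u where "u = (cmod q)\<^sup>2"
    define x where "x = Re (p * cnj q ^ 3) / u\<^sup>2"
    have u: "u > 0" using q by (simp add: u_def)
    have qq: "q * cnj q = of_real u" by (simp add: u_def mult_cnj_cmod)
    have frame: "L_gen (Zgen a d q p) \<noteq> g2"
      if "Im (p * cnj q ^ 3) = 0" "2 * (a - d) * u = l * (a + d)"
        "4 * l = - (a - d) * (3 * a - d) - u * (1 - x)\<^sup>2"
        "d\<^sup>2 - a\<^sup>2 + u * (1 - x)\<^sup>2 = 2 * (2 * m) * (- (a + d) * (a - d) + 2 * u * (x - 1))"
        "2 * a * x - 2 * d = (2 * m) * (- (a + d) * x - 3 * a + 5 * d)" for l m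
      using frame_proper[OF q frame_relation_converse[OF q that(1) u_def x_def that(2-5)]] .
    from assms q consider "a = 0" "d\<^sup>2 + (cmod p)\<^sup>2 = u" | "a + d = 0" "(cmod p)\<^sup>2 = u"
      | "a = 0" "d = 0" "Im (p * cnj q ^ 3) = 0" | "d = 3 * a" "of_real u * p = 3 * q ^ 3"
      | "a\<^sup>2 + u - d\<^sup>2 - (cmod p)\<^sup>2 = 0" "Im (p * cnj q ^ 3) = 0"
        "u * ((2 * (cmod p)\<^sup>2 + 3 * u) * a - 3 * u * d) - (a + d) * Re (p * cnj q ^ 3) = 0"
      unfolding nongenerating_def u_def by blast
    then show ?thesis
    proof cases
      case 1
      show ?thesis
      proof (cases "d = 0")
        case True
        then show ?thesis using point[OF q] 1 by (simp add: u_def)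
      next
        case False
        have pp: "p * cnj p = of_real (u - d\<^sup>2)" using 1(2) by (simp add: mult_cnj_cmod flip: 1(2))
        have "p * ((cnj q)\<^sup>2 - cnj p * q) + cnj q * (q\<^sup>2 - p * cnj q) = q * (q * cnj q - p * cnj p)"
          by (simp add: power2_eq_square algebra_simps)
        also have "\<dots> = of_real (d * d) * q" by (simp add: qq pp power2_eq_square)
        finally have "p * ((cnj q)\<^sup>2 - cnj p * q) + cnj q * (q\<^sup>2 - p * cnj q) = of_real (d * d) * q" .
        \<comment> \<open>This is the S-negated kernel vector found in \<open>common_kernel\<close>,
          normalised by t = d.\<close>
        then have "Zgen a d q p *v cv 0 0 (d * q) (- (d * q)) ((cnj q)\<^sup>2 - cnj p * q) = 0"
          using 1(1) by (simp add: Zgen_def complex_eq_iff power2_eq_square algebra_simps)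
        then show ?thesis
          by (rule kernel_proper[rotated 2]) (use False q in simp_all)
      qed
    next
      case 2
      then show ?thesis using point[OF q] by (simp add: u_def)
    next
      case 3
      show ?thesis
        \<comment> \<open>With a = d = 0 the second equation gives \<open>l\<close>, the third gives
          \<open>m\<close>, and the other two are trivial.\<close>
        by (rule frame[OF 3(3), of "- u * (1 - x)\<^sup>2 / 4" "(x - 1) / 8"])
          (simp_all add: 3(1,2) power2_eq_square field_simps)
    next
      case 4
      have "of_real u * (p * cnj q ^ 3) = 3 * (q * cnj q) ^ 3"
        using arg_cong[OF 4(2), of "\<lambda>w. w * cnj q ^ 3"] by (simp add: power_mult_distrib mult.assoc)
      also have "\<dots> = of_real u * of_real (3 * u\<^sup>2)" by (simp add: qq power2_eq_square power3_eq_cube)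
      finally have "p * cnj q ^ 3 = of_real (3 * u\<^sup>2)" using u by simp
      then have "Im (p * cnj q ^ 3) = 0" "x = 3" using u by (simp_all add: x_def)
      then show ?thesis
        \<comment> \<open>With d = 3a and x = 3 the second equation reads
          \<open>4 * l = - 4 * u\<close>, and the third forces \<open>m = 1 / 4\<close>.\<close>
        by (intro frame[of "- u" "1 / 4"]) (simp_all add: 4(1) power2_eq_square algebra_simps)
    next
      case 5
      have R: "Re (p * cnj q ^ 3) = x * u\<^sup>2" using u by (simp add: x_def)
      have "p * cnj q ^ 3 = of_real (x * u\<^sup>2)" using 5(2) R by (simp add: complex_eq_iff)
      note p = cubic_ratio_cancel[OF u qq this]
      note v = cubic_ratio(3)[OF u qq p]
      have del: "d\<^sup>2 - a\<^sup>2 = u * (1 - x\<^sup>2)" using 5(1) by (simp add: v algebra_simps)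
      have "u\<^sup>2 * ((2 * x\<^sup>2 - x + 3) * a - (x + 3) * d) = 0"
        using 5(3) unfolding v R by (simp add: power2_eq_square algebra_simps)
      then have th: "(2 * x\<^sup>2 - x + 3) * a = (x + 3) * d" using u by simp
      show ?thesis
      proof (cases "x = 1")
        \<comment> \<open>Here the formula for \<open>m\<close> below has a pole, but a = d and
          \<open>frame_m\<close> vanishes, so \<open>frame_n\<close> is a kernel vector.\<close>
        case True
        then have "frame_m a d q p = 0" using th cubic_ratio(4)[OF u qq p] by (simp add: frame_m_def)
        then show ?thesis by (rule special[OF q])
      next
        case False
        define l where "l = (- (a - d) * (3 * a - d) - u * (1 - x)\<^sup>2) / 4"
        \<comment> \<open>The value for which the last two equations become
          \<open>(x - 1) * A = B\<close>, with A and B their left side and the cofactor of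
          \<open>2 * m\<close>.\<close>
        define m where "m = 1 / (2 * (x - 1))"
        have cancel: "A = (2 * m) * B" if "(x - 1) * A = B" for A B
          using False that by (simp add: m_def field_simps)
        show ?thesis
        proof (rule frame[of l m])
          show e2: "4 * l = - (a - d) * (3 * a - d) - u * (1 - x)\<^sup>2" by (simp add: l_def)
          have "4 * (2 * (a - d) * u - l * (a + d)) = 8 * (a - d) * u - (4 * l) * (a + d)"
            by (simp add: algebra_simps)
          also have "\<dots> = 8 * (a - d) * u - (d\<^sup>2 - a\<^sup>2) * (3 * a - d) + (a + d) * u * (1 - x)\<^sup>2"
            unfolding e2 by (simp add: power2_eq_square algebra_simps)
          also have "\<dots> = 2 * u * ((2 * x\<^sup>2 - x + 3) * a - (x + 3) * d)"
            unfolding del by (simp add: power2_eq_square algebra_simps)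
          finally show "2 * (a - d) * u = l * (a + d)" using th by simp
          have "(x - 1) * (d\<^sup>2 - a\<^sup>2 + u * (1 - x)\<^sup>2) = 2 * ((d\<^sup>2 - a\<^sup>2) + 2 * u * (x - 1))"
            unfolding del by (simp add: power2_eq_square algebra_simps)
          also have "\<dots> = 2 * (- (a + d) * (a - d) + 2 * u * (x - 1))"
            by (simp add: power2_eq_square algebra_simps)
          finally have "d\<^sup>2 - a\<^sup>2 + u * (1 - x)\<^sup>2 = (2 * m) * (2 * (- (a + d) * (a - d) + 2 * u * (x - 1)))"
            by (rule cancel)
          then show "d\<^sup>2 - a\<^sup>2 + u * (1 - x)\<^sup>2 = 2 * (2 * m) * (- (a + d) * (a - d) + 2 * u * (x - 1))"
            by (simp only: mult_ac)
          have "(x - 1) * (2 * a * x - 2 * d) = - (a + d) * x - 3 * a + 5 * d"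
            using th by (simp add: power2_eq_square algebra_simps)
          then show "2 * a * x - 2 * d = (2 * m) * (- (a + d) * x - 3 * a + 5 * d)"
            by (rule cancel)
        qed (rule 5(2))
      qed
    qed
  qed
qed

section \<open>Homogeneous polynomials\<close>

lemma finite_exponents: "finite {m :: 'n::finite \<Rightarrow> nat. (\<Sum>i\<in>UNIV. m i) = n}"
proof (rule finite_subset)
  show "{m :: 'n \<Rightarrow> nat. (\<Sum>i\<in>UNIV. m i) = n} \<subseteq> PiE UNIV (\<lambda>_. {..n})"
    by (auto simp: PiE_UNIV_domain intro: member_le_sum)
  show "finite (PiE (UNIV :: 'n set) (\<lambda>_. {..n}))" by (intro finite_PiE) auto
qed

lemma homogeneous_polynomial_add:
  assumes "homogeneous_polynomial n f" "homogeneous_polynomial n g"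
  shows "homogeneous_polynomial n (\<lambda>x. f x + g x)"
proof -
  obtain c c' where "\<And>x. f x = (\<Sum>m | (\<Sum>i\<in>UNIV. m i) = n. c m * (\<Prod>i\<in>UNIV. x $ i ^ m i))"
    "\<And>x. g x = (\<Sum>m | (\<Sum>i\<in>UNIV. m i) = n. c' m * (\<Prod>i\<in>UNIV. x $ i ^ m i))"
    using assms unfolding homogeneous_polynomial_def by blast
  then show ?thesis
    unfolding homogeneous_polynomial_def
    by (intro exI[of _ "\<lambda>m. c m + c' m"]) (simp add: sum.distrib distrib_right)
qed

text \<open>Cauchy product: the pairs of exponents are grouped by their sum, which has total degree
  \<open>k + l\<close>.\<close>

lemma homogeneous_polynomial_mult:
  fixes f g :: "real ^ 'n::finite \<Rightarrow> real"
  assumes "homogeneous_polynomial k f" "homogeneous_polynomial l g"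
  shows "homogeneous_polynomial (k + l) (\<lambda>x. f x * g x)"
proof -
  let ?E = "\<lambda>n. {m :: 'n \<Rightarrow> nat. (\<Sum>i\<in>UNIV. m i) = n}"
  let ?M = "\<lambda>x m. \<Prod>i\<in>UNIV. (x :: real ^ 'n) $ i ^ m i"
  obtain c c' where c: "\<And>x. f x = (\<Sum>m\<in>?E k. c m * ?M x m)" and c': "\<And>x. g x = (\<Sum>m\<in>?E l. c' m * ?M x m)"
    using assms unfolding homogeneous_polynomial_def by blast
  let ?add = "\<lambda>(m, m') i. (m i + m' i :: nat)"
  define C where "C M = (\<Sum>(m, m') | (m, m') \<in> ?E k \<times> ?E l \<and> ?add (m, m') = M. c m * c' m')" for M
  have "f x * g x = (\<Sum>M\<in>?E (k + l). C M * ?M x M)" for x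
  proof -
    have "f x * g x = (\<Sum>p\<in>?E k \<times> ?E l. c (fst p) * c' (snd p) * ?M x (?add p))"
      unfolding c c' sum_product sum.cartesian_product
      by (intro sum.cong refl) (auto simp: prod.distrib power_add)
    also have "\<dots> = (\<Sum>M\<in>?E (k + l). \<Sum>p | p \<in> ?E k \<times> ?E l \<and> ?add p = M. c (fst p) * c' (snd p) * ?M x (?add p))"
      by (rule sum.group[symmetric]) (auto intro!: finite_cartesian_product finite_exponents simp: sum.distrib)
    also have "\<dots> = (\<Sum>M\<in>?E (k + l). C M * ?M x M)"
      unfolding C_def sum_distrib_right by (intro sum.cong refl) (auto simp: case_prod_beta)
    finally show ?thesis .
  qed
  then show ?thesis unfolding homogeneous_polynomial_def by blast
qed

lemma homogeneous_polynomial_const: "homogeneous_polynomial 0 (\<lambda>x :: real ^ 'n::finite. c)"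
proof -
  have "{m :: 'n \<Rightarrow> nat. (\<Sum>i\<in>UNIV. m i) = 0} = {\<lambda>_. 0}" by (auto simp: fun_eq_iff)
  then show ?thesis unfolding homogeneous_polynomial_def by (intro exI[of _ "\<lambda>_. c"]) simp
qed

lemma homogeneous_polynomial_coord: "homogeneous_polynomial 1 (\<lambda>x :: real ^ 'n::finite. x $ j)"
proof -
  let ?e = "\<lambda>i. if i = j then 1 else 0 :: nat"
  have "(\<Sum>m | (\<Sum>i\<in>UNIV. m i) = 1. (if m = ?e then 1 else 0) * (\<Prod>i\<in>UNIV. x $ i ^ m i)) = x $ j" for x :: "real ^ 'n"
  proof -
    have "(\<Sum>m | (\<Sum>i\<in>UNIV. m i) = 1. (if m = ?e then 1 else 0) * (\<Prod>i\<in>UNIV. x $ i ^ m i))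
        = (\<Sum>m\<in>{?e}. (if m = ?e then 1 else 0) * (\<Prod>i\<in>UNIV. x $ i ^ m i))"
      by (rule sum.mono_neutral_right) (auto simp: finite_exponents)
    also have "\<dots> = (\<Prod>i\<in>UNIV. if i = j then x $ i else 1)" by (simp add: if_distrib cong: if_cong)
    also have "\<dots> = x $ j" by simp
    finally show ?thesis .
  qed
  then show ?thesis unfolding homogeneous_polynomial_def by (intro exI[of _ "\<lambda>m. if m = ?e then 1 else 0"]) simp
qed

lemma homogeneous_polynomial_cmult:
  "homogeneous_polynomial n f \<Longrightarrow> homogeneous_polynomial n (\<lambda>x. c * f x)"
  using homogeneous_polynomial_mult[OF homogeneous_polynomial_const] by simp

lemma homogeneous_polynomial_diff:
  "homogeneous_polynomial n f \<Longrightarrow> homogeneous_polynomial n g \<Longrightarrow> homogeneous_polynomial n (\<lambda>x. f x - g x)"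
  using homogeneous_polynomial_add[OF _ homogeneous_polynomial_cmult[of n g "- 1"], of f] by simp

lemma homogeneous_polynomial_power:
  "homogeneous_polynomial n f \<Longrightarrow> homogeneous_polynomial (k * n) (\<lambda>x. f x ^ k)"
  by (induction k) (auto intro: homogeneous_polynomial_const dest: homogeneous_polynomial_mult)

lemma homogeneous_polynomial_real_polynomial_function:
  fixes f :: "real ^ 'n::finite \<Rightarrow> real"
  assumes "homogeneous_polynomial n f"
  shows "real_polynomial_function f"
proof -
  obtain c where "f = (\<lambda>x. \<Sum>m | (\<Sum>i\<in>UNIV. m i) = n. c m * (\<Prod>i\<in>UNIV. x $ i ^ m i))"
    using assms unfolding homogeneous_polynomial_def by blast
  moreover have "real_polynomial_function (\<lambda>x :: real ^ 'n. x $ i ^ k)" for i k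
    by (intro real_polynomial_function_power real_polynomial_function.intros(1) bounded_linear_vec_nth)
  ultimately show ?thesis
    by (simp only:) (intro real_polynomial_function_sum real_polynomial_function_prod
        real_polynomial_function.intros(2,4) finite_exponents finite)
qed

text \<open>The degrees of \<open>F1\<close> to \<open>F6\<close> are 2, 4, 4, 8, 6 and 10.
  Complex-valued factors are tracked through their real and imaginary parts.\<close>

lemma homogeneous_polynomial_P34: "homogeneous_polynomial 34 (\<lambda>x. P34 (kA_elem x))"
proof -
  note add = homogeneous_polynomial_add and diff = homogeneous_polynomial_diff
    and cmult = homogeneous_polynomial_cmult
  let ?h = "\<lambda>n f. homogeneous_polynomial n (f :: real ^ 6 \<Rightarrow> real)"
  have mult: "?h N (\<lambda>x. f x * g x)" if "?h n f" "?h k g" "N = n + k" for n k N f g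
    unfolding that(3) by (rule homogeneous_polynomial_mult[OF that(1,2)])
  have power: "?h N (\<lambda>x. f x ^ k)" if "?h n f" "N = k * n" for n k N f
    unfolding that(2) by (rule homogeneous_polynomial_power[OF that(1)])
  have a: "?h 1 a_c" and d: "?h 1 d_c"
    unfolding a_c_def[abs_def] d_c_def[abs_def]
    by (intro diff cmult homogeneous_polynomial_coord)+
  have q: "?h 1 (\<lambda>x. Re (q_c x))" "?h 1 (\<lambda>x. Im (q_c x))"
    and p: "?h 1 (\<lambda>x. Re (p_c x))" "?h 1 (\<lambda>x. Im (p_c x))"
    unfolding q_c_def p_c_def complex.sel
    by (intro diff cmult homogeneous_polynomial_coord)+
  let ?hc = "\<lambda>n f. ?h n (\<lambda>x. Re (f x)) \<and> ?h n (\<lambda>x. Im (f x))"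
  have cmul: "?hc N (\<lambda>x. f x * g x)" if "?hc n f" "?hc k g" "N = n + k" for n k N f g
    using that by (auto intro!: add diff mult)
  have cnj: "?hc n (\<lambda>x. cnj (f x))" if "?hc n f" for n f
    using that cmult[of n "\<lambda>x. Im (f x)" "- 1"] by simp
  have cube: "?hc 3 (\<lambda>x. f x ^ 3)" if f: "?hc 1 f" for f
    unfolding power3_eq_cube using cmul[OF cmul[OF f f, of 2] f, of 3] by simp
  have q3: "?hc 3 (\<lambda>x. q_c x ^ 3)" using q by (intro cube) simp
  have u: "?h 2 u_c" and v: "?h 2 v_c"
    unfolding u_c_def[abs_def] v_c_def[abs_def] cmod_power2
    by (rule add; rule power[OF q(1)] power[OF q(2)] power[OF p(1)] power[OF p(2)]; simp)+
  have pq: "?hc 4 (\<lambda>x. p_c x * cnj (q_c x) ^ 3)"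
    using p q by (intro cmul[of 1 _ 3] cube cnj conjI) simp_all
  have RI: "?h 4 R_c" "?h 4 I_c"
    unfolding R_c_def[abs_def] I_c_def[abs_def] using pq by auto
  have a2: "?h 2 (\<lambda>x. (a_c x)\<^sup>2)" and d2: "?h 2 (\<lambda>x. (d_c x)\<^sup>2)"
    by (rule power[OF a] power[OF d]; simp)+
  have rho: "?h 2 rho_c"
    unfolding rho_c_def[abs_def] by (intro add a2 d2 u v)
  have rho3: "?h 6 (\<lambda>x. rho_c x ^ 3)" and rho2: "?h 4 (\<lambda>x. (rho_c x)\<^sup>2)"
    by (rule power[OF rho]; simp)+
  have delta: "?h 2 delta_c"
    unfolding delta_c_def[abs_def] by (intro add diff a2 d2 u v)
  have ad: "?h 1 (\<lambda>x. a_c x + d_c x)" by (rule add[OF a d])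
  have Theta: "?h 5 Theta_c"
    unfolding Theta_c_def[abs_def]
  proof (rule diff)
    show "?h 5 (\<lambda>x. (a_c x + d_c x) * R_c x)" by (rule mult[OF ad RI(1)]) simp
    have "?h 3 (\<lambda>x. (2 * v_c x + 3 * u_c x) * a_c x)"
      by (rule mult[OF add[OF cmult[OF v] cmult[OF u]] a]) simp
    moreover have "?h 3 (\<lambda>x. 3 * u_c x * d_c x)" by (rule mult[OF cmult[OF u] d]) simp
    ultimately show "?h 5 (\<lambda>x. u_c x * ((2 * v_c x + 3 * u_c x) * a_c x - 3 * u_c x * d_c x))"
      by (intro mult[OF u diff]) simp_all
  qed
  have F1: "?h 2 F1" unfolding F1_def[abs_def] by (rule u)
  have F2: "?h 4 F2"
    unfolding F2_def[abs_def]
    by (rule add[OF mult[OF a2 rho] power[OF diff[OF add[OF d2 v] u]]]) simp_all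
  have F3: "?h 4 F3"
    unfolding F3_def[abs_def]
    by (rule add[OF mult[OF power[OF ad refl] rho] power[OF diff[OF v u]]]) simp_all
  have F4: "?h 8 F4"
    unfolding F4_def[abs_def]
    by (rule add[OF mult[OF add[OF a2 d2] rho3] power[OF RI(2)]]) simp_all
  have F5: "?h 6 F5"
  proof -
    have "?hc 3 (\<lambda>x. complex_of_real (u_c x) * p_c x - 3 * q_c x ^ 3)"
    proof
      have "?h 3 (\<lambda>x. u_c x * Re (p_c x) - 3 * Re (q_c x ^ 3))"
        by (rule diff[OF mult[OF u p(1)] cmult]) (use q3 in simp_all)
      then show "?h 3 (\<lambda>x. Re (complex_of_real (u_c x) * p_c x - 3 * q_c x ^ 3))" by simp
      have "?h 3 (\<lambda>x. u_c x * Im (p_c x) - 3 * Im (q_c x ^ 3))"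
        by (rule diff[OF mult[OF u p(2)] cmult]) (use q3 in simp_all)
      then show "?h 3 (\<lambda>x. Im (complex_of_real (u_c x) * p_c x - 3 * q_c x ^ 3))" by simp
    qed
    then have "?h 6 (\<lambda>x. (Re (complex_of_real (u_c x) * p_c x - 3 * q_c x ^ 3))\<^sup>2
        + (Im (complex_of_real (u_c x) * p_c x - 3 * q_c x ^ 3))\<^sup>2)"
      by (intro add power[of 3]) simp_all
    then show ?thesis
      unfolding F5_def[abs_def] cmod_power2
      by (intro add[OF mult[OF power[OF diff[OF d cmult[OF a]] refl] rho2]]) simp_all
  qed
  have F6: "?h 10 F6"
    unfolding F6_def[abs_def]
    by (rule add[OF add[OF mult[OF power[OF delta refl] rho3] mult[OF power[OF RI(2) refl] rho]] power[OF Theta]]) simp_all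
  show ?thesis
    unfolding P34_kA_elem by (rule mult[OF mult[OF mult[OF mult[OF mult[OF F1 F2 refl] F3 refl] F4 refl] F5 refl] F6]) simp
qed

lemma linear_kA_elem: "linear kA_elem"
  unfolding kA_elem_def[abs_def]
  by (intro linearI) (simp_all add: algebra_simps scaleR_add_left del: gm_linear)

text \<open>\<open>kA_coords\<close> has no controlled values off \<open>k_A\<close>, so
  \<open>P34\<close> itself need not be polynomial on all matrices. A linear left inverse of
  \<open>kA_elem\<close> provides the polynomial extension.\<close>

lemma P34_polynomial:
  obtains P where "real_polynomial_function P" "\<And>Z. Z \<in> k_A \<Longrightarrow> P Z = P34 Z"
proof -
  obtain T where T: "linear T" "T \<circ> kA_elem = id"
    using linear_injective_left_inverse[OF linear_kA_elem inj_kA_elem] by blast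
  define P where "P = (\<lambda>x. P34 (kA_elem x)) \<circ> T"
  have "real_polynomial_function P"
    unfolding P_def
  proof (rule real_polynomial_function_compose)
    show "polynomial_function T"
      using T(1) by (intro polynomial_function_bounded_linear) (simp add: linear_conv_bounded_linear)
    show "real_polynomial_function (\<lambda>x. P34 (kA_elem x))"
      by (rule homogeneous_polynomial_real_polynomial_function[OF homogeneous_polynomial_P34])
  qed
  moreover have "P Z = P34 Z" if Z: "Z \<in> k_A" for Z
  proof -
    obtain x where x: "Z = kA_elem x" using Z by (auto simp flip: range_kA_elem)
    have "T (kA_elem x) = x" using fun_cong[OF T(2), of x] by simp
    then show ?thesis unfolding P_def x comp_apply by (simp only:)
  qed
  ultimately show ?thesis by (rule that)
qed

theorem corollary8p4:
  shows "(\<forall>\<theta>. \<forall>Z\<in>k_A. Ad (g_res \<theta>) Z \<in> k_A \<and> P34 (Ad (g_res \<theta>) Z) = P34 Z)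
    \<and> homogeneous_polynomial 34 (\<lambda>x. P34 (kA_elem x))
    \<and> {Z \<in> k_A. L_gen Z \<noteq> g2} = {Z \<in> k_A. P34 Z = 0}
    \<and> {Z \<in> k_A. L_gen Z = g2} = {Z \<in> k_A. P34 Z > 0}
    \<and> real_algebraic_in k_A {Z \<in> k_A. L_gen Z \<noteq> g2}
    \<and> k_A - {Z \<in> k_A. L_gen Z \<noteq> g2} \<noteq> {}
    \<and> real_zariski_open_in k_A (k_A - {Z \<in> k_A. L_gen Z \<noteq> g2})"
proof -
  have gen: "L_gen Z \<noteq> g2 \<longleftrightarrow> P34 Z = 0" and nonneg: "P34 Z \<ge> 0" if Z: "Z \<in> k_A" for Z
  proof -
    obtain a d q p where Z: "Z = Zgen a d q p" using Z by (rule k_A_E)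
    show "L_gen Z \<noteq> g2 \<longleftrightarrow> P34 Z = 0"
      unfolding Z P34_eq_0_iff using L_gen_eq_g2 nongenerating_proper by blast
    show "P34 Z \<ge> 0" unfolding Z by (rule P34_nonneg)
  qed
  have N: "{Z \<in> k_A. L_gen Z \<noteq> g2} = {Z \<in> k_A. P34 Z = 0}" using gen by blast
  have pos: "{Z \<in> k_A. L_gen Z = g2} = {Z \<in> k_A. P34 Z > 0}"
    using gen nonneg by (auto simp: less_le)
  obtain P where P: "real_polynomial_function P" "\<And>Z. Z \<in> k_A \<Longrightarrow> P Z = P34 Z"
    by (rule P34_polynomial) blast
  have alg: "real_algebraic_in k_A {Z \<in> k_A. L_gen Z \<noteq> g2}"
    unfolding real_algebraic_in_def N using P by (intro exI[of _ "{P}"]) auto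
  \<comment> \<open>A generating point: q and a are nonzero, a + d = 1, d differs from 3a, and delta
    = 1 + 1 - 0 - 1 = 1, so every condition fails.\<close>
  have "\<not> nongenerating 1 0 1 \<i>"
    by (simp add: nongenerating_def)
  then have "P34 (Zgen 1 0 1 \<i>) \<noteq> 0" by (simp add: P34_eq_0_iff)
  then have ne: "k_A - {Z \<in> k_A. L_gen Z \<noteq> g2} \<noteq> {}"
    unfolding N using Zgen_in_k_A[of 1 0 1 \<i>] by blast
  have "k_A - (k_A - {Z \<in> k_A. L_gen Z \<noteq> g2}) = {Z \<in> k_A. L_gen Z \<noteq> g2}" by blast
  then have "real_zariski_open_in k_A (k_A - {Z \<in> k_A. L_gen Z \<noteq> g2})"
    using alg by (simp add: real_zariski_open_in_def)
  then show ?thesis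
    using P34_Ad_g_res homogeneous_polynomial_P34 N pos alg ne by blast
qed

end
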